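(* In each of the following five cases, the potential $V_1(x)$ is orbifold equivalent to the potential $V_2(y)$ (all polynomials having complex coefficients, with variable weights normalised so that each potential has weight $2$): (1) $V_1(x) = x_1^6 + x_2^2$ and $V_2(y) = y_1^3 + y_2^3$; (2) $V_1(x) = x_1^5 x_2 + x_2^3$ and $V_2(y) = y_1^3 y_2 + y_2^5$; (3) $V_1(x) = x_1^6 + x_1 x_2^3 + x_3^2$ and $V_2(y) = y_2 y_3^3 + y_2^3 + y_1^2 y_3$; (4) $V_1(x) = x_1^2 x_3 + x_2 x_3^2 + x_2^4$ and $V_2(y) = -y_1^2 + y_2^4 + y_2 y_3^4$; (5) $V_1(x) = x_1^{10} x_2 + x_2^3$ and $V_2(y) = y_1 y_2^7 + y_1^3 y_2$.
   Context: Potentials. A polynomial $W\in\mathbb{C}[z_1,\dots,z_k]$ is quasi-homogeneous if there are rational weights $|z_i|>0$ such that every monomial of $W$ has the same weight (the weight of $z^{p}$ being $\sum_i p_i|z_i|$). A potential is a quasi-homogeneous polynomial of weight $2$ lying in $\mathfrak m^2$, $\mathfrak m=\langle z_1,\dots,z_k\rangle$, whose Jacobi ring $\mathbb{C}[z]/\langle\partial_{z_1}W,\dots,\partial_{z_k}W\rangle$ is finite-dimensional over $\mathbb{C}$. Graded matrix factorisations. A rank $N$ matrix factorisation of $W$ is a pair of $N\times N$ matrices $E,J$ over $\mathbb{C}[z]$ with $EJ=JE=W\mathbf 1_N$, collected into $Q=\begin{pmatrix} 0 & E \\ J & 0 \end{pmatrix}$, so $Q^2=W\mathbf 1_{2N}$.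 It is graded if there are $g_1,\dots,g_{2N}\in\mathbb{Q}$ such that, with $U(\lambda)=\mathrm{diag}(\lambda^{g_1},\dots,\lambda^{g_{2N}})$, $U(\lambda)\,Q(\lambda^{|z_1|}z_1,\dots,\lambda^{|z_k|}z_k)\,U(\lambda)^{-1}=\lambda\,Q(z)$ for all $\lambda$; equivalently each entry $Q_{rs}$ is quasi-homogeneous of weight $g_s-g_r+1$ (or zero). Matrix factorisations are assumed to have no non-zero constant entries. Supertrace. $\sigma=\mathrm{diag}(\mathbf 1_N,-\mathbf 1_N)$ and $\mathrm{str}(A)=\mathrm{tr}(\sigma A)$. Residue. For $f_1,\dots,f_n\in\mathbb{C}[x_1,\dots,x_n]$ with $\mathbb{C}[x]/\langle f_1,\dots,f_n\rangle$ finite-dimensional and isolated common zero at the origin, $\mathrm{res}_x\left[\frac{g}{f_1\cdots f_n}\right]$ is the Grothendieck residue at $0$ (normalised so that $\mathrm{res}_x[\,1/(x_1\cdots x_n)\,]=1$), extended $\mathbb{C}[y]$-linearly to $g\in\mathbb{C}[x,y]$; similarly $\mathrm{res}_y$. Orbifold equivalence. Let $V_1\in\mathbb{C}[x_1,\dots,x_n]$ and $V_2\in\mathbb{C}[y_1,\dots,y_m]$ be potentials. They are orbifold equivalent if there is a graded matrix factorisation $Q(x,y)$ (of some finite rank) of $V_1(x)-V_2(y)$ such that both quantum dimensions $$q_L(Q)=(-1)^{\binom{m+1}{2}}\,\mathrm{res}_x\left[\frac{\mathrm{str}(\partial_{x_1}Q\cdots\partial_{x_n}Q\,\partial_{y_1}Q\cdots\partial_{y_m}Q)}{\partial_{x_1}V_1\cdots\partial_{x_n}V_1}\right],$$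 $$q_R(Q)=(-1)^{\binom{n+1}{2}}\,\mathrm{res}_y\left[\frac{\mathrm{str}(\partial_{x_1}Q\cdots\partial_{x_n}Q\,\partial_{y_1}Q\cdots\partial_{y_m}Q)}{\partial_{y_1}V_2\cdots\partial_{y_m}V_2}\right]$$ are invertible ($q_L(Q)$ in $\mathbb{C}[y]$, $q_R(Q)$ in $\mathbb{C}[x]$), i.e. non-zero complex numbers. *)

theory Defs
  imports
    Complex_Main
    "HOL-Library.Poly_Mapping"
    "Jordan_Normal_Form.Determinant"
begin

section \<open>Polynomials over the complex numbers\<close>

text \<open>
  Monomials are finitely supported exponent functions, and multiplication on
  \<^typ>\<open>('v \<Rightarrow>\<^sub>0 nat) \<Rightarrow>\<^sub>0 complex\<close> is convolution, so this type is the polynomial ring in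
  the variables of type \<^typ>\<open>'v\<close>. The ring in a smaller set \<open>S\<close> of variables is the
  subring \<open>polys_in S\<close>.
\<close>

type_synonym 'v cpoly = "('v \<Rightarrow>\<^sub>0 nat) \<Rightarrow>\<^sub>0 complex"

definition pvar :: "'v \<Rightarrow> 'v cpoly" where
  "pvar v = Poly_Mapping.single (Poly_Mapping.single v 1) 1"

definition pconst :: "complex \<Rightarrow> 'v cpoly" where
  "pconst c = Poly_Mapping.single 0 c"

definition polys_in :: "'v set \<Rightarrow> 'v cpoly set" where
  "polys_in S = {p. \<forall>\<mu>\<in>Poly_Mapping.keys p. Poly_Mapping.keys \<mu> \<subseteq> S}"

definition pderiv_wrt :: "'v \<Rightarrow> 'v cpoly \<Rightarrow> 'v cpoly" where
  "pderiv_wrt v p =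
     (\<Sum>\<mu>\<in>Poly_Mapping.keys p. Poly_Mapping.single (\<mu> - Poly_Mapping.single v 1)
                                       (of_nat (Poly_Mapping.lookup \<mu> v) * Poly_Mapping.lookup p \<mu>))"

definition ideal_in :: "'v set \<Rightarrow> 'v cpoly set \<Rightarrow> 'v cpoly set" where
  "ideal_in S G = {(\<Sum>g\<in>F. c g * g) |F c. finite F \<and> F \<subseteq> G \<and> c ` F \<subseteq> polys_in S}"

definition invertible_in :: "'v set \<Rightarrow> 'v cpoly \<Rightarrow> bool" where
  "invertible_in S q \<longleftrightarrow> q \<in> polys_in S \<and> (\<exists>u\<in>polys_in S. q * u = 1)"


section \<open>Potentials\<close>

definition monom_weight :: "('v \<Rightarrow> rat) \<Rightarrow> ('v \<Rightarrow>\<^sub>0 nat) \<Rightarrow> rat" where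
  "monom_weight w \<mu> = (\<Sum>v\<in>Poly_Mapping.keys \<mu>. of_nat (Poly_Mapping.lookup \<mu> v) * w v)"

text \<open>The zero polynomial is quasi-homogeneous of every weight.\<close>

definition quasi_homogeneous :: "('v \<Rightarrow> rat) \<Rightarrow> rat \<Rightarrow> 'v cpoly \<Rightarrow> bool" where
  "quasi_homogeneous w d p \<longleftrightarrow> (\<forall>\<mu>\<in>Poly_Mapping.keys p. monom_weight w \<mu> = d)"

definition jacobi_ideal :: "'v set \<Rightarrow> 'v cpoly \<Rightarrow> 'v cpoly set" where
  "jacobi_ideal S W = ideal_in S ((\<lambda>v. pderiv_wrt v W) ` S)"

text \<open>Finite-dimensionality: finitely many elements span the quotient over the complex numbers.\<close>

definition jacobi_ring_finite_dim :: "'v set \<Rightarrow> 'v cpoly \<Rightarrow> bool" where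
  "jacobi_ring_finite_dim S W \<longleftrightarrow>
     (\<exists>B. finite B \<and> B \<subseteq> polys_in S \<and>
          (\<forall>p\<in>polys_in S. \<exists>c. p - (\<Sum>b\<in>B. pconst (c b) * b) \<in> jacobi_ideal S W))"

text \<open>The ideal in the third conjunct is the square of the ideal generated by the variables.\<close>

definition potential :: "('v \<Rightarrow> rat) \<Rightarrow> 'v set \<Rightarrow> 'v cpoly \<Rightarrow> bool" where
  "potential w S W \<longleftrightarrow>
     W \<in> polys_in S \<and>
     (\<forall>v\<in>S. w v > 0) \<and> quasi_homogeneous w 2 W \<and>
     W \<in> ideal_in S {pvar u * pvar v |u v. u \<in> S \<and> v \<in> S} \<and>
     jacobi_ring_finite_dim S W"


section \<open>Graded matrix factorisations\<close>

definition mf_mat :: "nat \<Rightarrow> 'v cpoly mat \<Rightarrow> 'v cpoly mat \<Rightarrow> 'v cpoly mat" where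
  "mf_mat N E J = four_block_mat (0\<^sub>m N N) E J (0\<^sub>m N N)"

definition matrix_factorisation ::
  "'v set \<Rightarrow> 'v cpoly \<Rightarrow> nat \<Rightarrow> 'v cpoly mat \<Rightarrow> 'v cpoly mat \<Rightarrow> bool" where
  "matrix_factorisation S W N E J \<longleftrightarrow>
     E \<in> carrier_mat N N \<and> J \<in> carrier_mat N N \<and>
     elements_mat E \<subseteq> polys_in S \<and> elements_mat J \<subseteq> polys_in S \<and>
     E * J = W \<cdot>\<^sub>m 1\<^sub>m N \<and> J * E = W \<cdot>\<^sub>m 1\<^sub>m N \<and>
     (\<forall>c. c \<noteq> 0 \<longrightarrow> pconst c \<notin> elements_mat E \<and> pconst c \<notin> elements_mat J)"

definition graded_mf :: "('v \<Rightarrow> rat) \<Rightarrow> nat \<Rightarrow> 'v cpoly mat \<Rightarrow> 'v cpoly mat \<Rightarrow> bool" where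
  "graded_mf w N E J \<longleftrightarrow>
     (\<exists>g :: nat \<Rightarrow> rat. \<forall>r < 2 * N. \<forall>s < 2 * N.
        quasi_homogeneous w (g s - g r + 1) (mf_mat N E J $$ (r, s)))"

definition mat_trace :: "'a :: comm_monoid_add mat \<Rightarrow> 'a" where
  "mat_trace A = (\<Sum>i < dim_row A. A $$ (i, i))"

definition supertrace :: "nat \<Rightarrow> 'a :: ring_1 mat \<Rightarrow> 'a" where
  "supertrace N A =
     mat_trace (four_block_mat (1\<^sub>m N) (0\<^sub>m N N) (0\<^sub>m N N) (- 1\<^sub>m N) * A)"

text \<open>Ordered product of the entrywise derivatives of a square matrix along a list of variables.\<close>

definition deriv_prod :: "'v list \<Rightarrow> 'v cpoly mat \<Rightarrow> 'v cpoly mat" where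
  "deriv_prod vs Q = foldr (\<lambda>v A. map_mat (pderiv_wrt v) Q * A) vs (1\<^sub>m (dim_row Q))"


section \<open>The Grothendieck residue at the origin\<close>

text \<open>
  \<open>coeff_wrt S \<alpha> p\<close> is the coefficient of the monomial \<open>\<alpha>\<close> in \<open>p\<close>, where \<open>p\<close> is read as a
  polynomial in the variables from \<open>S\<close> whose coefficients are polynomials in the others.
\<close>

definition coeff_wrt :: "'v set \<Rightarrow> ('v \<Rightarrow>\<^sub>0 nat) \<Rightarrow> 'v cpoly \<Rightarrow> 'v cpoly" where
  "coeff_wrt S \<alpha> p =
     (\<Sum>\<mu> | \<mu> \<in> Poly_Mapping.keys p \<and>
          (\<forall>v\<in>S. Poly_Mapping.lookup \<mu> v = Poly_Mapping.lookup \<alpha> v).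
        Poly_Mapping.single (\<mu> - \<alpha>) (Poly_Mapping.lookup p \<mu>))"

text \<open>
  Let \<open>f\<^sub>1, \<dots>, f\<^sub>n\<close> be polynomials in \<open>x\<^sub>1, \<dots>, x\<^sub>n\<close> whose only common zero is the origin, so that the
  ideal they generate contains a power of every variable. The residue is given by its value on monomial
  denominators (the coefficient of \<open>x\<^sub>1\<^sup>-\<^sup>1 \<cdots> x\<^sub>n\<^sup>-\<^sup>1\<close>) and the transformation law:
  if \<open>x\<^sub>i ^ a\<^sub>i = (\<Sum>j. C\<^sub>i\<^sub>j * f\<^sub>j)\<close> for all \<open>i\<close>, then the residue of \<open>g / (f\<^sub>1 \<cdots> f\<^sub>n)\<close> is that of
  \<open>det C * g / (x\<^sub>1 ^ a\<^sub>1 \<cdots> x\<^sub>n ^ a\<^sub>n)\<close>; the result does not depend on \<open>a\<close> and \<open>C\<close>.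
  Here \<open>g\<close> may contain variables outside \<open>xs\<close>, in which the residue is polynomial and linear.
  For a potential, quasi-homogeneity with positive weights and finite-dimensionality of the Jacobi
  ring imply that the partial derivatives vanish simultaneously only at the origin.
\<close>

definition is_residue :: "'v list \<Rightarrow> 'v cpoly list \<Rightarrow> 'v cpoly \<Rightarrow> 'v cpoly \<Rightarrow> bool" where
  "is_residue xs fs g r \<longleftrightarrow>
     (\<exists>(a :: nat \<Rightarrow> nat) C.
        (\<forall>i < length xs. a i \<ge> 1) \<and>
        C \<in> carrier_mat (length xs) (length xs) \<and>
        elements_mat C \<subseteq> polys_in (set xs) \<and>
        C *\<^sub>v vec_of_list fs = vec (length xs) (\<lambda>i. pvar (xs ! i) ^ a i) \<and>
        r = coeff_wrt (set xs)
              (\<Sum>i < length xs. Poly_Mapping.single (xs ! i) (a i - 1)) (det C * g))"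

definition residue :: "'v list \<Rightarrow> 'v cpoly list \<Rightarrow> 'v cpoly \<Rightarrow> 'v cpoly" where
  "residue xs fs g = (THE r. is_residue xs fs g r)"


section \<open>Orbifold equivalence\<close>

datatype xy = X nat | Y nat

abbreviation x_var :: "nat \<Rightarrow> xy cpoly" where "x_var i \<equiv> pvar (X i)"
abbreviation y_var :: "nat \<Rightarrow> xy cpoly" where "y_var j \<equiv> pvar (Y j)"

definition x_vars :: "nat \<Rightarrow> xy list" where "x_vars n = map X [1..<n + 1]"
definition y_vars :: "nat \<Rightarrow> xy list" where "y_vars m = map Y [1..<m + 1]"

definition q_left :: "nat \<Rightarrow> nat \<Rightarrow> xy cpoly \<Rightarrow> nat \<Rightarrow> xy cpoly mat \<Rightarrow> xy cpoly" where
  "q_left n m V\<^sub>1 N Q =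
     (- 1) ^ ((m + 1) choose 2) *
     residue (x_vars n) (map (\<lambda>v. pderiv_wrt v V\<^sub>1) (x_vars n))
       (supertrace N (deriv_prod (x_vars n @ y_vars m) Q))"

definition q_right :: "nat \<Rightarrow> nat \<Rightarrow> xy cpoly \<Rightarrow> nat \<Rightarrow> xy cpoly mat \<Rightarrow> xy cpoly" where
  "q_right n m V\<^sub>2 N Q =
     (- 1) ^ ((n + 1) choose 2) *
     residue (y_vars m) (map (\<lambda>v. pderiv_wrt v V\<^sub>2) (y_vars m))
       (supertrace N (deriv_prod (x_vars n @ y_vars m) Q))"

text \<open>
  The weights \<open>w\<close> are shared: the grading of the matrix factorisation refers to weights for which both
  potentials have weight 2.
\<close>

definition orbifold_equivalent :: "nat \<Rightarrow> nat \<Rightarrow> xy cpoly \<Rightarrow> xy cpoly \<Rightarrow> bool" where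
  "orbifold_equivalent n m V\<^sub>1 V\<^sub>2 \<longleftrightarrow>
     (\<exists>w. potential w (set (x_vars n)) V\<^sub>1 \<and> potential w (set (y_vars m)) V\<^sub>2 \<and>
        (\<exists>N E J.
           matrix_factorisation (set (x_vars n) \<union> set (y_vars m)) (V\<^sub>1 - V\<^sub>2) N E J \<and>
           graded_mf w N E J \<and>
           invertible_in (set (y_vars m)) (q_left n m V\<^sub>1 N (mf_mat N E J)) \<and>
           invertible_in (set (x_vars n)) (q_right n m V\<^sub>2 N (mf_mat N E J))))"

end

(*
  Each matrix factorisation Q of V1 - V2 is given by explicit matrices. In cases (1) and (4) it is of Koszul
  type, V1 - V2 being a sum of two or three products. In cases (2) and (5) it is the Koszul factorisation
  of an expression a d + b c over the extension by a square root of a polynomial N, written out over the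
  polynomial ring. In case (3) V1 - V2 = x3^2 + C^2 for a 6 x 6 matrix C, and Q consists of x3 + iC and x3 - iC.
  The unknown coefficients are algebraic numbers; in case (2) they describe a section of a rational
  elliptic surface.

  The residue is determined by the transformation law. By quasi-homogeneity the quantum dimensions have
  weight 0, so they are constants and the remaining variables may be set to 0 before the supertrace is
  computed; the transformation law turns the residue into a single coefficient, which is seen to be nonzero.
*)
theory Submission
  imports Defs
begin

section \<open>Polynomials and derivatives\<close>

text \<open>A Koszul factorisation exists whenever V1 - V2 lies in the ideal of two or three
  polynomials, that is, when it vanishes suitably on their common zeros. In cases (2) and (5) these
  zeros are parametrised with a square root, so the Koszul factors live in a quadratic extension and
  the rank doubles. In case (2) the vanishing amounts to one polynomial equation, which becomes a
  Weierstrass equation after completing the square.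

  Two obstacles shape the rest. \<open>residue\<close> is a definite description, so nothing can be
  read off from a certificate before any two certificates have been compared; this needs an argument
  with adjugates modulo powers of the variables. And the factorisations have to be verified with
  symbolic coefficients: each identity is an unconditional polynomial identity plus explicit
  multiples of relations between the coefficients. The existence of numbers satisfying the
  relations, and the nonvanishing of two expressions in them, thereby become separate questions over
  the complex numbers.\<close>

abbreviation lk :: "('a \<Rightarrow>\<^sub>0 'b::zero) \<Rightarrow> 'a \<Rightarrow> 'b" where "lk \<equiv> Poly_Mapping.lookup"
abbreviation keys :: "('a \<Rightarrow>\<^sub>0 'b::zero) \<Rightarrow> 'a set" where "keys \<equiv> Poly_Mapping.keys"
abbreviation single :: "'a \<Rightarrow> 'b::zero \<Rightarrow> ('a \<Rightarrow>\<^sub>0 'b)" where "single \<equiv> Poly_Mapping.single"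

text \<open>Every polynomial is a finite sum of terms. Applied to both factors in turn, this reduces
  the product rules for derivatives and for setting variables to zero to products of two
  terms.\<close>

lemma poly_mapping_single_induct [case_names single add]:
  fixes p :: "'a \<Rightarrow>\<^sub>0 'b::comm_monoid_add"
  assumes "\<And>\<mu> c. P (single \<mu> c)" and "\<And>p q. P p \<Longrightarrow> P q \<Longrightarrow> P (p + q)"
  shows "P p"
proof -
  have z: "P 0" using assms(1)[of undefined 0] by simp
  have s: "P (\<Sum>\<mu>\<in>A. single \<mu> (f \<mu>))" if "finite A" for A f
    using that by (induction A) (auto intro: z assms)
  have "p = (\<Sum>\<mu>\<in>keys p. single \<mu> (lk p \<mu>))"
    by (rule poly_mapping_eqI) (auto simp: lookup_sum lookup_single when_def in_keys_iff)
  then show ?thesis using s[of "keys p" "lk p"] by simp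
qed

lemma pconst_0 [simp]: "pconst 0 = 0" by (simp add: pconst_def)
lemma pconst_1 [simp]: "pconst 1 = 1" by (simp add: pconst_def)
lemma pconst_add: "pconst (a + b) = pconst a + pconst b" by (simp add: pconst_def single_add)
lemma pconst_diff: "pconst (a - b) = pconst a - pconst b" by (simp add: pconst_def single_diff)
lemma pconst_uminus: "pconst (- a) = - pconst a" by (simp add: pconst_def single_uminus)
lemma pconst_mult: "pconst (a * b) = pconst a * pconst b" by (simp add: pconst_def mult_single)
lemma pconst_power: "pconst (a ^ n) = pconst a ^ n" by (induction n) (simp_all add: pconst_mult)
lemma pconst_numeral [simp]: "pconst (numeral n) = numeral n" by (simp add: pconst_def)
lemma pconst_of_nat [simp]: "pconst (of_nat n) = of_nat n" by (simp add: pconst_def)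
lemmas pconst_hom = pconst_add pconst_diff pconst_uminus pconst_mult pconst_power

lemma of_nat_eq_pconst: "of_nat n = pconst (of_nat n)" by simp
lemma numeral_eq_pconst: "numeral n = pconst (numeral n)" by simp

lemma pvar_power: "pvar v ^ n = single (single v n) 1"
  by (induction n) (simp_all add: pvar_def mult_single single_add[symmetric])

lemma polys_inI: "(\<And>\<mu>. \<mu> \<in> keys p \<Longrightarrow> keys \<mu> \<subseteq> S) \<Longrightarrow> p \<in> polys_in S"
  by (auto simp: polys_in_def)
lemma polys_in_0 [simp, intro]: "0 \<in> polys_in S" by (simp add: polys_in_def)
lemma polys_in_1 [simp, intro]: "1 \<in> polys_in S" by (simp add: polys_in_def)
lemma polys_in_pconst [simp, intro]: "pconst c \<in> polys_in S" by (simp add: polys_in_def pconst_def)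
lemma polys_in_numeral [simp, intro]: "numeral n \<in> polys_in S"
  by (subst numeral_eq_pconst) (rule polys_in_pconst)
lemma polys_in_of_nat [simp, intro]: "of_nat n \<in> polys_in S"
  by (subst of_nat_eq_pconst) (rule polys_in_pconst)
lemma polys_in_pvar [intro]: "v \<in> S \<Longrightarrow> pvar v \<in> polys_in S" by (simp add: polys_in_def pvar_def)
lemma polys_in_add [intro]: "p \<in> polys_in S \<Longrightarrow> q \<in> polys_in S \<Longrightarrow> p + q \<in> polys_in S"
  using Poly_Mapping.keys_add[of p q] by (fastforce simp: polys_in_def)
lemma polys_in_uminus [intro]: "p \<in> polys_in S \<Longrightarrow> - p \<in> polys_in S"
  by (auto simp: polys_in_def in_keys_iff)
lemma polys_in_diff [intro]: "p \<in> polys_in S \<Longrightarrow> q \<in> polys_in S \<Longrightarrow> p - q \<in> polys_in S"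
  using polys_in_add[OF _ polys_in_uminus, of p S q] by simp
lemma polys_in_mult [intro]: "p \<in> polys_in S \<Longrightarrow> q \<in> polys_in S \<Longrightarrow> p * q \<in> polys_in S"
proof (rule polys_inI)
  fix \<mu> assume pq: "p \<in> polys_in S" "q \<in> polys_in S" and "\<mu> \<in> keys (p * q)"
  then obtain a b where "\<mu> = a + b" "a \<in> keys p" "b \<in> keys q" using keys_mult[of p q] by auto
  with pq show "keys \<mu> \<subseteq> S" using Poly_Mapping.keys_add[of a b] by (fastforce simp: polys_in_def)
qed
lemma polys_in_power [intro]: "p \<in> polys_in S \<Longrightarrow> p ^ n \<in> polys_in S"
  by (induction n) auto
lemma polys_in_sum [intro]: "(\<And>i. i \<in> A \<Longrightarrow> f i \<in> polys_in S) \<Longrightarrow> sum f A \<in> polys_in S"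
  by (induction A rule: infinite_finite_induct) auto
lemma polys_in_mono: "p \<in> polys_in S \<Longrightarrow> S \<subseteq> T \<Longrightarrow> p \<in> polys_in T"
  by (auto simp: polys_in_def)

section \<open>Formal partial derivatives\<close>

lemma lookup_pderiv:
  "lk (pderiv_wrt v p) \<mu> = of_nat (lk \<mu> v + 1) * lk p (\<mu> + single v 1)"
proof -
  \<comment> \<open>Exponents are natural numbers, so \<open>\<nu> - single v 1\<close> is truncated
    when \<open>v\<close> does not occur in \<nu>. The factor \<open>lk \<nu> v\<close> is then 0;
    in all other cases the shift can be undone.\<close>
  have e: "lk (single (\<nu> - single v 1) (of_nat (lk \<nu> v) * lk p \<nu>)) \<mu>
     = (if \<nu> = \<mu> + single v 1 then of_nat (lk \<mu> v + 1) * lk p \<nu> else 0)" for \<nu>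
  proof (cases "lk \<nu> v = 0")
    case True
    then have "\<nu> \<noteq> \<mu> + single v 1" by (auto simp: lookup_add)
    with True show ?thesis by simp
  next
    case False
    then have "\<nu> - single v 1 = \<mu> \<longleftrightarrow> \<nu> = \<mu> + single v 1"
      by (auto simp: poly_mapping_eq_iff fun_eq_iff lookup_add lookup_minus lookup_single when_def)
    then show ?thesis by (auto simp: lookup_single when_def lookup_add)
  qed
  show ?thesis unfolding pderiv_wrt_def lookup_sum e
    by (simp add: sum.delta' in_keys_iff)
qed

lemma pderiv_add: "pderiv_wrt v (p + q) = pderiv_wrt v p + pderiv_wrt v q"
  by (rule poly_mapping_eqI) (simp add: lookup_pderiv lookup_add algebra_simps)
lemma pderiv_uminus: "pderiv_wrt v (- p) = - pderiv_wrt v p"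
  by (rule poly_mapping_eqI) (simp add: lookup_pderiv)
lemma pderiv_diff: "pderiv_wrt v (p - q) = pderiv_wrt v p - pderiv_wrt v q"
  using pderiv_add[of v p "-q"] by (simp add: pderiv_uminus)
lemma pderiv_single: "pderiv_wrt v (single \<mu> c) = single (\<mu> - single v 1) (of_nat (lk \<mu> v) * c)"
  by (cases "c = 0") (simp_all add: pderiv_wrt_def)
lemma pderiv_0 [simp]: "pderiv_wrt v 0 = 0" by (simp add: pderiv_wrt_def)
lemma pderiv_pconst [simp]: "pderiv_wrt v (pconst c) = 0" by (simp add: pconst_def pderiv_single)
lemma pderiv_1 [simp]: "pderiv_wrt v 1 = 0" using pderiv_pconst[of v 1] by simp
lemma pderiv_numeral [simp]: "pderiv_wrt v (numeral n) = 0"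
  by (subst numeral_eq_pconst) (rule pderiv_pconst)
lemma pderiv_pvar: "pderiv_wrt v (pvar u) = (if u = v then 1 else 0)"
  by (auto simp: pvar_def pderiv_single lookup_single when_def)

lemma pderiv_mult: "pderiv_wrt v (p * q) = pderiv_wrt v p * q + p * pderiv_wrt v q"
proof (induction p rule: poly_mapping_single_induct)
  case (single \<mu> c)
  show ?case
  proof (induction q rule: poly_mapping_single_induct)
    case (single \<nu> d)
    \<comment> \<open>Moving \<nu> across the truncated subtraction is wrong when \<open>v\<close>
      does not occur in \<mu>, but then both coefficients are 0.\<close>
    have a: "single (\<mu> + \<nu> - single v 1) (of_nat (lk \<mu> v) * c * d)
        = single ((\<mu> - single v 1) + \<nu>) (of_nat (lk \<mu> v) * c * d)" for \<mu> \<nu> :: "'a \<Rightarrow>\<^sub>0 nat" and c d :: complex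
    proof (cases "lk \<mu> v = 0")
      case False
      then have "\<mu> + \<nu> - single v 1 = (\<mu> - single v 1) + \<nu>"
        by (auto simp: poly_mapping_eq_iff fun_eq_iff lookup_add lookup_minus lookup_single when_def)
      then show ?thesis by simp
    qed simp
    have "pderiv_wrt v (single \<mu> c * single \<nu> d)
       = single (\<mu> + \<nu> - single v 1) (of_nat (lk \<mu> v) * c * d)
        + single (\<nu> + \<mu> - single v 1) (of_nat (lk \<nu> v) * d * c)"
      by (simp add: mult_single pderiv_single lookup_add algebra_simps single_add[symmetric])
    also have "\<dots> = pderiv_wrt v (single \<mu> c) * single \<nu> d + single \<mu> c * pderiv_wrt v (single \<nu> d)"
      unfolding a by (simp add: mult_single pderiv_single algebra_simps)
    finally show ?case .
  next
    case (add p q)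
    then show ?case by (simp add: distrib_left pderiv_add algebra_simps)
  qed
next
  case (add p q)
  then show ?case by (simp add: distrib_right pderiv_add algebra_simps)
qed

lemma pderiv_power: "pderiv_wrt v (p ^ n) = of_nat n * p ^ (n - 1) * pderiv_wrt v p"
proof (induction n)
  case (Suc n)
  then show ?case by (cases n) (simp_all add: pderiv_mult algebra_simps)
qed simp

lemma pderiv_power_numeral:
  "pderiv_wrt v (p ^ numeral n) = numeral n * p ^ (numeral n - 1) * pderiv_wrt v p"
  by (subst pderiv_power) simp

lemmas pderiv_simps = pderiv_add pderiv_diff pderiv_uminus pderiv_mult pderiv_power_numeral pderiv_pvar

lemma polys_in_pderiv [intro]: "p \<in> polys_in S \<Longrightarrow> pderiv_wrt v p \<in> polys_in S"
proof (rule polys_inI)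
  fix \<mu> assume p: "p \<in> polys_in S" and "\<mu> \<in> keys (pderiv_wrt v p)"
  then have "\<mu> + single v 1 \<in> keys p" by (auto simp: in_keys_iff lookup_pderiv)
  with p have "keys (\<mu> + single v 1) \<subseteq> S" by (auto simp: polys_in_def)
  moreover have "keys \<mu> \<subseteq> keys (\<mu> + single v 1)" by (auto simp: in_keys_iff lookup_add)
  ultimately show "keys \<mu> \<subseteq> S" by blast
qed

section \<open>Weights and quasi-homogeneity\<close>

lemma monom_weight_superset:
  "finite A \<Longrightarrow> keys \<mu> \<subseteq> A \<Longrightarrow> monom_weight w \<mu> = (\<Sum>v\<in>A. of_nat (lk \<mu> v) * w v)"
  unfolding monom_weight_def by (rule sum.mono_neutral_left) (auto simp: in_keys_iff)

lemma monom_weight_add: "monom_weight w (\<mu> + \<nu>) = monom_weight w \<mu> + monom_weight w \<nu>"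
  using Poly_Mapping.keys_add[of \<mu> \<nu>]
  by (simp add: monom_weight_superset[of "keys \<mu> \<union> keys \<nu>"] lookup_add distrib_right sum.distrib)

lemma monom_weight_single: "monom_weight w (single v n) = of_nat n * w v"
  by (simp add: monom_weight_def)

lemma monom_weight_0 [simp]: "monom_weight w 0 = 0" by (simp add: monom_weight_def)

lemma quasi_homogeneous_0 [simp, intro]: "quasi_homogeneous w d 0" by (simp add: quasi_homogeneous_def)
lemma quasi_homogeneous_pconst: "quasi_homogeneous w 0 (pconst c)"
  by (simp add: quasi_homogeneous_def pconst_def)
lemma quasi_homogeneous_1: "quasi_homogeneous w 0 1"
  by (simp add: quasi_homogeneous_def)
lemma quasi_homogeneous_numeral: "quasi_homogeneous w 0 (numeral n)"
  by (subst numeral_eq_pconst) (rule quasi_homogeneous_pconst)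
lemma quasi_homogeneous_pvar: "quasi_homogeneous w (w v) (pvar v)"
  by (simp add: quasi_homogeneous_def pvar_def monom_weight_single)
lemma quasi_homogeneous_add:
  "quasi_homogeneous w d p \<Longrightarrow> quasi_homogeneous w d q \<Longrightarrow> quasi_homogeneous w d (p + q)"
  using Poly_Mapping.keys_add[of p q] by (auto simp: quasi_homogeneous_def)
lemma quasi_homogeneous_uminus: "quasi_homogeneous w d p \<Longrightarrow> quasi_homogeneous w d (- p)"
  by (simp add: quasi_homogeneous_def in_keys_iff)
lemma quasi_homogeneous_diff:
  "quasi_homogeneous w d p \<Longrightarrow> quasi_homogeneous w d q \<Longrightarrow> quasi_homogeneous w d (p - q)"
  using quasi_homogeneous_add[OF _ quasi_homogeneous_uminus, of w d p q] by simp
lemma quasi_homogeneous_mult: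
  "quasi_homogeneous w a p \<Longrightarrow> quasi_homogeneous w b q \<Longrightarrow> quasi_homogeneous w (a + b) (p * q)"
  using keys_mult[of p q] by (fastforce simp: quasi_homogeneous_def monom_weight_add)
lemma quasi_homogeneous_power:
  "quasi_homogeneous w a p \<Longrightarrow> quasi_homogeneous w (of_nat n * a) (p ^ n)"
proof (induction n)
  case (Suc n)
  from quasi_homogeneous_mult[OF Suc.prems Suc.IH[OF Suc.prems]] show ?case by (simp add: algebra_simps)
qed (simp add: quasi_homogeneous_1)
lemma quasi_homogeneous_sum:
  "(\<And>i. i \<in> A \<Longrightarrow> quasi_homogeneous w d (f i)) \<Longrightarrow> quasi_homogeneous w d (sum f A)"
  by (induction A rule: infinite_finite_induct) (auto intro: quasi_homogeneous_add)
lemma quasi_homogeneous_pderiv: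
  assumes "quasi_homogeneous w d p" shows "quasi_homogeneous w (d - w v) (pderiv_wrt v p)"
  unfolding quasi_homogeneous_def
proof
  fix \<mu> assume "\<mu> \<in> keys (pderiv_wrt v p)"
  then have "\<mu> + single v 1 \<in> keys p" by (auto simp: in_keys_iff lookup_pderiv)
  with assms have "monom_weight w (\<mu> + single v 1) = d" by (auto simp: quasi_homogeneous_def)
  then show "monom_weight w \<mu> = d - w v" by (simp add: monom_weight_add monom_weight_single)
qed

section \<open>Setting variables to zero\<close>

definition zero_vars :: "'v set \<Rightarrow> 'v cpoly \<Rightarrow> 'v cpoly" where
  "zero_vars T = Poly_Mapping.mapp (\<lambda>\<mu> c. c when keys \<mu> \<inter> T = {})"

lemma lookup_zero_vars: "lk (zero_vars T p) \<mu> = (lk p \<mu> when keys \<mu> \<inter> T = {})"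
  by (auto simp: zero_vars_def lookup_mapp when_def in_keys_iff)

lemma zero_vars_add: "zero_vars T (p + q) = zero_vars T p + zero_vars T q"
  by (rule poly_mapping_eqI) (simp add: lookup_zero_vars lookup_add when_def)
lemma zero_vars_uminus: "zero_vars T (- p) = - zero_vars T p"
  by (rule poly_mapping_eqI) (simp add: lookup_zero_vars when_def)
lemma zero_vars_diff: "zero_vars T (p - q) = zero_vars T p - zero_vars T q"
  using zero_vars_add[of T p "-q"] by (simp add: zero_vars_uminus)
lemma zero_vars_single: "zero_vars T (single \<mu> c) = (if keys \<mu> \<inter> T = {} then single \<mu> c else 0)"
  by (rule poly_mapping_eqI) (auto simp: lookup_zero_vars lookup_single when_def)
lemma zero_vars_0 [simp]: "zero_vars T 0 = 0"
  by (rule poly_mapping_eqI) (simp add: lookup_zero_vars)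
lemma zero_vars_pconst [simp]: "zero_vars T (pconst c) = pconst c"
  by (simp add: pconst_def zero_vars_single)
lemma zero_vars_1 [simp]: "zero_vars T 1 = 1"
  using zero_vars_pconst[of T 1] by simp
lemma zero_vars_numeral [simp]: "zero_vars T (numeral n) = numeral n"
  by (subst (1 2) numeral_eq_pconst) (rule zero_vars_pconst)
lemma zero_vars_pvar: "zero_vars T (pvar v) = (if v \<in> T then 0 else pvar v)"
  by (simp add: pvar_def zero_vars_single)
lemma zero_vars_mult: "zero_vars T (p * q) = zero_vars T p * zero_vars T q"
proof (induction p rule: poly_mapping_single_induct)
  case (single \<mu> c)
  show ?case
  proof (induction q rule: poly_mapping_single_induct)
    case (single \<nu> d)
    have "keys (\<mu> + \<nu>) = keys \<mu> \<union> keys \<nu>" by (auto simp: in_keys_iff lookup_add)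
    then have "keys (\<mu> + \<nu>) \<inter> T = {} \<longleftrightarrow> keys \<mu> \<inter> T = {} \<and> keys \<nu> \<inter> T = {}" by blast
    then show ?case by (simp add: mult_single zero_vars_single)
  next
    case (add p q)
    then show ?case by (simp add: distrib_left zero_vars_add)
  qed
next
  case (add p q)
  then show ?case by (simp add: distrib_right zero_vars_add)
qed
lemma zero_vars_power: "zero_vars T (p ^ n) = zero_vars T p ^ n"
  by (induction n) (simp_all add: zero_vars_mult)
lemmas zero_vars_simps =
  zero_vars_add zero_vars_diff zero_vars_uminus zero_vars_mult zero_vars_power zero_vars_pvar

text \<open>Provides the compatibility with matrix products and finite sums by which the
  substitution is moved inside a supertrace.\<close>

interpretation zero_vars: comm_ring_hom "zero_vars T" for T
  by unfold_locales (simp_all add: zero_vars_add zero_vars_mult)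

section \<open>Jacobi rings and residues\<close>

lemma ideal_in_0: "0 \<in> ideal_in S G"
  unfolding ideal_in_def by (rule CollectI, rule exI[of _ "{}"]) auto
lemma ideal_in_gen: "g \<in> G \<Longrightarrow> c \<in> polys_in S \<Longrightarrow> c * g \<in> ideal_in S G"
  unfolding ideal_in_def by (rule CollectI, rule exI[of _ "{g}"], rule exI[of _ "\<lambda>_. c"]) auto
lemma ideal_in_add:
  assumes "p \<in> ideal_in S G" "q \<in> ideal_in S G" shows "p + q \<in> ideal_in S G"
proof -
  from assms obtain F1 c1 F2 c2 where
    1: "p = (\<Sum>g\<in>F1. c1 g * g)" "finite F1" "F1 \<subseteq> G" "c1 ` F1 \<subseteq> polys_in S" and
    2: "q = (\<Sum>g\<in>F2. c2 g * g)" "finite F2" "F2 \<subseteq> G" "c2 ` F2 \<subseteq> polys_in S"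
    unfolding ideal_in_def by blast
  let ?c = "\<lambda>g. (if g \<in> F1 then c1 g else 0) + (if g \<in> F2 then c2 g else 0)"
  have "p = (\<Sum>g\<in>F1 \<union> F2. (if g \<in> F1 then c1 g else 0) * g)"
    unfolding 1 using 1 2 by (intro sum.mono_neutral_cong_left) auto
  moreover have "q = (\<Sum>g\<in>F1 \<union> F2. (if g \<in> F2 then c2 g else 0) * g)"
    unfolding 2 using 1 2 by (intro sum.mono_neutral_cong_left) auto
  ultimately have "p + q = (\<Sum>g\<in>F1 \<union> F2. ?c g * g)"
    by (simp add: sum.distrib distrib_right)
  moreover have "?c ` (F1 \<union> F2) \<subseteq> polys_in S" using 1(4) 2(4) by (auto simp: image_subset_iff)
  ultimately show ?thesis unfolding ideal_in_def using 1 2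
    by (intro CollectI exI[of _ "F1 \<union> F2"] exI[of _ ?c]) auto
qed
lemma ideal_in_mult:
  assumes "p \<in> ideal_in S G" "r \<in> polys_in S" shows "r * p \<in> ideal_in S G"
proof -
  from assms obtain F c where
    1: "p = (\<Sum>g\<in>F. c g * g)" "finite F" "F \<subseteq> G" "c ` F \<subseteq> polys_in S"
    unfolding ideal_in_def by blast
  have "r * p = (\<Sum>g\<in>F. (r * c g) * g)" unfolding 1 by (simp add: sum_distrib_left mult.assoc)
  then show ?thesis unfolding ideal_in_def using 1 assms(2)
    by (intro CollectI exI[of _ F] exI[of _ "\<lambda>g. r * c g"]) auto
qed
lemma ideal_in_sum:
  "(\<And>i. i \<in> A \<Longrightarrow> f i \<in> ideal_in S G) \<Longrightarrow> sum f A \<in> ideal_in S G"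
  by (induction A rule: infinite_finite_induct) (auto intro: ideal_in_0 ideal_in_add)

lemma poly_expand: "p = (\<Sum>\<mu>\<in>keys p. single \<mu> (lk p \<mu>))"
  by (rule poly_mapping_eqI) (auto simp: lookup_sum lookup_single when_def in_keys_iff)

text \<open>A monomial outside \<open>M\<close> has an exponent of at least \<open>a v\<close> at
  some \<open>v\<close> and is a multiple of a power in the ideal, so the finitely many monomials in
  \<open>M\<close> span the quotient.\<close>

lemma jacobi_ring_finite_dimI:
  assumes S: "finite S" and a: "\<And>v. v \<in> S \<Longrightarrow> pvar v ^ a v \<in> jacobi_ideal S W"
  shows "jacobi_ring_finite_dim S W"
proof -
  define M where "M = {\<mu>. keys \<mu> \<subseteq> S \<and> (\<forall>v\<in>S. lk \<mu> v < a v)}"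
  define e :: "('a \<Rightarrow>\<^sub>0 nat) \<Rightarrow> 'a cpoly" where "e = (\<lambda>\<mu>. single \<mu> 1)"
  have inje: "inj_on e M"
    by (rule inj_onI) (metis e_def keys_single singleton_inject zero_neq_one)
  have "inj_on (\<lambda>\<mu>. restrict (lk \<mu>) S) M"
  proof (rule inj_onI, rule poly_mapping_eqI)
    fix \<mu> \<nu> v assume "\<mu> \<in> M" "\<nu> \<in> M" and eq: "restrict (lk \<mu>) S = restrict (lk \<nu>) S"
    then have "keys \<mu> \<subseteq> S" "keys \<nu> \<subseteq> S" by (auto simp: M_def)
    moreover have "lk \<mu> v = lk \<nu> v" if "v \<in> S"
      using fun_cong[OF eq, of v] that by (simp only: restrict_apply if_True)
    moreover have "lk \<mu> v = 0" "lk \<nu> v = 0" if "v \<notin> S"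
      using that calculation by (meson in_keys_iff subsetD)+
    ultimately show "lk \<mu> v = lk \<nu> v" by metis
  qed
  moreover have "(\<lambda>\<mu>. restrict (lk \<mu>) S) ` M \<subseteq> (\<Pi>\<^sub>E v\<in>S. {..<a v})" by (auto simp: M_def)
  ultimately have finM: "finite M" by (rule inj_on_finite) (auto intro: finite_PiE S)
  have "e ` M \<subseteq> polys_in S" by (auto simp: e_def M_def polys_in_def)
  moreover have "\<exists>c. p - (\<Sum>b\<in>e ` M. pconst (c b) * b) \<in> jacobi_ideal S W" if p: "p \<in> polys_in S" for p
  proof
    \<comment> \<open>The definition indexes the scalars by the spanning polynomials and not by
      their exponents, hence the detour through the inverse of \<open>e\<close>.\<close>
    let ?c = "\<lambda>b. lk p (inv_into M e b)"
    have "(\<Sum>b\<in>e ` M. pconst (?c b) * b) = (\<Sum>\<mu>\<in>M. single \<mu> (lk p \<mu>))"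
      unfolding sum.reindex[OF inje] o_def
    proof (rule sum.cong)
      fix \<mu> assume "\<mu> \<in> M"
      then have "inv_into M e (e \<mu>) = \<mu>" by (rule inv_into_f_f[OF inje])
      then show "pconst (lk p (inv_into M e (e \<mu>))) * e \<mu> = single \<mu> (lk p \<mu>)"
        by (simp only: pconst_def) (simp add: e_def mult_single)
    qed simp
    moreover define q where "q = p - (\<Sum>\<mu>\<in>M. single \<mu> (lk p \<mu>))"
    have lq: "lk q \<mu> = (if \<mu> \<in> M then 0 else lk p \<mu>)" for \<mu>
      using finM by (simp add: q_def lookup_minus lookup_sum lookup_single when_def)
    have "single \<mu> (lk q \<mu>) \<in> jacobi_ideal S W" if "\<mu> \<in> keys q" for \<mu>
    proof -
      have m: "\<mu> \<notin> M" "\<mu> \<in> keys p" using that by (auto simp: in_keys_iff lq split: if_splits)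
      with p have k: "keys \<mu> \<subseteq> S" by (auto simp: polys_in_def)
      with m obtain v where v: "v \<in> S" "a v \<le> lk \<mu> v" by (auto simp: M_def not_less)
      have "\<mu> = (\<mu> - single v (a v)) + single v (a v)"
        using v by (auto simp: poly_mapping_eq_iff fun_eq_iff lookup_add lookup_minus lookup_single when_def)
      then have "single \<mu> (lk q \<mu>) = single (\<mu> - single v (a v)) (lk q \<mu>) * pvar v ^ a v"
        by (simp add: pvar_power mult_single)
      moreover have "keys (\<mu> - single v (a v)) \<subseteq> keys \<mu>" by (auto simp: in_keys_iff lookup_minus)
      then have "single (\<mu> - single v (a v)) (lk q \<mu>) \<in> polys_in S"
        using k by (auto simp: polys_in_def split: if_splits)
      ultimately show ?thesis using a[OF v(1)] unfolding jacobi_ideal_def by (simp add: ideal_in_mult)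
    qed
    then have "q \<in> jacobi_ideal S W"
      unfolding jacobi_ideal_def by (subst poly_expand[of q]) (rule ideal_in_sum)
    ultimately show "p - (\<Sum>b\<in>e ` M. pconst (?c b) * b) \<in> jacobi_ideal S W" by (simp add: q_def)
  qed
  ultimately show ?thesis unfolding jacobi_ring_finite_dim_def using finM by (intro exI[of _ "e ` M"]) auto
qed

section \<open>Independence of the residue from the chosen certificate\<close>

lemma lookup_single_mult: "lk (single \<kappa> 1 * p) (\<kappa> + \<mu>) = lk (p :: 'v cpoly) \<mu>"
  by (induction p rule: poly_mapping_single_induct)
    (simp_all add: mult_single lookup_single when_def distrib_left lookup_add)

text \<open>All monomials of \<open>p\<close> lie in the ideal generated by the \<open>pvar (xs ! i) ^ a i\<close> with \<open>i \<in> I\<close>.\<close>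

definition mono_above :: "'v list \<Rightarrow> nat set \<Rightarrow> (nat \<Rightarrow> nat) \<Rightarrow> 'v cpoly \<Rightarrow> bool" where
  "mono_above xs I a p \<longleftrightarrow> (\<forall>\<mu>\<in>keys p. \<exists>i\<in>I. a i \<le> lk \<mu> (xs ! i))"

lemma mono_above_0: "mono_above xs I a 0" by (simp add: mono_above_def)
lemma mono_above_add: "mono_above xs I a p \<Longrightarrow> mono_above xs I a q \<Longrightarrow> mono_above xs I a (p + q)"
  using Poly_Mapping.keys_add[of p q] by (fastforce simp: mono_above_def)
lemma mono_above_mult: "mono_above xs I a p \<Longrightarrow> mono_above xs I a (q * p)"
  unfolding mono_above_def
proof
  fix \<mu> assume p: "\<forall>\<mu>\<in>keys p. \<exists>i\<in>I. a i \<le> lk \<mu> (xs ! i)" and "\<mu> \<in> keys (q * p)"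
  then obtain b c where \<mu>: "\<mu> = b + c" "c \<in> keys p" using keys_mult[of q p] by auto
  with p obtain i where "i \<in> I" "a i \<le> lk c (xs ! i)" by auto
  then show "\<exists>i\<in>I. a i \<le> lk \<mu> (xs ! i)" by (auto simp: \<mu> lookup_add intro!: bexI[of _ i])
qed
lemma mono_above_sum:
  "(\<And>i. i \<in> A \<Longrightarrow> mono_above xs I a (f i)) \<Longrightarrow> mono_above xs I a (sum f A)"
  by (induction A rule: infinite_finite_induct) (auto intro: mono_above_0 mono_above_add)
lemma mono_above_power: "i \<in> I \<Longrightarrow> mono_above xs I a (pvar (xs ! i) ^ a i)"
  by (auto simp: mono_above_def pvar_power intro!: bexI[of _ i])
lemma mono_above_mono: "mono_above xs I a p \<Longrightarrow> I \<subseteq> J \<Longrightarrow> mono_above xs J a p"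
  by (force simp: mono_above_def)
text \<open>The variable \<open>xs ! k\<close> differs from every \<open>xs ! i\<close> with
  \<open>i \<in> I\<close>, so multiplying by its power leaves alone all the exponents that decide
  membership in the monomial ideal.\<close>

lemma mono_above_cancel:
  assumes "mono_above xs I a (pvar (xs ! k) ^ m * p)" "distinct xs" "k < length xs" "I \<subseteq> {..<length xs} - {k}"
  shows "mono_above xs I a p"
  unfolding mono_above_def
proof
  fix \<mu> assume "\<mu> \<in> keys p"
  then have "single (xs ! k) m + \<mu> \<in> keys (pvar (xs ! k) ^ m * p)"
    by (simp add: in_keys_iff pvar_power lookup_single_mult)
  then obtain i where "i \<in> I" "a i \<le> lk (single (xs ! k) m + \<mu>) (xs ! i)"
    using assms(1) by (auto simp: mono_above_def)
  moreover have "xs ! i \<noteq> xs ! k" using \<open>i \<in> I\<close> assms(2-4) by (auto simp: nth_eq_iff_index_eq)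
  ultimately show "\<exists>i\<in>I. a i \<le> lk \<mu> (xs ! i)" by (auto simp: lookup_add lookup_single when_def)
qed

lemma mat_delete_row_cong:
  assumes A: "A \<in> carrier_mat n n" and B: "B \<in> carrier_mat n n"
    and eq: "\<And>i j. i < n \<Longrightarrow> j < n \<Longrightarrow> i \<noteq> k \<Longrightarrow> A $$ (i, j) = B $$ (i, j)"
  shows "mat_delete A k j = mat_delete B k j"
proof (rule eq_matI)
  fix i' j' assume "i' < dim_row (mat_delete B k j)" "j' < dim_col (mat_delete B k j)"
  then have ij: "i' < n - 1" "j' < n - 1" using B by auto
  then have "(if i' < k then i' else Suc i') < n" "(if j' < j then j' else Suc j') < n"
    "(if i' < k then i' else Suc i') \<noteq> k" by auto
  from eq[OF this] show "mat_delete A k j $$ (i', j') = mat_delete B k j $$ (i', j')"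
    using A B ij by (simp add: mat_delete_def)
qed (use A B in auto)

text \<open>Linearity of the determinant in row \<open>k\<close>: in the expansion along this row
  the cofactors do not involve it and are therefore common to all three matrices.\<close>

lemma det_row_diff:
  fixes A B :: "'a::comm_ring_1 mat"
  assumes A: "A \<in> carrier_mat n n" and B: "B \<in> carrier_mat n n" and k: "k < n"
    and eq: "\<And>i j. i < n \<Longrightarrow> j < n \<Longrightarrow> i \<noteq> k \<Longrightarrow> A $$ (i, j) = B $$ (i, j)"
  shows "det A - det B = det (mat n n (\<lambda>(i, j). if i = k then A $$ (i, j) - B $$ (i, j) else A $$ (i, j)))"
    (is "_ = det ?D")
proof -
  have D: "?D \<in> carrier_mat n n" by simp
  have c: "cofactor B k j = cofactor A k j" "cofactor ?D k j = cofactor A k j" if "j < n" for j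
  proof -
    have "mat_delete B k j = mat_delete A k j"
      by (rule mat_delete_row_cong[OF B A]) (simp add: eq)
    moreover have "mat_delete ?D k j = mat_delete A k j"
      by (rule mat_delete_row_cong[OF D A]) simp
    ultimately show "cofactor B k j = cofactor A k j" "cofactor ?D k j = cofactor A k j"
      unfolding cofactor_def by simp_all
  qed
  show ?thesis
    unfolding laplace_expansion_row[OF A k] laplace_expansion_row[OF B k] laplace_expansion_row[OF D k]
    unfolding sum_subtractf[symmetric]
  proof (rule sum.cong)
    fix j assume "j \<in> {..<n}"
    then have j: "j < n" by simp
    show "A $$ (k, j) * cofactor A k j - B $$ (k, j) * cofactor B k j = ?D $$ (k, j) * cofactor ?D k j"
      unfolding c[OF j] left_diff_distrib[symmetric] using j k by simp
  qed simp
qed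

text \<open>The rows of \<open>C\<close> are exchanged for those of \<open>C'\<close> one at a time. The difference \<open>D\<close> of two consecutive
  stages has \<open>(D f)\<^sub>k = 0\<close>, so by Cramer's rule \<open>det D\<close> times each entry of \<open>f\<close>, hence also
  \<open>det D\<close> times the \<open>k\<close>-th power, lies in the ideal of the other powers.\<close>

lemma det_diff_mono_above:
  fixes C C' :: "'v cpoly mat"
  assumes xs: "distinct xs" "length xs = n" and C: "C \<in> carrier_mat n n" and C': "C' \<in> carrier_mat n n"
    and f: "f \<in> carrier_vec n"
    and Cf: "C *\<^sub>v f = vec n (\<lambda>i. pvar (xs ! i) ^ a i)"
    and C'f: "C' *\<^sub>v f = vec n (\<lambda>i. pvar (xs ! i) ^ a i)"
  shows "mono_above xs {..<n} a (det C - det C')"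
proof -
  define M where "M k = mat n n (\<lambda>(i, j). if i < k then C' $$ (i, j) else C $$ (i, j))" for k
  have step: "mono_above xs {..<n} a (det (M k) - det (M (Suc k)))" if k: "k < n" for k
  proof -
    define D where "D = mat n n (\<lambda>(i, j). if i = k then M k $$ (i, j) - M (Suc k) $$ (i, j) else M k $$ (i, j))"
    have D: "D \<in> carrier_mat n n" by (simp add: D_def)
    have diff: "det (M k) - det (M (Suc k)) = det D"
      unfolding D_def using k by (intro det_row_diff) (auto simp: M_def)
    have rowsC: "(\<Sum>j<n. C $$ (i, j) * f $ j) = pvar (xs ! i) ^ a i"
      and rowsC': "(\<Sum>j<n. C' $$ (i, j) * f $ j) = pvar (xs ! i) ^ a i" if "i < n" for i
      using arg_cong[OF Cf, of "\<lambda>v. v $ i"] arg_cong[OF C'f, of "\<lambda>v. v $ i"] that C C' f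
      by (simp_all add: scalar_prod_def atLeast0LessThan)
    have Df: "(D *\<^sub>v f) $ i = (if i = k then 0 else pvar (xs ! i) ^ a i)" if i: "i < n" for i
    proof -
      have "(D *\<^sub>v f) $ i = (\<Sum>j<n. D $$ (i, j) * f $ j)"
        using D f i by (simp add: scalar_prod_def atLeast0LessThan)
      also have "\<dots> = (if i = k then 0 else pvar (xs ! i) ^ a i)"
        using rowsC[OF i] rowsC'[OF i] i
        by (cases "i < k") (auto simp: D_def M_def left_diff_distrib sum_subtractf)
      finally show ?thesis .
    qed
    let ?J = "{..<n} - {k}"
    have detf: "mono_above xs ?J a (det D * f $ l)" if l: "l < n" for l
    proof -
      have "(det D \<cdot>\<^sub>m 1\<^sub>m n) *\<^sub>v f = adj_mat D *\<^sub>v (D *\<^sub>v f)"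
        using adj_mat[OF D] f D by (metis assoc_mult_mat_vec)
      moreover have "((det D \<cdot>\<^sub>m 1\<^sub>m n) *\<^sub>v f) $ l = det D * f $ l"
        using l f by (simp add: scalar_prod_def if_distrib[of "\<lambda>z. _ * z * _"] sum.delta cong: if_cong)
      ultimately have "det D * f $ l = (adj_mat D *\<^sub>v (D *\<^sub>v f)) $ l" by simp
      also have "\<dots> = (\<Sum>i<n. adj_mat D $$ (l, i) * (D *\<^sub>v f) $ i)"
        using adj_mat(1)[OF D] D l
        by (subst index_mult_mat_vec) (auto simp: scalar_prod_def atLeast0LessThan simp del: index_mult_mat_vec)
      also have "\<dots> = (\<Sum>i<n. adj_mat D $$ (l, i) * (if i = k then 0 else pvar (xs ! i) ^ a i))"
        by (simp add: Df del: index_mult_mat_vec)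
      finally have "det D * f $ l = (\<Sum>i<n. adj_mat D $$ (l, i) * (if i = k then 0 else pvar (xs ! i) ^ a i))" .
      then show ?thesis
        by (auto intro!: mono_above_sum mono_above_mult mono_above_power mono_above_0)
    qed
    have "pvar (xs ! k) ^ a k * det D = (\<Sum>j<n. C $$ (k, j) * (det D * f $ j))"
      by (simp add: rowsC[OF k, symmetric] sum_distrib_left mult_ac)
    then have "mono_above xs ?J a (pvar (xs ! k) ^ a k * det D)"
      by (auto intro!: mono_above_sum mono_above_mult detf)
    then have "mono_above xs ?J a (det D)" by (rule mono_above_cancel) (use xs k in auto)
    then show ?thesis unfolding diff by (rule mono_above_mono) auto
  qed
  have "mono_above xs {..<n} a (det (M 0) - det (M k))" if "k \<le> n" for k
    using that
  proof (induction k)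
    case (Suc k)
    have "det (M 0) - det (M (Suc k)) = (det (M 0) - det (M k)) + (det (M k) - det (M (Suc k)))" by simp
    then show ?case using Suc step[of k] by (metis Suc_le_lessD less_imp_le mono_above_add)
  qed (simp add: mono_above_0)
  moreover have "M 0 = C" using C by (auto simp: M_def intro!: eq_matI)
  moreover have "M n = C'" using C' by (auto simp: M_def intro!: eq_matI)
  ultimately show ?thesis by auto
qed

text \<open>As \<alpha> is supported in \<open>S\<close>, an exponent that agrees with \<alpha> on
  \<open>S\<close> dominates it everywhere. The truncated difference then loses no information, and
  at most one monomial contributes to each coefficient.\<close>

lemma lookup_coeff_wrt:
  assumes "keys \<alpha> \<subseteq> S"
  shows "lk (coeff_wrt S \<alpha> p) \<nu> = (lk p (\<alpha> + \<nu>) when keys \<nu> \<inter> S = {})"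
proof -
  have iff: "\<mu> - \<alpha> = \<nu> \<longleftrightarrow> \<mu> = \<alpha> + \<nu> \<and> keys \<nu> \<inter> S = {}" if "\<forall>v\<in>S. lk \<mu> v = lk \<alpha> v" for \<mu>
  proof
    assume "\<mu> - \<alpha> = \<nu>"
    then have \<nu>: "lk \<nu> v = lk \<mu> v - lk \<alpha> v" for v by (auto simp: lookup_minus)
    have "lk \<alpha> v = 0" if "v \<notin> S" for v using assms that by (auto simp: in_keys_iff)
    with \<nu> that have "lk \<mu> v = lk \<alpha> v + lk \<nu> v" for v by (cases "v \<in> S") auto
    moreover have "keys \<nu> \<inter> S = {}" using \<nu> that by (auto simp: in_keys_iff)
    ultimately show "\<mu> = \<alpha> + \<nu> \<and> keys \<nu> \<inter> S = {}"
      by (auto intro: poly_mapping_eqI simp: lookup_add)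
  qed auto
  have "lk (coeff_wrt S \<alpha> p) \<nu> = (\<Sum>\<mu> | \<mu> \<in> keys p \<and> (\<forall>v\<in>S. lk \<mu> v = lk \<alpha> v).
      if \<mu> = \<alpha> + \<nu> then (lk p \<mu> when keys \<nu> \<inter> S = {}) else 0)"
    unfolding coeff_wrt_def lookup_sum by (rule sum.cong) (auto simp: lookup_single when_def iff)
  also have "\<dots> = (lk p (\<alpha> + \<nu>) when keys \<nu> \<inter> S = {})"
  proof -
    have "\<forall>v\<in>S. lk (\<alpha> + \<nu>) v = lk \<alpha> v" if "keys \<nu> \<inter> S = {}"
      using that by (auto simp: lookup_add in_keys_iff)
    then show ?thesis by (auto simp: sum.delta in_keys_iff when_def)
  qed
  finally show ?thesis .
qed

lemma sum_single_lookup: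
  assumes "distinct xs" "i < length xs"
  shows "lk (\<Sum>i<length xs. single (xs ! i) (e i)) (xs ! i) = (e i :: nat)"
proof -
  have "lk (\<Sum>i<length xs. single (xs ! i) (e i)) (xs ! i) = (\<Sum>j<length xs. if j = i then e j else 0)"
    unfolding lookup_sum
    by (rule sum.cong) (use assms in \<open>auto simp: lookup_single when_def nth_eq_iff_index_eq\<close>)
  then show ?thesis using assms by simp
qed

lemma keys_sum_single: "keys (\<Sum>i<length xs. single (xs ! i) (e i :: nat)) \<subseteq> set xs"
proof
  fix v assume "v \<in> keys (\<Sum>i<length xs. single (xs ! i) (e i))"
  then have "(\<Sum>i<length xs. (e i when xs ! i = v)) \<noteq> 0" by (simp add: in_keys_iff lookup_sum lookup_single)
  then obtain i where "i < length xs" "xs ! i = v" by (auto simp: when_def split: if_splits)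
  then show "v \<in> set xs" by auto
qed

lemma prod_pvar_power:
  "finite A \<Longrightarrow> (\<Prod>i\<in>A. pvar (xs ! i) ^ e i) = single (\<Sum>i\<in>A. single (xs ! i) (e i)) 1"
  by (induction A rule: finite_induct) (simp_all add: pvar_power mult_single)

text \<open>Multiplying the rows of both certificates by powers of the variables brings them to the common
  exponents \<open>a + a'\<close>, where the determinants agree up to monomials that do not contribute.\<close>

lemma is_residue_unique:
  assumes xs: "distinct xs" "length fs = length xs"
    and r: "is_residue xs fs g r" "is_residue xs fs g r'"
  shows "r = r'"
proof -
  define n where "n = length xs"
  define f where "f = vec_of_list fs"
  have f: "f \<in> carrier_vec n" unfolding f_def n_def by (rule carrier_vecI) (simp add: xs(2))
  let ?\<alpha> = "\<lambda>e :: nat \<Rightarrow> nat. \<Sum>i<length xs. single (xs ! i) (e i)"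
  from r(1)[unfolded is_residue_def] obtain a C where "\<forall>i<length xs. a i \<ge> 1"
    "C \<in> carrier_mat (length xs) (length xs)"
    "C *\<^sub>v vec_of_list fs = vec (length xs) (\<lambda>i. pvar (xs ! i) ^ a i)"
    "r = coeff_wrt (set xs) (?\<alpha> (\<lambda>i. a i - 1)) (det C * g)"
    by (elim exE conjE) (rule that)
  note 1 = this(1-3)[folded n_def f_def] this(4)
  from r(2)[unfolded is_residue_def] obtain a' C' where "\<forall>i<length xs. a' i \<ge> 1"
    "C' \<in> carrier_mat (length xs) (length xs)"
    "C' *\<^sub>v vec_of_list fs = vec (length xs) (\<lambda>i. pvar (xs ! i) ^ a' i)"
    "r' = coeff_wrt (set xs) (?\<alpha> (\<lambda>i. a' i - 1)) (det C' * g)"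
    by (elim exE conjE) (rule that)
  note 2 = this(1-3)[folded n_def f_def] this(4)
  define b where "b i = a i + a' i" for i
  define B where "B e D = mat\<^sub>r n n (\<lambda>i. pvar (xs ! i) ^ e i \<cdot>\<^sub>v row D i)" for e :: "nat \<Rightarrow> nat" and D
  have Bc: "B e D \<in> carrier_mat n n" for e D by (simp add: B_def)
  have detB: "det (B e D) = single (?\<alpha> e) 1 * det D" if "D \<in> carrier_mat n n" for e D
  proof -
    have "det (B e D) = (\<Prod>i\<in>{0..<n}. pvar (xs ! i) ^ e i) * det (mat\<^sub>r n n (row D))"
      unfolding B_def using that by (intro det_rows_mul) auto
    moreover have "mat\<^sub>r n n (row D) = D" using that by (intro eq_matI) auto
    ultimately show ?thesis by (simp add: prod_pvar_power n_def atLeast0LessThan)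
  qed
  have Bf: "B e D *\<^sub>v f = vec n (\<lambda>i. pvar (xs ! i) ^ b i)"
    if D: "D \<in> carrier_mat n n" "D *\<^sub>v f = vec n (\<lambda>i. pvar (xs ! i) ^ d i)"
      and b: "\<And>i. e i + d i = b i" for e d D
  proof (rule eq_vecI)
    fix i assume "i < dim_vec (vec n (\<lambda>i. pvar (xs ! i) ^ b i))"
    then have i: "i < n" by simp
    then have "row D i \<bullet> f = pvar (xs ! i) ^ d i"
      using arg_cong[OF D(2), of "\<lambda>v. v $ i"] D(1) by simp
    then have "(B e D *\<^sub>v f) $ i = pvar (xs ! i) ^ e i * pvar (xs ! i) ^ d i"
      using i D(1) f by (simp add: B_def)
    then show "(B e D *\<^sub>v f) $ i = vec n (\<lambda>i. pvar (xs ! i) ^ b i) $ i"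
      using i by (simp add: b[symmetric] power_add)
  qed (simp add: B_def)
  have above: "mono_above xs {..<n} b (g * (det (B a' C) - det (B a C')))"
  proof (rule mono_above_mult, rule det_diff_mono_above[OF xs(1) n_def[symmetric] Bc Bc f])
    show "B a' C *\<^sub>v f = vec n (\<lambda>i. pvar (xs ! i) ^ b i)"
      by (rule Bf[OF 1(2,3)]) (simp add: b_def)
    show "B a C' *\<^sub>v f = vec n (\<lambda>i. pvar (xs ! i) ^ b i)"
      by (rule Bf[OF 2(2,3)]) (simp add: b_def)
  qed
  \<comment> \<open>Multiplying row i by a power with exponent \<open>e i\<close> moves the exponent
    that is read off from \<open>d i - 1\<close> to \<open>b i - 1\<close>. This uses
    \<open>d i \<ge> 1\<close>: at 0 the subtraction would truncate.\<close>
  have shift: "lk (det D * g) (?\<alpha> (\<lambda>i. d i - 1) + \<nu>) = lk (g * det (B e D)) (?\<alpha> (\<lambda>i. b i - 1) + \<nu>)"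
    if D: "D \<in> carrier_mat n n" and b: "\<And>i. e i + d i = b i" and d: "\<And>i. i < n \<Longrightarrow> d i \<ge> 1" for e d D \<nu>
  proof -
    have "?\<alpha> (\<lambda>i. b i - 1) = ?\<alpha> e + ?\<alpha> (\<lambda>i. d i - 1)"
      unfolding sum.distrib[symmetric] single_add[symmetric]
    proof (rule sum.cong)
      fix i assume "i \<in> {..<length xs}"
      then show "single (xs ! i) (b i - 1) = single (xs ! i) (e i + (d i - 1))"
        using b[of i] d[of i] by (simp add: n_def)
    qed simp
    moreover have "g * det (B e D) = single (?\<alpha> e) 1 * (det D * g)" by (simp add: detB[OF D] mult_ac)
    ultimately show ?thesis by (simp add: lookup_single_mult add.assoc)
  qed
  show ?thesis
  proof (rule poly_mapping_eqI)
    fix \<nu>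
    show "lk r \<nu> = lk r' \<nu>"
    proof (cases "keys \<nu> \<inter> set xs = {}")
      case False
      then show ?thesis unfolding 1(4) 2(4) by (simp add: lookup_coeff_wrt keys_sum_single)
    next
      case True
      let ?\<mu> = "?\<alpha> (\<lambda>i. b i - 1) + \<nu>"
      \<comment> \<open>The monomial read off has exponent exactly \<open>b i - 1\<close> in each
        variable of \<open>xs\<close>, one too small for the ideal of the powers. The difference of
        the two determinants therefore does not reach it.\<close>
      have "lk ?\<mu> (xs ! i) < b i" if "i < n" for i
      proof -
        have "xs ! i \<notin> keys \<nu>" using True that by (auto simp: n_def)
        then have "lk ?\<mu> (xs ! i) = b i - 1"
          using sum_single_lookup[OF xs(1), of i] that by (simp add: lookup_add in_keys_iff n_def)
        then show ?thesis using 1(1)[rule_format, OF that] by (simp add: b_def)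
      qed
      then have "?\<mu> \<notin> keys (g * (det (B a' C) - det (B a C')))"
        using above by (force simp: mono_above_def not_le)
      then have "lk (g * det (B a' C)) ?\<mu> = lk (g * det (B a C')) ?\<mu>"
        by (simp add: in_keys_iff right_diff_distrib lookup_minus)
      then show ?thesis unfolding 1(4) 2(4) using True
        using shift[OF 1(2) _ 1(1)[rule_format], where e = a' and \<nu> = \<nu>] shift[OF 2(2) _ 2(1)[rule_format], where e = a and \<nu> = \<nu>]
        by (simp add: lookup_coeff_wrt keys_sum_single b_def)
    qed
  qed
qed

lemma residue_eqI:
  "distinct xs \<Longrightarrow> length fs = length xs \<Longrightarrow> is_residue xs fs g r \<Longrightarrow> residue xs fs g = r"
  unfolding residue_def by (rule the_equality) (auto intro: is_residue_unique)

section \<open>Supertraces and quantum dimensions\<close>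

definition lmat :: "nat \<Rightarrow> 'a list list \<Rightarrow> 'a mat" where
  "lmat n rs = mat n n (\<lambda>(i, j). rs ! i ! j)"

abbreviation sqlist :: "nat \<Rightarrow> 'a list list \<Rightarrow> bool" where
  "sqlist n rs \<equiv> length rs = n \<and> (\<forall>r\<in>set rs. length r = n)"

lemma lmat_carrier [simp, intro]: "lmat n rs \<in> carrier_mat n n" by (simp add: lmat_def)
lemma lmat_dim [simp]: "dim_row (lmat n rs) = n" "dim_col (lmat n rs) = n" by (simp_all add: lmat_def)
lemma lmat_index [simp]: "i < n \<Longrightarrow> j < n \<Longrightarrow> lmat n rs $$ (i, j) = rs ! i ! j" by (simp add: lmat_def)

lemma elements_lmat: "sqlist n rs \<Longrightarrow> elements_mat (lmat n rs) \<subseteq> \<Union> (set ` set rs)"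
  by (fastforce dest!: elements_matD intro: nth_mem)

lemma map_lmat: "sqlist n rs \<Longrightarrow> map_mat f (lmat n rs) = lmat n (map (map f) rs)"
  by (rule eq_matI) auto

text \<open>A row times a matrix is formed as a combination of the rows of \<open>B\<close>, by
  recursion over lists only. For explicit entries the simplifier can unfold this without any
  arithmetic of indices.\<close>

definition rowmul :: "nat \<Rightarrow> 'a::semiring_0 list \<Rightarrow> 'a list list \<Rightarrow> 'a list" where
  "rowmul n r B = foldr (\<lambda>(x, b) acc. map2 (+) (map ((*) x) b) acc) (zip r B) (replicate n 0)"

definition lprod :: "nat \<Rightarrow> 'a::semiring_0 list list \<Rightarrow> 'a list list \<Rightarrow> 'a list list" where
  "lprod n A B = map (\<lambda>r. rowmul n r B) A"

lemma rowmul_nth: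
  "length r = length B \<Longrightarrow> (\<forall>b\<in>set B. length b = n) \<Longrightarrow>
    length (rowmul n r B) = n \<and> (\<forall>j<n. rowmul n r B ! j = (\<Sum>k<length B. r ! k * B ! k ! j))"
proof (induction r B rule: list_induct2)
  case (Cons x r b B)
  have s: "(\<Sum>k<Suc (length B). (x # r) ! k * (b # B) ! k ! j) = x * b ! j + (\<Sum>k<length B. r ! k * B ! k ! j)" for j
    by (subst sum.lessThan_Suc_shift) simp
  have "rowmul n (x # r) (b # B) = map2 (+) (map ((*) x) b) (rowmul n r B)" by (simp add: rowmul_def)
  with Cons show ?case by (simp only: length_Cons s) simp
qed (simp add: rowmul_def)

lemma lmat_mult: "sqlist n A \<Longrightarrow> sqlist n B \<Longrightarrow> lmat n A * lmat n B = lmat n (lprod n A B)"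
proof (rule eq_matI)
  fix i j assume A: "sqlist n A" and B: "sqlist n B"
    and "i < dim_row (lmat n (lprod n A B))" "j < dim_col (lmat n (lprod n A B))"
  then have ij: "i < n" "j < n" by auto
  have "(lmat n A * lmat n B) $$ (i, j) = (\<Sum>k<n. A ! i ! k * B ! k ! j)"
    using ij by (simp add: scalar_prod_def atLeast0LessThan)
  also have "\<dots> = rowmul n (A ! i) B ! j"
    using rowmul_nth[of "A ! i" B n] A B ij nth_mem[of i A] by auto
  also have "\<dots> = lmat n (lprod n A B) $$ (i, j)" using ij A by (simp add: lprod_def)
  finally show "(lmat n A * lmat n B) $$ (i, j) = lmat n (lprod n A B) $$ (i, j)" .
qed auto

lemma sqlist_lprod: "sqlist n A \<Longrightarrow> sqlist n B \<Longrightarrow> sqlist n (lprod n A B)"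
  using rowmul_nth[of _ B n] by (auto simp: lprod_def)

section \<open>Products of derivatives: block structure, supertrace and grading\<close>

fun dprod :: "'v cpoly mat \<Rightarrow> 'v cpoly mat \<Rightarrow> 'v list \<Rightarrow> 'v cpoly mat" where
  "dprod E J [] = 1\<^sub>m (dim_row E)"
| "dprod E J (v # vs) = map_mat (pderiv_wrt v) E * dprod J E vs"

lemma dprod_carrier [simp]:
  "E \<in> carrier_mat N N \<Longrightarrow> J \<in> carrier_mat N N \<Longrightarrow> dprod E J vs \<in> carrier_mat N N"
  by (induction vs arbitrary: E J) (auto simp: carrier_matD)

lemma mf_mat_carrier: "E \<in> carrier_mat N N \<Longrightarrow> J \<in> carrier_mat N N \<Longrightarrow> mf_mat N E J \<in> carrier_mat (2 * N) (2 * N)"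
  unfolding mf_mat_def mult_2 by (rule four_block_carrier_mat) auto

lemma map_mf_mat:
  "E \<in> carrier_mat N N \<Longrightarrow> J \<in> carrier_mat N N \<Longrightarrow>
    map_mat (pderiv_wrt v) (mf_mat N E J) = mf_mat N (map_mat (pderiv_wrt v) E) (map_mat (pderiv_wrt v) J)"
  unfolding mf_mat_def by (subst map_four_block_mat[of _ N N _ N _ N]) auto

text \<open>Each derivative of the factorisation is block antidiagonal, so the blocks coming from
  \<open>E\<close> and \<open>J\<close> alternate in a product, and the parity of the number of
  factors decides where the two nonzero blocks stand. All computations can then be done in half the
  size.\<close>

lemma deriv_prod_mf_mat:
  assumes "E \<in> carrier_mat N N" "J \<in> carrier_mat N N"
  shows "deriv_prod vs (mf_mat N E J) =
    (if even (length vs) then four_block_mat (dprod E J vs) (0\<^sub>m N N) (0\<^sub>m N N) (dprod J E vs)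
     else four_block_mat (0\<^sub>m N N) (dprod E J vs) (dprod J E vs) (0\<^sub>m N N))"
proof (induction vs)
  case Nil
  have "dim_row (mf_mat N E J) = N + N" using assms by (simp add: mf_mat_def)
  then show ?case using assms
    by (simp add: deriv_prod_def)
next
  case (Cons v vs)
  have c: "map_mat (pderiv_wrt v) E \<in> carrier_mat N N" "map_mat (pderiv_wrt v) J \<in> carrier_mat N N"
    using assms by auto
  have "deriv_prod (v # vs) (mf_mat N E J) = mf_mat N (map_mat (pderiv_wrt v) E) (map_mat (pderiv_wrt v) J) *
    deriv_prod vs (mf_mat N E J)"
    by (simp add: deriv_prod_def map_mf_mat assms)
  also have "\<dots> = (if even (length (v # vs)) then four_block_mat (dprod E J (v # vs)) (0\<^sub>m N N) (0\<^sub>m N N) (dprod J E (v # vs))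
     else four_block_mat (0\<^sub>m N N) (dprod E J (v # vs)) (dprod J E (v # vs)) (0\<^sub>m N N))"
    unfolding Cons.IH unfolding mf_mat_def using assms c
      left_mult_zero_mat[OF dprod_carrier[OF assms, of vs], of N] left_mult_zero_mat[OF dprod_carrier[OF assms(2,1), of vs], of N]
    by (auto simp: mult_four_block_mat[of _ N N _ N _ N _ _ N _ N])
  finally show ?case .
qed

lemma supertrace_diag:
  assumes "A \<in> carrier_mat N N" "D \<in> carrier_mat N N"
  shows "supertrace N (four_block_mat A (0\<^sub>m N N) (0\<^sub>m N N) D) = mat_trace A - mat_trace D"
proof -
  have "four_block_mat (1\<^sub>m N) (0\<^sub>m N N) (0\<^sub>m N N) (- 1\<^sub>m N) * four_block_mat A (0\<^sub>m N N) (0\<^sub>m N N) D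
     = four_block_mat A (0\<^sub>m N N) (0\<^sub>m N N) (- D)"
    using assms by (subst mult_four_block_mat[of _ N N _ N _ N _ _ N _ N])
      (auto simp: uminus_mult_left_mat[symmetric])
  moreover have "(\<Sum>i<N + N. f i) = (\<Sum>i<N. f i) + (\<Sum>i<N. f (N + i))" for f :: "nat \<Rightarrow> 'a"
    by (simp add: lessThan_atLeast0 sum.atLeastLessThan_concat[of 0 N "N + N" f, symmetric]
        sum.shift_bounds_nat_ivl[of f 0 N N, simplified] add.commute)
  ultimately show ?thesis using assms
    by (simp add: supertrace_def mat_trace_def sum_negf)
qed

lemma supertrace_deriv_prod:
  assumes "E \<in> carrier_mat N N" "J \<in> carrier_mat N N" "even (length vs)"
  shows "supertrace N (deriv_prod vs (mf_mat N E J)) = mat_trace (dprod E J vs) - mat_trace (dprod J E vs)"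
  using assms by (simp add: deriv_prod_mf_mat supertrace_diag)

fun zdprod :: "'v set \<Rightarrow> 'v cpoly mat \<Rightarrow> 'v cpoly mat \<Rightarrow> 'v list \<Rightarrow> 'v cpoly mat" where
  "zdprod T E J [] = 1\<^sub>m (dim_row E)"
| "zdprod T E J (v # vs) = map_mat (\<lambda>p. zero_vars T (pderiv_wrt v p)) E * zdprod T J E vs"

lemma map_zero_vars_dprod:
  "E \<in> carrier_mat N N \<Longrightarrow> J \<in> carrier_mat N N \<Longrightarrow> map_mat (zero_vars T) (dprod E J vs) = zdprod T E J vs"
proof (induction vs arbitrary: E J)
  case Nil
  then show ?case by (auto intro: eq_matI)
next
  case (Cons v vs)
  have m: "map_mat (zero_vars T) (map_mat (pderiv_wrt v) E) = map_mat (\<lambda>p. zero_vars T (pderiv_wrt v p)) E"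
    by (rule eq_matI) auto
  show ?case using Cons
    by (simp add: zero_vars.mat_hom_mult[of _ N N _ N] m)
qed

lemma zero_vars_trace: "A \<in> carrier_mat N N \<Longrightarrow> zero_vars T (mat_trace A) = mat_trace (map_mat (zero_vars T) A)"
  by (simp add: mat_trace_def zero_vars.hom_sum)

text \<open>A derivative lowers the weight of an entry by \<open>w v\<close>, and the differences of
  values of \<open>g\<close> telescope in a product. They cancel on the diagonal, which gives the
  supertrace a weight independent of the chosen grading.\<close>

lemma graded_deriv_prod:
  assumes Q: "Q \<in> carrier_mat M M"
    and q: "\<And>r s. r < M \<Longrightarrow> s < M \<Longrightarrow> quasi_homogeneous w (g s - g r + 1) (Q $$ (r, s))"
  shows "deriv_prod vs Q \<in> carrier_mat M M \<and> (\<forall>r<M. \<forall>s<M.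
    quasi_homogeneous w (g s - g r + (\<Sum>v\<leftarrow>vs. 1 - w v)) (deriv_prod vs Q $$ (r, s)))"
proof (induction vs)
  case Nil
  then show ?case using Q by (auto simp: deriv_prod_def quasi_homogeneous_1)
next
  case (Cons v vs)
  let ?A = "deriv_prod vs Q"
  have eq: "deriv_prod (v # vs) Q = map_mat (pderiv_wrt v) Q * ?A" by (simp add: deriv_prod_def)
  have A: "?A \<in> carrier_mat M M" using Cons by simp
  have "quasi_homogeneous w (g s - g r + (\<Sum>v\<leftarrow>v # vs. 1 - w v)) (deriv_prod (v # vs) Q $$ (r, s))"
    if rs: "r < M" "s < M" for r s
  proof -
    have "deriv_prod (v # vs) Q $$ (r, s) = (\<Sum>k<M. pderiv_wrt v (Q $$ (r, k)) * ?A $$ (k, s))"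
      using rs Q A by (simp add: eq scalar_prod_def atLeast0LessThan)
    moreover have "quasi_homogeneous w ((g k - g r + 1 - w v) + (g s - g k + (\<Sum>v\<leftarrow>vs. 1 - w v)))
        (pderiv_wrt v (Q $$ (r, k)) * ?A $$ (k, s))" if "k < M" for k
      by (rule quasi_homogeneous_mult[OF quasi_homogeneous_pderiv[OF q]]) (use that rs Cons in auto)
    ultimately show ?thesis by (auto intro!: quasi_homogeneous_sum simp: algebra_simps)
  qed
  with A Q show ?case by (simp add: eq)
qed

lemma polys_in_deriv_prod:
  assumes Q: "Q \<in> carrier_mat M M" and q: "\<And>r s. r < M \<Longrightarrow> s < M \<Longrightarrow> Q $$ (r, s) \<in> polys_in S"
  shows "deriv_prod vs Q \<in> carrier_mat M M \<and> (\<forall>r<M. \<forall>s<M. deriv_prod vs Q $$ (r, s) \<in> polys_in S)"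
proof (induction vs)
  case Nil
  then show ?case using Q by (auto simp: deriv_prod_def)
next
  case (Cons v vs)
  then show ?case using Q q
    by (auto simp: deriv_prod_def scalar_prod_def intro!: polys_in_sum polys_in_mult polys_in_pderiv)
qed

lemma supertrace_eq_sum:
  assumes "A \<in> carrier_mat (2 * N) (2 * N)"
  shows "supertrace N A = (\<Sum>i<2 * N. (if i < N then 1 else - 1) * A $$ (i, i))"
proof -
  let ?S = "four_block_mat (1\<^sub>m N) (0\<^sub>m N N) (0\<^sub>m N N) (- 1\<^sub>m N)"
  have "?S * A = mat (2 * N) (2 * N) (\<lambda>(i, j). (if i < N then 1 else - 1) * A $$ (i, j))"
  proof (rule eq_matI)
    fix i j assume "i < dim_row (mat (2 * N) (2 * N) (\<lambda>(i, j). (if i < N then 1 else - 1) * A $$ (i, j)))"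
      "j < dim_col (mat (2 * N) (2 * N) (\<lambda>(i, j). (if i < N then 1 else - 1) * A $$ (i, j)))"
    then have ij: "i < 2 * N" "j < 2 * N" by auto
    have "(?S * A) $$ (i, j) = (\<Sum>k<2 * N. ?S $$ (i, k) * A $$ (k, j))"
      using assms ij by (simp add: scalar_prod_def atLeast0LessThan mult_2)
    also have "\<dots> = (\<Sum>k<2 * N. if k = i then (if i < N then 1 else - 1) * A $$ (k, j) else 0)"
      using ij by (intro sum.cong) (auto simp: mult_2)
    finally show "(?S * A) $$ (i, j) = mat (2 * N) (2 * N) (\<lambda>(i, j). (if i < N then 1 else - 1) * A $$ (i, j)) $$ (i, j)"
      using ij by simp
  qed (use assms in auto)
  then show ?thesis by (simp add: supertrace_def mat_trace_def)
qed

section \<open>Certificates for Jacobi ideals and residues of weight zero\<close>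

lemma polys_in_zero_vars_disjoint:
  assumes "p \<in> polys_in S" "S \<inter> T = {}" shows "zero_vars T p = p"
proof (rule poly_mapping_eqI)
  fix \<mu> show "lk (zero_vars T p) \<mu> = lk p \<mu>"
  proof (cases "\<mu> \<in> keys p")
    case True
    with assms have "keys \<mu> \<inter> T = {}" by (auto simp: polys_in_def)
    then show ?thesis by (simp add: lookup_zero_vars)
  qed (simp add: lookup_zero_vars in_keys_iff when_def)
qed

lemma lookup_pconst_mult: "lk (pconst c * p) \<mu> = c * lk p \<mu>"
  using lookup_single_mult[of 0 "p" \<mu>]
  by (induction p rule: poly_mapping_single_induct)
    (auto simp: pconst_def mult_single lookup_single when_def distrib_left lookup_add)

lemma quasi_homogeneous_pconst_mult: "quasi_homogeneous w d p \<Longrightarrow> quasi_homogeneous w d (pconst c * p)"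
  using quasi_homogeneous_mult[OF quasi_homogeneous_pconst] by simp

lemma pconst_prod: "(\<Prod>i\<in>A. pconst (f i)) = pconst (\<Prod>i\<in>A. f i)"
  by (induction A rule: infinite_finite_induct) (simp_all add: pconst_mult)

text \<open>The matrix from the transformation law, except that row i may yield a nonzero multiple
  of the power. This permits integer coefficients in the explicit certificates.\<close>

definition jacobi_cert :: "'v list \<Rightarrow> 'v cpoly \<Rightarrow> (nat \<Rightarrow> nat) \<Rightarrow> 'v cpoly mat \<Rightarrow> bool" where
  "jacobi_cert xs V a C \<longleftrightarrow> (\<forall>i < length xs. a i \<ge> 1) \<and>
        C \<in> carrier_mat (length xs) (length xs) \<and>
        elements_mat C \<subseteq> polys_in (set xs) \<and>
        (\<exists>m. (\<forall>i < length xs. m i \<noteq> 0) \<and>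
          C *\<^sub>v vec_of_list (map (\<lambda>v. pderiv_wrt v V) xs) = vec (length xs) (\<lambda>i. pconst (m i) * pvar (xs ! i) ^ a i))"

lemma jacobi_cert_finite_dim:
  assumes "jacobi_cert xs V a C" "distinct xs" shows "jacobi_ring_finite_dim (set xs) V"
proof -
  let ?n = "length xs" and ?f = "\<lambda>v. pderiv_wrt v V"
  have C: "C \<in> carrier_mat ?n ?n" "elements_mat C \<subseteq> polys_in (set xs)"
    using assms by (auto simp: jacobi_cert_def)
  obtain m where m: "\<forall>i < ?n. m i \<noteq> 0"
    and eq: "C *\<^sub>v vec_of_list (map ?f xs) = vec ?n (\<lambda>i. pconst (m i) * pvar (xs ! i) ^ a i)"
    using assms unfolding jacobi_cert_def by blast
  have "pvar (xs ! i) ^ a i \<in> jacobi_ideal (set xs) V" if i: "i < ?n" for i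
  proof -
    have "pconst (m i) * pvar (xs ! i) ^ a i = (\<Sum>j<?n. C $$ (i, j) * ?f (xs ! j))"
      using arg_cong[OF eq, of "\<lambda>v. v $ i"] i C
      by (simp add: scalar_prod_def atLeast0LessThan vec_of_list_index)
    also have "\<dots> \<in> jacobi_ideal (set xs) V"
      unfolding jacobi_ideal_def by (rule ideal_in_sum, rule ideal_in_gen) (use C i in auto)
    finally have "pconst (inverse (m i)) * (pconst (m i) * pvar (xs ! i) ^ a i) \<in> jacobi_ideal (set xs) V"
      unfolding jacobi_ideal_def by (rule ideal_in_mult) simp
    then show ?thesis using m i by (simp add: mult.assoc[symmetric] pconst_mult[symmetric])
  qed
  then have "\<exists>k. \<forall>v\<in>set xs. pvar v ^ k v \<in> jacobi_ideal (set xs) V"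
    by (intro bchoice) (metis in_set_conv_nth)
  then show ?thesis by (metis jacobi_ring_finite_dimI finite_set)
qed

text \<open>The residue has weight 0, so that only the part of \<open>g\<close> without the variables in \<open>T\<close> contributes.\<close>

lemma residue_eq_pconst:
  assumes cert: "jacobi_cert xs V a C" and xs: "distinct xs" and dis: "set xs \<inter> T = {}"
    and C: "quasi_homogeneous w d (det C)" "det C \<in> polys_in (set xs)"
    and g: "quasi_homogeneous w e g" "g \<in> polys_in (set xs \<union> T)"
    and de: "d + e = (\<Sum>i<length xs. of_nat (a i - 1) * w (xs ! i))"
    and pos: "\<And>v. v \<in> T \<Longrightarrow> w v > 0"
  shows "\<exists>c. c \<noteq> 0 \<and> residue xs (map (\<lambda>v. pderiv_wrt v V) xs) g =
    pconst (c * lk (det C * zero_vars T g) (\<Sum>i<length xs. single (xs ! i) (a i - 1)))"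
proof -
  let ?n = "length xs"
  have Cc: "C \<in> carrier_mat ?n ?n" "elements_mat C \<subseteq> polys_in (set xs)"
    using cert by (auto simp: jacobi_cert_def)
  obtain m where m: "\<forall>i < ?n. m i \<noteq> 0"
    and eq: "C *\<^sub>v vec_of_list (map (\<lambda>v. pderiv_wrt v V) xs) = vec ?n (\<lambda>i. pconst (m i) * pvar (xs ! i) ^ a i)"
    using cert unfolding jacobi_cert_def by blast
  \<comment> \<open>Dividing row i by \<open>m i\<close> produces a matrix as required by
    \<open>is_residue\<close>; its determinant differs from that of \<open>C\<close> by the nonzero
    factor \<open>z\<close>.\<close>
  define D where "D = mat\<^sub>r ?n ?n (\<lambda>i. pconst (inverse (m i)) \<cdot>\<^sub>v row C i)"
  define z where "z = (\<Prod>i\<in>{0..<?n}. inverse (m i))"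
  have z: "z \<noteq> 0" using m by (simp add: z_def)
  have detD: "det D = pconst z * det C"
  proof -
    have "det D = (\<Prod>i\<in>{0..<?n}. pconst (inverse (m i))) * det (mat\<^sub>r ?n ?n (row C))"
      unfolding D_def using Cc by (intro det_rows_mul) auto
    moreover have "mat\<^sub>r ?n ?n (row C) = C" using Cc by (intro eq_matI) auto
    ultimately show ?thesis by (simp add: pconst_prod z_def)
  qed
  have "D \<in> carrier_mat ?n ?n" by (simp add: D_def)
  moreover have "D *\<^sub>v vec_of_list (map (\<lambda>v. pderiv_wrt v V) xs) = vec ?n (\<lambda>i. pvar (xs ! i) ^ a i)"
  proof (rule eq_vecI)
    fix i assume "i < dim_vec (vec ?n (\<lambda>i. pvar (xs ! i) ^ a i))"
    then have i: "i < ?n" by simp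
    then have "row C i \<bullet> vec_of_list (map (\<lambda>v. pderiv_wrt v V) xs) = pconst (m i) * pvar (xs ! i) ^ a i"
      using arg_cong[OF eq, of "\<lambda>v. v $ i"] Cc by simp
    then show "(D *\<^sub>v vec_of_list (map (\<lambda>v. pderiv_wrt v V) xs)) $ i = vec ?n (\<lambda>i. pvar (xs ! i) ^ a i) $ i"
      using i m Cc by (simp add: D_def smult_scalar_prod_distrib[of _ ?n] carrier_vecI mult.assoc[symmetric] pconst_mult[symmetric])
  qed (simp add: D_def)
  moreover have "elements_mat D \<subseteq> polys_in (set xs)"
  proof
    fix p assume "p \<in> elements_mat D"
    then obtain i j where "i < ?n" "j < ?n" "p = pconst (inverse (m i)) * C $$ (i, j)"
      using Cc(1) by (auto simp: D_def elements_mat_def)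
    then show "p \<in> polys_in (set xs)" using Cc by (auto intro!: polys_in_mult)
  qed
  ultimately have D: "D \<in> carrier_mat ?n ?n" "elements_mat D \<subseteq> polys_in (set xs)"
    "D *\<^sub>v vec_of_list (map (\<lambda>v. pderiv_wrt v V) xs) = vec ?n (\<lambda>i. pvar (xs ! i) ^ a i)" by simp_all
  have dD: "quasi_homogeneous w d (det D)" "det D \<in> polys_in (set xs)"
    unfolding detD using C by (auto intro: quasi_homogeneous_pconst_mult)
  let ?\<alpha> = "\<Sum>i<length xs. single (xs ! i) (a i - 1)"
  have k\<alpha>: "keys ?\<alpha> \<subseteq> set xs" by (rule keys_sum_single)
  have w\<alpha>: "monom_weight w ?\<alpha> = d + e"
  proof -
    have "monom_weight w (\<Sum>i\<in>A. f i) = (\<Sum>i\<in>A. monom_weight w (f i))" if "finite A" for A and f :: "nat \<Rightarrow> _"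
      using that by (induction A) (auto simp: monom_weight_add)
    then show ?thesis by (simp add: monom_weight_single de)
  qed
  have "lk (coeff_wrt (set xs) ?\<alpha> (det D * g)) \<nu> = lk (pconst (lk (det D * zero_vars T g) ?\<alpha>)) \<nu>" for \<nu>
  proof (cases "\<nu> = 0")
    case True
    have "lk (det D * g) ?\<alpha> = lk (zero_vars T (det D * g)) ?\<alpha>"
      using k\<alpha> dis by (subst lookup_zero_vars) (auto simp: when_def)
    also have "\<dots> = lk (det D * zero_vars T g) ?\<alpha>"
      by (simp add: zero_vars_mult polys_in_zero_vars_disjoint[OF dD(2) dis])
    finally show ?thesis using True k\<alpha> by (simp add: lookup_coeff_wrt pconst_def)
  next
    case False
    \<comment> \<open>A remaining factor \<nu> in the other variables would have weight 0, which
      their positive weights exclude unless it is the empty monomial.\<close>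
    have "?\<alpha> + \<nu> \<notin> keys (det D * g)" if \<nu>: "keys \<nu> \<inter> set xs = {}"
    proof
      assume k: "?\<alpha> + \<nu> \<in> keys (det D * g)"
      have "quasi_homogeneous w (d + e) (det D * g)" by (rule quasi_homogeneous_mult[OF dD(1) g(1)])
      with k have "monom_weight w (?\<alpha> + \<nu>) = d + e" by (simp add: quasi_homogeneous_def)
      then have 0: "monom_weight w \<nu> = 0" by (simp only: monom_weight_add w\<alpha> add_cancel_left_right)
      have "det D * g \<in> polys_in (set xs \<union> T)" using polys_in_mono[OF dD(2)] g(2) by blast
      with k have "keys (?\<alpha> + \<nu>) \<subseteq> set xs \<union> T" by (auto simp: polys_in_def)
      moreover have "keys \<nu> \<subseteq> keys (?\<alpha> + \<nu>)" by (auto simp: in_keys_iff lookup_add)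
      ultimately have "keys \<nu> \<subseteq> T" using \<nu> by blast
      moreover have "keys \<nu> \<noteq> {}" using False by simp
      ultimately have "monom_weight w \<nu> > 0" unfolding monom_weight_def
        by (intro sum_pos) (auto simp: in_keys_iff intro!: mult_pos_pos pos)
      with 0 show False by simp
    qed
    then show ?thesis using False k\<alpha> by (auto simp: lookup_coeff_wrt pconst_def lookup_single when_def in_keys_iff)
  qed
  then have "pconst (lk (det D * zero_vars T g) ?\<alpha>) = coeff_wrt (set xs) ?\<alpha> (det D * g)"
    by (intro poly_mapping_eqI) simp
  then have "is_residue xs (map (\<lambda>v. pderiv_wrt v V) xs) g (pconst (lk (det D * zero_vars T g) ?\<alpha>))"
    using cert D unfolding is_residue_def jacobi_cert_def by blast
  then have "residue xs (map (\<lambda>v. pderiv_wrt v V) xs) g = pconst (lk (det D * zero_vars T g) ?\<alpha>)"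
    by (intro residue_eqI xs) auto
  then show ?thesis using z by (auto simp: detD mult.assoc lookup_pconst_mult)
qed

lemma invertible_in_pconst: "c \<noteq> 0 \<Longrightarrow> invertible_in S (pconst c)"
  unfolding invertible_in_def
  by (intro conjI bexI[of _ "pconst (inverse c)"]) (auto simp: pconst_mult[symmetric])

lemma minus_one_power_pconst: "(- 1) ^ k = pconst ((- 1) ^ k)"
  by (simp add: pconst_power pconst_uminus)

text \<open>With equally many variables on both sides the number of derivatives is even, so their
  product is block diagonal. The equations \<open>wt\<close> say that the monomial read off has the
  weight of determinant times supertrace, which forces both residues to be constants.
  \<open>L\<close> and \<open>R\<close> are these constants up to nonzero factors, computed with the
  other variables set to 0 after differentiation.\<close>

lemma orbifold_equivalentI:
  assumes pot: "potential w (set (x_vars n)) V1" "potential w (set (y_vars n)) V2"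
    and c1: "jacobi_cert (x_vars n) V1 a C" "quasi_homogeneous w d (det C)" "det C \<in> polys_in (set (x_vars n))"
    and c2: "jacobi_cert (y_vars n) V2 a' C'" "quasi_homogeneous w d' (det C')" "det C' \<in> polys_in (set (y_vars n))"
    and wt: "d + (\<Sum>v\<leftarrow>x_vars n @ y_vars n. 1 - w v) = (\<Sum>i<n. of_nat (a i - 1) * w (x_vars n ! i))"
      "d' + (\<Sum>v\<leftarrow>x_vars n @ y_vars n. 1 - w v) = (\<Sum>i<n. of_nat (a' i - 1) * w (y_vars n ! i))"
    and mf: "matrix_factorisation (set (x_vars n) \<union> set (y_vars n)) (V1 - V2) N E J"
    and gr: "graded_mf w N E J"
    and L: "lk (det C * (mat_trace (zdprod (set (y_vars n)) E J (x_vars n @ y_vars n)) -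
        mat_trace (zdprod (set (y_vars n)) J E (x_vars n @ y_vars n))))
          (\<Sum>i<n. single (x_vars n ! i) (a i - 1)) \<noteq> 0"
    and R: "lk (det C' * (mat_trace (zdprod (set (x_vars n)) E J (x_vars n @ y_vars n)) -
        mat_trace (zdprod (set (x_vars n)) J E (x_vars n @ y_vars n))))
          (\<Sum>i<n. single (y_vars n ! i) (a' i - 1)) \<noteq> 0"
  shows "orbifold_equivalent n n V1 V2"
proof -
  let ?vs = "x_vars n @ y_vars n" and ?Q = "mf_mat N E J" and ?S = "set (x_vars n) \<union> set (y_vars n)"
  let ?g = "supertrace N (deriv_prod ?vs ?Q)"
  have len: "length (x_vars n) = n" "length (y_vars n) = n" by (simp_all add: x_vars_def y_vars_def)
  have dist: "distinct (x_vars n)" "distinct (y_vars n)"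
    by (auto simp: x_vars_def y_vars_def distinct_map inj_on_def)
  have disj: "set (x_vars n) \<inter> set (y_vars n) = {}" by (auto simp: x_vars_def y_vars_def)
  have E: "E \<in> carrier_mat N N" and J: "J \<in> carrier_mat N N"
    and pE: "elements_mat E \<subseteq> polys_in ?S" and pJ: "elements_mat J \<subseteq> polys_in ?S"
    using mf by (auto simp: matrix_factorisation_def)
  note Q = mf_mat_carrier[OF E J]
  obtain g where "\<forall>r<2 * N. \<forall>s<2 * N. quasi_homogeneous w (g s - g r + 1) (?Q $$ (r, s))"
    using gr unfolding graded_mf_def by blast
  then have gr': "deriv_prod ?vs ?Q \<in> carrier_mat (2 * N) (2 * N)"
      "\<forall>r<2 * N. \<forall>s<2 * N. quasi_homogeneous w (g s - g r + (\<Sum>v\<leftarrow>?vs. 1 - w v)) (deriv_prod ?vs ?Q $$ (r, s))"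
    using graded_deriv_prod[OF Q, of w g ?vs] by auto
  have "quasi_homogeneous w (\<Sum>v\<leftarrow>?vs. 1 - w v) (deriv_prod ?vs ?Q $$ (i, i))" if "i < 2 * N" for i
    using gr'(2)[rule_format, OF that that] by simp
  then have qg: "quasi_homogeneous w (\<Sum>v\<leftarrow>?vs. 1 - w v) ?g"
    unfolding supertrace_eq_sum[OF gr'(1)]
    by (intro quasi_homogeneous_sum) (auto intro: quasi_homogeneous_uminus)
  have "?Q $$ (r, s) \<in> polys_in ?S" if "r < 2 * N" "s < 2 * N" for r s
  proof -
    have "E $$ (i, j) \<in> polys_in ?S" "J $$ (i, j) \<in> polys_in ?S" if "i < N" "j < N" for i j
      using elements_matI[OF E that refl] elements_matI[OF J that refl] pE pJ by blast+
    then show ?thesis using that E J unfolding mf_mat_def by simp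
  qed
  then have "\<forall>r<2 * N. \<forall>s<2 * N. deriv_prod ?vs ?Q $$ (r, s) \<in> polys_in ?S"
    using polys_in_deriv_prod[OF Q, of ?S ?vs] by blast
  then have pg: "?g \<in> polys_in ?S"
    unfolding supertrace_eq_sum[OF gr'(1)] by (intro polys_in_sum) auto
  have g0: "zero_vars T ?g = mat_trace (zdprod T E J ?vs) - mat_trace (zdprod T J E ?vs)" for T
    using E J by (simp add: supertrace_deriv_prod len zero_vars_diff zero_vars_trace[of _ N] map_zero_vars_dprod[of _ N])
  have pos: "\<And>v. v \<in> set (x_vars n) \<Longrightarrow> w v > 0" "\<And>v. v \<in> set (y_vars n) \<Longrightarrow> w v > 0"
    using pot by (auto simp: potential_def)
  have "\<exists>c. c \<noteq> 0 \<and> residue (x_vars n) (map (\<lambda>v. pderiv_wrt v V1) (x_vars n)) ?g =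
    pconst (c * lk (det C * zero_vars (set (y_vars n)) ?g) (\<Sum>i<n. single (x_vars n ! i) (a i - 1)))"
    using residue_eq_pconst[OF c1(1) dist(1) disj c1(2,3) qg pg] wt pos by (simp add: len)
  then obtain cL where cL: "cL \<noteq> 0" "residue (x_vars n) (map (\<lambda>v. pderiv_wrt v V1) (x_vars n)) ?g =
    pconst (cL * lk (det C * zero_vars (set (y_vars n)) ?g) (\<Sum>i<n. single (x_vars n ! i) (a i - 1)))" by blast
  then have "invertible_in (set (y_vars n)) (q_left n n V1 N ?Q)"
    unfolding q_left_def cL(2) g0 minus_one_power_pconst by (simp only: pconst_mult[symmetric])
      (rule invertible_in_pconst, use L cL(1) in simp)
  moreover have "\<exists>c. c \<noteq> 0 \<and> residue (y_vars n) (map (\<lambda>v. pderiv_wrt v V2) (y_vars n)) ?g =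
    pconst (c * lk (det C' * zero_vars (set (x_vars n)) ?g) (\<Sum>i<n. single (y_vars n ! i) (a' i - 1)))"
    using residue_eq_pconst[OF c2(1) dist(2) _ c2(2,3) qg] pg disj wt pos by (simp add: len Un_commute Int_commute)
  then obtain cR where cR: "cR \<noteq> 0" "residue (y_vars n) (map (\<lambda>v. pderiv_wrt v V2) (y_vars n)) ?g =
    pconst (cR * lk (det C' * zero_vars (set (x_vars n)) ?g) (\<Sum>i<n. single (y_vars n ! i) (a' i - 1)))" by blast
  then have "invertible_in (set (x_vars n)) (q_right n n V2 N ?Q)"
    unfolding q_right_def cR(2) g0 minus_one_power_pconst by (simp only: pconst_mult[symmetric])
      (rule invertible_in_pconst, use R cR(1) in simp)
  ultimately show ?thesis unfolding orbifold_equivalent_def using pot mf gr by blast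
qed

text \<open>A linear order on the variables makes the polynomial ring an integral domain for the type class system.\<close>

instantiation xy :: linorder
begin
definition xy_code :: "xy \<Rightarrow> nat" where "xy_code v = (case v of X i \<Rightarrow> 2 * i | Y i \<Rightarrow> Suc (2 * i))"
definition "less_eq_xy u v \<longleftrightarrow> xy_code u \<le> xy_code v"
definition "less_xy u v \<longleftrightarrow> xy_code u < xy_code v"
instance
proof
  fix u v :: xy assume "u \<le> v" "v \<le> u"
  then have "xy_code u = xy_code v" by (simp add: less_eq_xy_def)
  then show "u = v" by (auto simp: xy_code_def split: xy.splits) presburger+
qed (auto simp: less_eq_xy_def less_xy_def)
end

text \<open>With all weights below 2, neither a constant nor a single variable has weight 2, so two
  variables can be split off from every monomial of \<open>W\<close>.\<close>

lemma two_le_degree_imp_ideal: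
  assumes W: "W \<in> polys_in S" "quasi_homogeneous w 2 W" and w: "\<And>v. v \<in> S \<Longrightarrow> w v < 2"
  shows "W \<in> ideal_in S {pvar u * pvar v | u v. u \<in> S \<and> v \<in> S}"
proof -
  have "single \<mu> c \<in> ideal_in S {pvar u * pvar v | u v. u \<in> S \<and> v \<in> S}"
    if k: "keys \<mu> \<subseteq> S" and wt: "monom_weight w \<mu> = 2" for \<mu> and c :: complex
  proof -
    have split: "\<nu> = (\<nu> - single v 1) + single v 1" if "v \<in> keys \<nu>" for \<nu> :: "'a \<Rightarrow>\<^sub>0 nat" and v
      using that by (intro poly_mapping_eqI) (auto simp: lookup_add lookup_minus lookup_single when_def in_keys_iff)
    have "keys \<mu> \<noteq> {}" using wt by (auto simp: monom_weight_def)
    then obtain v where v: "v \<in> keys \<mu>" by blast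
    define \<mu>' where "\<mu>' = \<mu> - single v 1"
    have \<mu>: "\<mu> = \<mu>' + single v 1" unfolding \<mu>'_def by (rule split[OF v])
    have "monom_weight w \<mu>' = 2 - w v" using wt unfolding \<mu> by (simp add: monom_weight_add monom_weight_single)
    then have "monom_weight w \<mu>' \<noteq> 0" using w[of v] v k by auto
    then have "keys \<mu>' \<noteq> {}" by (auto simp: monom_weight_def)
    then obtain u where u: "u \<in> keys \<mu>'" by blast
    define \<kappa> where "\<kappa> = \<mu>' - single u 1"
    have \<mu>': "\<mu>' = \<kappa> + single u 1" unfolding \<kappa>_def by (rule split[OF u])
    have "single \<mu> c = single \<kappa> c * (pvar u * pvar v)"
      unfolding \<mu> \<mu>' by (simp add: pvar_def mult_single add.assoc)
    moreover have "keys \<kappa> \<subseteq> S" "u \<in> S" "v \<in> S"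
      using k u v by (auto simp: in_keys_iff \<mu> \<mu>' lookup_add subset_iff)
    ultimately show ?thesis by (auto intro!: ideal_in_gen simp: polys_in_def)
  qed
  then show ?thesis using W
    by (subst poly_expand[of W]) (auto intro!: ideal_in_sum simp: polys_in_def quasi_homogeneous_def)
qed

lemma potentialI:
  assumes "distinct xs" "W \<in> polys_in (set xs)" "\<forall>v\<in>set xs. 0 < w v \<and> w v < 2" "quasi_homogeneous w 2 W"
    "jacobi_cert xs W a C"
  shows "potential w (set xs) W"
  unfolding potential_def using assms
  by (auto intro: two_le_degree_imp_ideal jacobi_cert_finite_dim)

section \<open>From matrices to lists of polynomials\<close>

definition diag_list :: "nat \<Rightarrow> 'a::zero \<Rightarrow> 'a list list" where
  "diag_list n d = map (\<lambda>i. map (\<lambda>j. if i = j then d else 0) [0..<n]) [0..<n]"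

lemma lmat_diag_list: "lmat n (diag_list n d) = d \<cdot>\<^sub>m (1\<^sub>m n :: 'a::comm_ring_1 mat)"
  by (rule eq_matI) (auto simp: diag_list_def)

text \<open>\<open>zero_vars UNIV\<close> extracts the constant term. Its vanishing in every entry
  rules out nonzero constant entries and can be checked by rewriting.\<close>

lemma matrix_factorisation_lmat:
  fixes e j :: "'v cpoly list list"
  assumes "sqlist N e" "sqlist N j"
    "\<forall>r\<in>set e. \<forall>p\<in>set r. p \<in> polys_in S" "\<forall>r\<in>set j. \<forall>p\<in>set r. p \<in> polys_in S"
    "\<forall>r\<in>set e. \<forall>p\<in>set r. zero_vars UNIV p = 0" "\<forall>r\<in>set j. \<forall>p\<in>set r. zero_vars UNIV p = 0"
    "lprod N e j = diag_list N W" "lprod N j e = diag_list N W"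
  shows "matrix_factorisation S W N (lmat N e) (lmat N j)"
proof -
  have "pconst c \<notin> elements_mat (lmat N r)" if "sqlist N r" "\<forall>s\<in>set r. \<forall>p\<in>set s. zero_vars UNIV p = 0" "c \<noteq> 0"
    for r :: "'v cpoly list list" and c
  proof
    assume "pconst c \<in> elements_mat (lmat N r)"
    then have "zero_vars UNIV (pconst c :: 'v cpoly) = 0" using elements_lmat[OF that(1)] that(2) by blast
    then have "lk (pconst c :: 'v cpoly) 0 = 0" by simp
    with that(3) show False by (simp add: pconst_def)
  qed
  then show ?thesis unfolding matrix_factorisation_def
    using assms elements_lmat[OF assms(1)] elements_lmat[OF assms(2)]
    by (auto simp: lmat_mult lmat_diag_list)
qed

text \<open>\<open>ga\<close> and \<open>gb\<close> are the degrees of the first and the last N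
  indices. The diagonal blocks are 0, which is quasi-homogeneous of every weight, so only the two
  off-diagonal blocks impose conditions.\<close>

lemma graded_mf_lmat:
  assumes e: "list_all2 (\<lambda>a. list_all2 (\<lambda>b. quasi_homogeneous w (b - a + 1)) gb) ga e"
    and j: "list_all2 (\<lambda>b. list_all2 (\<lambda>a. quasi_homogeneous w (a - b + 1)) ga) gb j"
    and len: "length ga = N" "length gb = N"
  shows "graded_mf w N (lmat N e) (lmat N j)"
proof -
  let ?g = "\<lambda>r. if r < N then ga ! r else gb ! (r - N)"
  have "quasi_homogeneous w (?g s - ?g r + 1) (mf_mat N (lmat N e) (lmat N j) $$ (r, s))"
    if "r < 2 * N" "s < 2 * N" for r s
    using that list_all2_nthD[OF list_all2_nthD[OF e, of r], of "s - N"]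
      list_all2_nthD[OF list_all2_nthD[OF j, of "r - N"], of s] len
    by (auto simp: mf_mat_def mult_2)
  then show ?thesis unfolding graded_mf_def by (intro exI[of _ ?g] allI impI)
qed

definition dlist :: "'v set \<Rightarrow> 'v \<Rightarrow> 'v cpoly list list \<Rightarrow> 'v cpoly list list" where
  "dlist T v e = map (map (\<lambda>p. zero_vars T (pderiv_wrt v p))) e"

lemma sqlist_dlist: "sqlist N e \<Longrightarrow> sqlist N (dlist T v e)" by (auto simp: dlist_def)

text \<open>The trace of a product needs only its diagonal, so the last multiplication in each
  supertrace is never carried out in full.\<close>

definition trace2 :: "nat \<Rightarrow> 'a::semiring_0 list list \<Rightarrow> 'a list list \<Rightarrow> 'a" where
  "trace2 n A B = (\<Sum>i<n. \<Sum>k<n. A ! i ! k * B ! k ! i)"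

lemma mat_trace_mult_lmat: "mat_trace (lmat n A * lmat n B) = trace2 n A B"
  by (simp add: mat_trace_def trace2_def scalar_prod_def atLeast0LessThan)

definition list_supertrace_4 :: "nat \<Rightarrow> 'v set \<Rightarrow> 'v cpoly list list \<Rightarrow> 'v cpoly list list \<Rightarrow> 'v \<Rightarrow> 'v \<Rightarrow> 'v \<Rightarrow> 'v \<Rightarrow> 'v cpoly" where
  "list_supertrace_4 N T e j v1 v2 v3 v4 =
    trace2 N (lprod N (dlist T v1 e) (dlist T v2 j)) (lprod N (dlist T v3 e) (dlist T v4 j)) -
    trace2 N (lprod N (dlist T v1 j) (dlist T v2 e)) (lprod N (dlist T v3 j) (dlist T v4 e))"

lemma zdprod_lmat_4:
  assumes e: "sqlist N e" and j: "sqlist N j"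
  shows "mat_trace (zdprod T (lmat N e) (lmat N j) [v1, v2, v3, v4]) =
    trace2 N (lprod N (dlist T v1 e) (dlist T v2 j)) (lprod N (dlist T v3 e) (dlist T v4 j))"
proof -
  note c = sqlist_dlist[OF e] sqlist_dlist[OF j]
  have d: "map_mat (\<lambda>p. zero_vars T (pderiv_wrt v p)) (lmat N e) = lmat N (dlist T v e)"
     "map_mat (\<lambda>p. zero_vars T (pderiv_wrt v p)) (lmat N j) = lmat N (dlist T v j)" for v
    using e j by (simp_all add: map_lmat dlist_def)
  have "zdprod T (lmat N e) (lmat N j) [v1, v2, v3, v4] =
    (lmat N (dlist T v1 e) * lmat N (dlist T v2 j)) * (lmat N (dlist T v3 e) * lmat N (dlist T v4 j))"
    by (simp add: d) (rule assoc_mult_mat[symmetric, of _ N N _ N _ N], auto intro!: mult_carrier_mat[of _ N N])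
  also have "\<dots> = lmat N (lprod N (dlist T v1 e) (dlist T v2 j)) * lmat N (lprod N (dlist T v3 e) (dlist T v4 j))"
    by (subst (1 2) lmat_mult) (use c in auto)
  finally show ?thesis by (simp only: mat_trace_mult_lmat)
qed

text \<open>The weight of the compound term is left free and its decomposition becomes a premise, so
  that the rule can be applied backwards to any stated weight.\<close>

lemma qh_mult': "quasi_homogeneous w a p \<Longrightarrow> quasi_homogeneous w b q \<Longrightarrow> a + b = d \<Longrightarrow> quasi_homogeneous w d (p * q)"
  using quasi_homogeneous_mult by blast
lemma qh_power': "quasi_homogeneous w a p \<Longrightarrow> of_nat n * a = d \<Longrightarrow> quasi_homogeneous w d (p ^ n)"
  using quasi_homogeneous_power by blast
lemma qh_const': "0 = d \<Longrightarrow> quasi_homogeneous w d (pconst c)" "0 = d \<Longrightarrow> quasi_homogeneous w d 1"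
    "0 = d \<Longrightarrow> quasi_homogeneous w d (numeral n)"
  by (auto intro: quasi_homogeneous_pconst quasi_homogeneous_1 quasi_homogeneous_numeral)

section \<open>Named variables and the extraction of coefficients\<close>

definition "x\<^sub>1 = pvar (X 1)"
definition "x\<^sub>2 = pvar (X 2)"
definition "x\<^sub>3 = pvar (X 3)"
definition "y\<^sub>1 = pvar (Y 1)"
definition "y\<^sub>2 = pvar (Y 2)"
definition "y\<^sub>3 = pvar (Y 3)"
lemmas var_defs = x\<^sub>1_def x\<^sub>2_def x\<^sub>3_def y\<^sub>1_def y\<^sub>2_def y\<^sub>3_def

lemma pderiv_vars [simp]:
  "pderiv_wrt (X i) x\<^sub>1 = (if i = 1 then 1 else 0)" "pderiv_wrt (X i) x\<^sub>2 = (if i = 2 then 1 else 0)"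
  "pderiv_wrt (X i) x\<^sub>3 = (if i = 3 then 1 else 0)" "pderiv_wrt (Y i) y\<^sub>1 = (if i = 1 then 1 else 0)"
  "pderiv_wrt (Y i) y\<^sub>2 = (if i = 2 then 1 else 0)" "pderiv_wrt (Y i) y\<^sub>3 = (if i = 3 then 1 else 0)"
  "pderiv_wrt (Y i) x\<^sub>1 = 0" "pderiv_wrt (Y i) x\<^sub>2 = 0" "pderiv_wrt (Y i) x\<^sub>3 = 0"
  "pderiv_wrt (X i) y\<^sub>1 = 0" "pderiv_wrt (X i) y\<^sub>2 = 0" "pderiv_wrt (X i) y\<^sub>3 = 0"
  by (simp_all add: var_defs pderiv_pvar)

lemma zero_vars_vars [simp]:
  "zero_vars T x\<^sub>1 = (if X 1 \<in> T then 0 else x\<^sub>1)" "zero_vars T x\<^sub>2 = (if X 2 \<in> T then 0 else x\<^sub>2)"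
  "zero_vars T x\<^sub>3 = (if X 3 \<in> T then 0 else x\<^sub>3)" "zero_vars T y\<^sub>1 = (if Y 1 \<in> T then 0 else y\<^sub>1)"
  "zero_vars T y\<^sub>2 = (if Y 2 \<in> T then 0 else y\<^sub>2)" "zero_vars T y\<^sub>3 = (if Y 3 \<in> T then 0 else y\<^sub>3)"
  by (simp_all add: var_defs zero_vars_pvar)

lemma polys_in_vars:
  "X 1 \<in> S \<Longrightarrow> x\<^sub>1 \<in> polys_in S" "X 2 \<in> S \<Longrightarrow> x\<^sub>2 \<in> polys_in S" "X 3 \<in> S \<Longrightarrow> x\<^sub>3 \<in> polys_in S"
  "Y 1 \<in> S \<Longrightarrow> y\<^sub>1 \<in> polys_in S" "Y 2 \<in> S \<Longrightarrow> y\<^sub>2 \<in> polys_in S" "Y 3 \<in> S \<Longrightarrow> y\<^sub>3 \<in> polys_in S"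
  by (auto simp: var_defs)
lemmas polys_in_intros = polys_in_vars polys_in_add polys_in_diff polys_in_uminus polys_in_mult polys_in_power
  polys_in_pconst polys_in_numeral polys_in_0 polys_in_1

lemma qh_vars:
  "quasi_homogeneous w (w (X 1)) x\<^sub>1" "quasi_homogeneous w (w (X 2)) x\<^sub>2" "quasi_homogeneous w (w (X 3)) x\<^sub>3"
  "quasi_homogeneous w (w (Y 1)) y\<^sub>1" "quasi_homogeneous w (w (Y 2)) y\<^sub>2" "quasi_homogeneous w (w (Y 3)) y\<^sub>3"
  by (simp_all add: var_defs quasi_homogeneous_pvar)
lemma qh_vars':
  "w (X 1) = d \<Longrightarrow> quasi_homogeneous w d x\<^sub>1" "w (X 2) = d \<Longrightarrow> quasi_homogeneous w d x\<^sub>2" "w (X 3) = d \<Longrightarrow> quasi_homogeneous w d x\<^sub>3"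
  "w (Y 1) = d \<Longrightarrow> quasi_homogeneous w d y\<^sub>1" "w (Y 2) = d \<Longrightarrow> quasi_homogeneous w d y\<^sub>2" "w (Y 3) = d \<Longrightarrow> quasi_homogeneous w d y\<^sub>3"
  using qh_vars by blast+
lemma x_vars_2: "x_vars 2 = [X 1, X 2]" and y_vars_2: "y_vars 2 = [Y 1, Y 2]"
  and x_vars_3: "x_vars 3 = [X 1, X 2, X 3]" and y_vars_3: "y_vars 3 = [Y 1, Y 2, Y 3]"
  by (simp_all add: x_vars_def y_vars_def upt_rec eval_nat_numeral)

lemma lookup_pconst_monom:
  "lk (pconst c * single \<mu> 1) \<nu> = (if \<mu> = \<nu> then c else 0)"
  by (auto simp: pconst_def mult_single lookup_single)

lemma single_add_eq_iff:
  "u \<noteq> v \<Longrightarrow> single u i + single v j = single u k + single v l \<longleftrightarrow> i = k \<and> j = (l::nat)"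
  by (auto simp: poly_mapping_eq_iff fun_eq_iff lookup_add lookup_single when_def dest: spec[of _ u] spec[of _ v])

text \<open>Coefficients are read off from sums of terms of exactly this shape, with exponents 0
  written out. The case proofs rewrite each product of determinant and supertrace
  accordingly.\<close>

lemma lookup_monom_2:
  "lk (pconst c * (x\<^sub>1 ^ i * x\<^sub>2 ^ j)) (single (X 1) k + single (X 2) l) = (if i = k \<and> j = l then c else 0)"
  "lk (pconst c * (y\<^sub>1 ^ i * y\<^sub>2 ^ j)) (single (Y 1) k + single (Y 2) l) = (if i = k \<and> j = l then c else 0)"
  by (simp_all add: var_defs pvar_power mult_single lookup_pconst_monom single_add_eq_iff)

lemma single_add3_eq_iff:
  assumes "u \<noteq> v" "u \<noteq> t" "v \<noteq> t"
  shows "single u i + (single v j + single t m) = single u i' + (single v j' + single t m') \<longleftrightarrow>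
    i = i' \<and> j = j' \<and> m = (m'::nat)" (is "?l = ?r \<longleftrightarrow> _")
proof
  assume "?l = ?r"
  then have "lk ?l x = lk ?r x" for x by simp
  from this[of u] this[of v] this[of t] show "i = i' \<and> j = j' \<and> m = m'"
    using assms by (simp add: lookup_add lookup_single)
qed simp

lemma lookup_monom_3:
  "lk (pconst c * (x\<^sub>1 ^ i * (x\<^sub>2 ^ j * x\<^sub>3 ^ m))) (single (X 1) i' + (single (X 2) j' + single (X 3) m')) =
    (if i = i' \<and> j = j' \<and> m = m' then c else 0)"
  "lk (pconst c * (y\<^sub>1 ^ i * (y\<^sub>2 ^ j * y\<^sub>3 ^ m))) (single (Y 1) i' + (single (Y 2) j' + single (Y 3) m')) =
    (if i = i' \<and> j = j' \<and> m = m' then c else 0)"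
  by (simp_all add: var_defs pvar_power mult_single lookup_pconst_monom single_add3_eq_iff)

text \<open>A copy of equality that hides an equation between polynomials from the simplifier.\<close>

definition eqv :: "'a \<Rightarrow> 'a \<Rightarrow> bool" where "eqv a b \<longleftrightarrow> a = b"
lemma eqv_refl [simp]: "eqv a a" by (simp add: eqv_def)
lemma list_eqvI: "list_all2 (list_all2 eqv) A B \<Longrightarrow> A = B"
  by (simp add: eqv_def[abs_def] list.rel_eq)

lemma diag_list_numeral:
  "diag_list 2 d = [[d, 0], [0, d]]"
  "diag_list 4 d = [[d, 0, 0, 0], [0, d, 0, 0], [0, 0, d, 0], [0, 0, 0, d]]"
  "diag_list 6 d = [[d, 0, 0, 0, 0, 0], [0, d, 0, 0, 0, 0], [0, 0, d, 0, 0, 0],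
     [0, 0, 0, d, 0, 0], [0, 0, 0, 0, d, 0], [0, 0, 0, 0, 0, d]]"
  by (simp_all add: diag_list_def upt_rec eval_nat_numeral)
lemma replicate_numeral_0: "replicate 2 z = [z, z]" "replicate 4 z = [z, z, z, z]" "replicate 6 z = [z, z, z, z, z, z]"
  by (simp_all add: eval_nat_numeral)

lemmas list_comp = lprod_def rowmul_def diag_list_numeral replicate_numeral_0 dlist_def

section \<open>Koszul factorisations and small determinants\<close>

lemma lprod_koszul_2:
  fixes a b c d :: "xy cpoly"
  shows "lprod 2 [[a, b], [- c, d]] [[d, - b], [c, a]] = diag_list 2 (a * d + b * c)"
    "lprod 2 [[d, - b], [c, a]] [[a, b], [- c, d]] = diag_list 2 (a * d + b * c)"
  by - (rule list_eqvI, simp add: list_comp, ((intro conjI)?; unfold eqv_def; Groebner_Basis.algebra))+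

text \<open>The tensor product of the rank one factorisations of the three summands, in a basis that
  separates even from odd elements; hence rank 4.\<close>

lemma lprod_koszul_3:
  fixes a1 a2 a3 b1 b2 b3 :: "xy cpoly"
  defines "e \<equiv> [[a1, a2, a3, 0], [b2, - b1, 0, a3], [b3, 0, - b1, - a2], [0, b3, - b2, a1]]"
    and "j \<equiv> [[b1, a2, a3, 0], [b2, - a1, 0, a3], [b3, 0, - a1, - a2], [0, b3, - b2, b1]]"
  shows "lprod 4 e j = diag_list 4 (a1 * b1 + a2 * b2 + a3 * b3)"
    "lprod 4 j e = diag_list 4 (a1 * b1 + a2 * b2 + a3 * b3)"
  unfolding e_def j_def
  by - (rule list_eqvI, simp add: list_comp, ((intro conjI)?; unfold eqv_def; Groebner_Basis.algebra))+

lemma det_lmat_2: "det (lmat 2 [[a, b], [c, d]]) = a * d - b * (c :: 'a::comm_ring_1)"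
proof -
  let ?M = "lmat 2 [[a, b], [c, d]]"
  have c: "mat_delete ?M 0 0 = lmat 1 [[d]]" "mat_delete ?M 0 1 = lmat 1 [[c]]"
    by (auto intro!: eq_matI simp: mat_delete_def)
  have "det ?M = (\<Sum>j<2. ?M $$ (0, j) * cofactor ?M 0 j)"
    by (rule laplace_expansion_row) auto
  also have "\<dots> = ?M $$ (0, 0) * cofactor ?M 0 0 + ?M $$ (0, 1) * cofactor ?M 0 1"
    by (simp add: numeral_2_eq_2)
  finally have "det ?M = a * det (lmat 1 [[d]]) - b * det (lmat 1 [[c]])"
    by (simp add: cofactor_def c c[simplified])
  then show ?thesis by (simp only: det_single[OF lmat_carrier]) simp
qed

lemma det_lmat_3:
  "det (lmat 3 [[a, b, c], [d, e, f], [g, h, i]]) =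
    a * (e * i - f * h) - b * (d * i - f * g) + c * (d * h - e * (g :: 'a::comm_ring_1))"
proof -
  let ?M = "lmat 3 [[a, b, c], [d, e, f], [g, h, i]]"
  have c: "mat_delete ?M 0 0 = lmat 2 [[e, f], [h, i]]" "mat_delete ?M 0 1 = lmat 2 [[d, f], [g, i]]"
    "mat_delete ?M 0 2 = lmat 2 [[d, e], [g, h]]"
    by (auto intro!: eq_matI simp: mat_delete_def less_Suc_eq eval_nat_numeral)
  have "det ?M = (\<Sum>j<3. ?M $$ (0, j) * cofactor ?M 0 j)"
    by (rule laplace_expansion_row) auto
  also have "\<dots> = ?M $$ (0, 0) * cofactor ?M 0 0 + ?M $$ (0, 1) * cofactor ?M 0 1 + ?M $$ (0, 2) * cofactor ?M 0 2"
    by (simp add: eval_nat_numeral)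
  finally show ?thesis by (simp add: cofactor_def c c[simplified] det_lmat_2 right_diff_distrib)
qed

section \<open>Explicit data in two and three variables\<close>

lemma jacobi_cert_2:
  fixes V :: "'v cpoly"
  assumes "c11 \<in> polys_in {u, v}" "c12 \<in> polys_in {u, v}" "c21 \<in> polys_in {u, v}" "c22 \<in> polys_in {u, v}"
    and "c11 * pderiv_wrt u V + c12 * pderiv_wrt v V = pconst m1 * pvar u ^ Suc k"
    and "c21 * pderiv_wrt u V + c22 * pderiv_wrt v V = pconst m2 * pvar v ^ Suc l"
    and "m1 \<noteq> 0" "m2 \<noteq> 0"
  shows "jacobi_cert [u, v] V (\<lambda>i. [Suc k, Suc l] ! i) (lmat 2 [[c11, c12], [c21, c22]])"
  unfolding jacobi_cert_def
proof (intro conjI)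
  let ?C = "lmat 2 [[c11, c12], [c21, c22]]"
  show "\<exists>s. (\<forall>i < length [u, v]. s i \<noteq> 0) \<and> ?C *\<^sub>v vec_of_list (map (\<lambda>v. pderiv_wrt v V) [u, v]) =
      vec (length [u, v]) (\<lambda>i. pconst (s i) * pvar ([u, v] ! i) ^ ([Suc k, Suc l] ! i))"
    using assms by (intro exI[of _ "(!) [m1, m2]"] conjI eq_vecI)
      (auto simp: scalar_prod_def less_Suc_eq eval_nat_numeral vec_of_list_index add.assoc)
  show "elements_mat ?C \<subseteq> polys_in (set [u, v])"
    by (rule subset_trans[OF elements_lmat]) (use assms in auto)
qed (auto simp: less_Suc_eq eval_nat_numeral carrier_matI)

lemma jacobi_cert_3:
  fixes V :: "'v cpoly"
  assumes "\<forall>c\<in>{c11, c12, c13, c21, c22, c23, c31, c32, c33}. c \<in> polys_in {u, v, t}"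
    and "c11 * pderiv_wrt u V + c12 * pderiv_wrt v V + c13 * pderiv_wrt t V = pconst m1 * pvar u ^ Suc k"
    and "c21 * pderiv_wrt u V + c22 * pderiv_wrt v V + c23 * pderiv_wrt t V = pconst m2 * pvar v ^ Suc l"
    and "c31 * pderiv_wrt u V + c32 * pderiv_wrt v V + c33 * pderiv_wrt t V = pconst m3 * pvar t ^ Suc m"
    and "m1 \<noteq> 0" "m2 \<noteq> 0" "m3 \<noteq> 0"
  shows "jacobi_cert [u, v, t] V (\<lambda>i. [Suc k, Suc l, Suc m] ! i) (lmat 3 [[c11, c12, c13], [c21, c22, c23], [c31, c32, c33]])"
  unfolding jacobi_cert_def
proof (intro conjI)
  let ?C = "lmat 3 [[c11, c12, c13], [c21, c22, c23], [c31, c32, c33]]"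
  show "\<exists>s. (\<forall>i < length [u, v, t]. s i \<noteq> 0) \<and> ?C *\<^sub>v vec_of_list (map (\<lambda>v. pderiv_wrt v V) [u, v, t]) =
      vec (length [u, v, t]) (\<lambda>i. pconst (s i) * pvar ([u, v, t] ! i) ^ ([Suc k, Suc l, Suc m] ! i))"
    using assms(2-) by (intro exI[of _ "(!) [m1, m2, m3]"] conjI eq_vecI)
      (auto simp: scalar_prod_def less_Suc_eq eval_nat_numeral vec_of_list_index add.assoc)
  show "elements_mat ?C \<subseteq> polys_in (set [u, v, t])"
    by (rule subset_trans[OF elements_lmat]) (use assms(1) in auto)
qed (auto simp: less_Suc_eq eval_nat_numeral carrier_matI)

definition list_supertrace_6 :: "nat \<Rightarrow> 'v set \<Rightarrow> 'v cpoly list list \<Rightarrow> 'v cpoly list list \<Rightarrow> 'v \<Rightarrow> 'v \<Rightarrow> 'v \<Rightarrow> 'v \<Rightarrow> 'v \<Rightarrow> 'v \<Rightarrow> 'v cpoly" where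
  "list_supertrace_6 N T e j v1 v2 v3 v4 v5 v6 =
    trace2 N (lprod N (lprod N (dlist T v1 e) (dlist T v2 j)) (lprod N (dlist T v3 e) (dlist T v4 j))) (lprod N (dlist T v5 e) (dlist T v6 j)) -
    trace2 N (lprod N (lprod N (dlist T v1 j) (dlist T v2 e)) (lprod N (dlist T v3 j) (dlist T v4 e))) (lprod N (dlist T v5 j) (dlist T v6 e))"

lemma zdprod_lmat_6:
  assumes e: "sqlist N e" and j: "sqlist N j"
  shows "mat_trace (zdprod T (lmat N e) (lmat N j) [v1, v2, v3, v4, v5, v6]) =
    trace2 N (lprod N (lprod N (dlist T v1 e) (dlist T v2 j)) (lprod N (dlist T v3 e) (dlist T v4 j)))
      (lprod N (dlist T v5 e) (dlist T v6 j))"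
proof -
  note c = sqlist_dlist[OF e] sqlist_dlist[OF j]
  have d: "map_mat (\<lambda>p. zero_vars T (pderiv_wrt v p)) (lmat N e) = lmat N (dlist T v e)"
     "map_mat (\<lambda>p. zero_vars T (pderiv_wrt v p)) (lmat N j) = lmat N (dlist T v j)" for v
    using e j by (simp_all add: map_lmat dlist_def)
  have assoc: "A * (B * (C * (D * (F * G)))) = ((A * B) * (C * D)) * (F * G)"
    if "A \<in> carrier_mat N N" "B \<in> carrier_mat N N" "C \<in> carrier_mat N N" "D \<in> carrier_mat N N"
      "F \<in> carrier_mat N N" "G \<in> carrier_mat N N" for A B C D F G :: "'a cpoly mat"
    using that by (simp add: assoc_mult_mat[of _ N N _ N _ N] mult_carrier_mat[of _ N N])
  have "zdprod T (lmat N e) (lmat N j) [v1, v2, v3, v4, v5, v6] =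
    ((lmat N (dlist T v1 e) * lmat N (dlist T v2 j)) * (lmat N (dlist T v3 e) * lmat N (dlist T v4 j))) *
      (lmat N (dlist T v5 e) * lmat N (dlist T v6 j))"
    by (simp add: d del: assoc_mult_mat) (rule assoc, auto)
  also have "\<dots> = lmat N (lprod N (lprod N (dlist T v1 e) (dlist T v2 j)) (lprod N (dlist T v3 e) (dlist T v4 j))) *
      lmat N (lprod N (dlist T v5 e) (dlist T v6 j))"
    unfolding lmat_mult[OF c] lmat_mult[OF sqlist_lprod[OF c] sqlist_lprod[OF c]] ..
  finally show ?thesis by (simp only: mat_trace_mult_lmat)
qed

text \<open>Only finite checks on explicit polynomials remain. The powers in the certificates are
  written \<open>Suc k1\<close> and so on because the residue reads off the exponents one below
  them.\<close>

lemma orbifold_equivalent_2I: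
  fixes e j :: "xy cpoly list list"
  assumes V: "V1 \<in> polys_in {X 1, X 2}" "quasi_homogeneous w 2 V1" "V2 \<in> polys_in {Y 1, Y 2}" "quasi_homogeneous w 2 V2"
    and w: "\<forall>v\<in>{X 1, X 2, Y 1, Y 2}. 0 < w v \<and> w v < 2"
    and c: "\<forall>c\<in>{c11, c12, c21, c22}. c \<in> polys_in {X 1, X 2}"
      "c11 * pderiv_wrt (X 1) V1 + c12 * pderiv_wrt (X 2) V1 = pconst m1 * x\<^sub>1 ^ Suc k1"
      "c21 * pderiv_wrt (X 1) V1 + c22 * pderiv_wrt (X 2) V1 = pconst m2 * x\<^sub>2 ^ Suc k2"
      "quasi_homogeneous w d (c11 * c22 - c12 * c21)"
      "d + 4 - w (X 1) - w (X 2) - w (Y 1) - w (Y 2) = of_nat k1 * w (X 1) + of_nat k2 * w (X 2)"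
    and b: "\<forall>b\<in>{b11, b12, b21, b22}. b \<in> polys_in {Y 1, Y 2}"
      "b11 * pderiv_wrt (Y 1) V2 + b12 * pderiv_wrt (Y 2) V2 = pconst n1 * y\<^sub>1 ^ Suc l1"
      "b21 * pderiv_wrt (Y 1) V2 + b22 * pderiv_wrt (Y 2) V2 = pconst n2 * y\<^sub>2 ^ Suc l2"
      "quasi_homogeneous w d' (b11 * b22 - b12 * b21)"
      "d' + 4 - w (X 1) - w (X 2) - w (Y 1) - w (Y 2) = of_nat l1 * w (Y 1) + of_nat l2 * w (Y 2)"
    and m: "m1 \<noteq> 0" "m2 \<noteq> 0"
    and n: "n1 \<noteq> 0" "n2 \<noteq> 0"
    and N: "sqlist N e" "sqlist N j"
    and pol: "\<forall>r\<in>set e \<union> set j. \<forall>p\<in>set r. p \<in> polys_in {X 1, X 2, Y 1, Y 2} \<and> zero_vars UNIV p = 0"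
    and mf: "lprod N e j = diag_list N (V1 - V2)" "lprod N j e = diag_list N (V1 - V2)"
    and gr: "list_all2 (\<lambda>a. list_all2 (\<lambda>b. quasi_homogeneous w (b - a + 1)) gb) ga e"
      "list_all2 (\<lambda>b. list_all2 (\<lambda>a. quasi_homogeneous w (a - b + 1)) ga) gb j"
      "length ga = N" "length gb = N"
    and L: "lk ((c11 * c22 - c12 * c21) *
      list_supertrace_4 N {Y 1, Y 2} e j (X 1) (X 2) (Y 1) (Y 2))
      (single (X 1) k1 + single (X 2) k2) \<noteq> 0"
    and R: "lk ((b11 * b22 - b12 * b21) *
      list_supertrace_4 N {X 1, X 2} e j (X 1) (X 2) (Y 1) (Y 2))
      (single (Y 1) l1 + single (Y 2) l2) \<noteq> 0"
  shows "orbifold_equivalent 2 2 V1 V2"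
proof -
  let ?C = "lmat 2 [[c11, c12], [c21, c22]]" and ?B = "lmat 2 [[b11, b12], [b21, b22]]"
  have sx: "set (x_vars 2) = {X 1, X 2}" and sy: "set (y_vars 2) = {Y 1, Y 2}" by (simp_all add: x_vars_2 y_vars_2)
  have c1: "jacobi_cert (x_vars 2) V1 (\<lambda>i. [Suc k1, Suc k2] ! i) ?C"
    unfolding x_vars_2 using c(1-3) m by (intro jacobi_cert_2[where ?m1.0 = m1 and ?m2.0 = m2]) (auto simp: var_defs)
  have b1: "jacobi_cert (y_vars 2) V2 (\<lambda>i. [Suc l1, Suc l2] ! i) ?B"
    unfolding y_vars_2 using b(1-3) n by (intro jacobi_cert_2[where ?m1.0 = n1 and ?m2.0 = n2]) (auto simp: var_defs)
  have dist: "distinct (x_vars 2)" "distinct (y_vars 2)" by (simp_all add: x_vars_2 y_vars_2)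
  have un: "{X 1, X 2} \<union> {Y 1, Y 2} = {X 1, X 2, Y 1, Y 2}" by auto
  have pot: "potential w (set (x_vars 2)) V1" "potential w (set (y_vars 2)) V2"
    using V w sx sy by (intro potentialI[OF dist(1) _ _ _ c1] potentialI[OF dist(2) _ _ _ b1]; auto)+
  have dC: "quasi_homogeneous w d (det ?C)" "det ?C \<in> polys_in (set (x_vars 2))"
    and dB: "quasi_homogeneous w d' (det ?B)" "det ?B \<in> polys_in (set (y_vars 2))"
    unfolding det_lmat_2 sx sy using c b by auto
  have mf': "matrix_factorisation (set (x_vars 2) \<union> set (y_vars 2)) (V1 - V2) N (lmat N e) (lmat N j)"
    unfolding sx sy un by (rule matrix_factorisation_lmat) (use N pol mf in auto)
  have wt: "d + (\<Sum>v\<leftarrow>x_vars 2 @ y_vars 2. 1 - w v) = (\<Sum>i<2. of_nat ([Suc k1, Suc k2] ! i - 1) * w (x_vars 2 ! i))"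
    "d' + (\<Sum>v\<leftarrow>x_vars 2 @ y_vars 2. 1 - w v) = (\<Sum>i<2. of_nat ([Suc l1, Suc l2] ! i - 1) * w (y_vars 2 ! i))"
    unfolding x_vars_2 y_vars_2 using c(5) b(5) by (simp_all add: numeral_2_eq_2 algebra_simps)
  have exps: "(\<Sum>i<2. single (x_vars 2 ! i) ([Suc k1, Suc k2] ! i - 1)) = single (X 1) k1 + single (X 2) k2"
    "(\<Sum>i<2. single (y_vars 2 ! i) ([Suc l1, Suc l2] ! i - 1)) = single (Y 1) l1 + single (Y 2) l2"
    unfolding x_vars_2 y_vars_2 by (simp_all add: numeral_2_eq_2)
  have vs: "x_vars 2 @ y_vars 2 = [X 1, X 2, Y 1, Y 2]" by (simp add: x_vars_2 y_vars_2)
  show ?thesis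
    by (rule orbifold_equivalentI[OF pot c1 dC b1 dB wt mf' graded_mf_lmat[OF gr]];
        unfold vs sx sy exps det_lmat_2 zdprod_lmat_4[OF N] zdprod_lmat_4[OF N(2,1)] list_supertrace_4_def[symmetric]; rule L R)
qed

text \<open>The names \<open>C\<close> and \<open>B\<close> abbreviate the expanded determinants of
  the certificates; discharging \<open>C_def\<close> and \<open>B_def\<close> by reflexivity inserts
  the expansions.\<close>

lemma orbifold_equivalent_3I:
  fixes e j :: "xy cpoly list list"
  assumes C_def: "C = c11 * (c22 * c33 - c23 * c32) - c12 * (c21 * c33 - c23 * c31) + c13 * (c21 * c32 - c22 * c31)"
    and B_def: "B = b11 * (b22 * b33 - b23 * b32) - b12 * (b21 * b33 - b23 * b31) + b13 * (b21 * b32 - b22 * b31)"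
    and V: "V1 \<in> polys_in {X 1, X 2, X 3}" "quasi_homogeneous w 2 V1" "V2 \<in> polys_in {Y 1, Y 2, Y 3}" "quasi_homogeneous w 2 V2"
    and w: "\<forall>v\<in>{X 1, X 2, X 3, Y 1, Y 2, Y 3}. 0 < w v \<and> w v < 2"
    and c: "\<forall>c\<in>{c11, c12, c13, c21, c22, c23, c31, c32, c33}. c \<in> polys_in {X 1, X 2, X 3}"
      "c11 * pderiv_wrt (X 1) V1 + c12 * pderiv_wrt (X 2) V1 + c13 * pderiv_wrt (X 3) V1 = pconst m1 * x\<^sub>1 ^ Suc k1"
      "c21 * pderiv_wrt (X 1) V1 + c22 * pderiv_wrt (X 2) V1 + c23 * pderiv_wrt (X 3) V1 = pconst m2 * x\<^sub>2 ^ Suc k2"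
      "c31 * pderiv_wrt (X 1) V1 + c32 * pderiv_wrt (X 2) V1 + c33 * pderiv_wrt (X 3) V1 = pconst m3 * x\<^sub>3 ^ Suc k3"
      "quasi_homogeneous w d C"
      "d + 6 - w (X 1) - w (X 2) - w (X 3) - w (Y 1) - w (Y 2) - w (Y 3) =
        of_nat k1 * w (X 1) + of_nat k2 * w (X 2) + of_nat k3 * w (X 3)"
    and b: "\<forall>b\<in>{b11, b12, b13, b21, b22, b23, b31, b32, b33}. b \<in> polys_in {Y 1, Y 2, Y 3}"
      "b11 * pderiv_wrt (Y 1) V2 + b12 * pderiv_wrt (Y 2) V2 + b13 * pderiv_wrt (Y 3) V2 = pconst n1 * y\<^sub>1 ^ Suc l1"
      "b21 * pderiv_wrt (Y 1) V2 + b22 * pderiv_wrt (Y 2) V2 + b23 * pderiv_wrt (Y 3) V2 = pconst n2 * y\<^sub>2 ^ Suc l2"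
      "b31 * pderiv_wrt (Y 1) V2 + b32 * pderiv_wrt (Y 2) V2 + b33 * pderiv_wrt (Y 3) V2 = pconst n3 * y\<^sub>3 ^ Suc l3"
      "quasi_homogeneous w d' B"
      "d' + 6 - w (X 1) - w (X 2) - w (X 3) - w (Y 1) - w (Y 2) - w (Y 3) =
        of_nat l1 * w (Y 1) + of_nat l2 * w (Y 2) + of_nat l3 * w (Y 3)"
    and m: "m1 \<noteq> 0" "m2 \<noteq> 0" "m3 \<noteq> 0"
    and n: "n1 \<noteq> 0" "n2 \<noteq> 0" "n3 \<noteq> 0"
    and N: "sqlist N e" "sqlist N j"
    and pol: "\<forall>r\<in>set e \<union> set j. \<forall>p\<in>set r. p \<in> polys_in {X 1, X 2, X 3, Y 1, Y 2, Y 3} \<and> zero_vars UNIV p = 0"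
    and mf: "lprod N e j = diag_list N (V1 - V2)" "lprod N j e = diag_list N (V1 - V2)"
    and gr: "list_all2 (\<lambda>a. list_all2 (\<lambda>b. quasi_homogeneous w (b - a + 1)) gb) ga e"
      "list_all2 (\<lambda>b. list_all2 (\<lambda>a. quasi_homogeneous w (a - b + 1)) ga) gb j"
      "length ga = N" "length gb = N"
    and L: "lk (C *
      list_supertrace_6 N {Y 1, Y 2, Y 3} e j (X 1) (X 2) (X 3) (Y 1) (Y 2) (Y 3))
      (single (X 1) k1 + (single (X 2) k2 + single (X 3) k3)) \<noteq> 0"
    and R: "lk (B *
      list_supertrace_6 N {X 1, X 2, X 3} e j (X 1) (X 2) (X 3) (Y 1) (Y 2) (Y 3))
      (single (Y 1) l1 + (single (Y 2) l2 + single (Y 3) l3)) \<noteq> 0"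
  shows "orbifold_equivalent 3 3 V1 V2"
proof -
  let ?C = "lmat 3 [[c11, c12, c13], [c21, c22, c23], [c31, c32, c33]]" and ?B = "lmat 3 [[b11, b12, b13], [b21, b22, b23], [b31, b32, b33]]"
  have sx: "set (x_vars 3) = {X 1, X 2, X 3}" and sy: "set (y_vars 3) = {Y 1, Y 2, Y 3}" by (simp_all add: x_vars_3 y_vars_3)
  have c1: "jacobi_cert (x_vars 3) V1 (\<lambda>i. [Suc k1, Suc k2, Suc k3] ! i) ?C"
    unfolding x_vars_3 using c(1-4) m by (intro jacobi_cert_3[where ?m1.0 = m1 and ?m2.0 = m2 and ?m3.0 = m3]) (auto simp: var_defs)
  have b1: "jacobi_cert (y_vars 3) V2 (\<lambda>i. [Suc l1, Suc l2, Suc l3] ! i) ?B"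
    unfolding y_vars_3 using b(1-4) n by (intro jacobi_cert_3[where ?m1.0 = n1 and ?m2.0 = n2 and ?m3.0 = n3]) (auto simp: var_defs)
  have dist: "distinct (x_vars 3)" "distinct (y_vars 3)" by (simp_all add: x_vars_3 y_vars_3)
  have un: "{X 1, X 2, X 3} \<union> {Y 1, Y 2, Y 3} = {X 1, X 2, X 3, Y 1, Y 2, Y 3}" by auto
  have pot: "potential w (set (x_vars 3)) V1" "potential w (set (y_vars 3)) V2"
    using V w sx sy by (intro potentialI[OF dist(1) _ _ _ c1] potentialI[OF dist(2) _ _ _ b1]; auto)+
  have dC: "quasi_homogeneous w d (det ?C)" "det ?C \<in> polys_in (set (x_vars 3))"
    and dB: "quasi_homogeneous w d' (det ?B)" "det ?B \<in> polys_in (set (y_vars 3))"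
    unfolding det_lmat_3 sx sy using c(1,5) b(1,5) unfolding C_def B_def
    by (auto intro!: polys_in_add polys_in_diff polys_in_mult)
  have mf': "matrix_factorisation (set (x_vars 3) \<union> set (y_vars 3)) (V1 - V2) N (lmat N e) (lmat N j)"
    unfolding sx sy un by (rule matrix_factorisation_lmat) (use N pol mf in auto)
  have wt: "d + (\<Sum>v\<leftarrow>x_vars 3 @ y_vars 3. 1 - w v) = (\<Sum>i<3. of_nat ([Suc k1, Suc k2, Suc k3] ! i - 1) * w (x_vars 3 ! i))"
    "d' + (\<Sum>v\<leftarrow>x_vars 3 @ y_vars 3. 1 - w v) = (\<Sum>i<3. of_nat ([Suc l1, Suc l2, Suc l3] ! i - 1) * w (y_vars 3 ! i))"
    unfolding x_vars_3 y_vars_3 using c(6) b(6) by (simp_all add: numeral_3_eq_3 numeral_2_eq_2 algebra_simps)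
  have exps: "(\<Sum>i<3. single (x_vars 3 ! i) ([Suc k1, Suc k2, Suc k3] ! i - 1)) = single (X 1) k1 + (single (X 2) k2 + single (X 3) k3)"
    "(\<Sum>i<3. single (y_vars 3 ! i) ([Suc l1, Suc l2, Suc l3] ! i - 1)) = single (Y 1) l1 + (single (Y 2) l2 + single (Y 3) l3)"
    unfolding x_vars_3 y_vars_3 by (simp_all add: numeral_3_eq_3 numeral_2_eq_2 add.assoc)
  have vs: "x_vars 3 @ y_vars 3 = [X 1, X 2, X 3, Y 1, Y 2, Y 3]" by (simp add: x_vars_3 y_vars_3)
  show ?thesis
    by (rule orbifold_equivalentI[OF pot c1 dC b1 dB wt mf' graded_mf_lmat[OF gr]];
        unfold vs sx sy exps det_lmat_3 zdprod_lmat_6[OF N] zdprod_lmat_6[OF N(2,1)] list_supertrace_6_def[symmetric]; rule L[unfolded C_def] R[unfolded B_def])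
qed

section \<open>Explicit weights, traces and further types of factorisations\<close>

definition weights :: "rat list \<Rightarrow> rat list \<Rightarrow> xy \<Rightarrow> rat" where
  "weights xs ys v = (case v of X i \<Rightarrow> xs ! (i - 1) | Y i \<Rightarrow> ys ! (i - 1))"

lemma weights_simps:
  "weights (a # xs) ys (X (Suc 0)) = a" "weights (a # b # xs) ys (X 2) = b" "weights (a # b # c # xs) ys (X 3) = c"
  "weights xs (a # ys) (Y (Suc 0)) = a" "weights xs (a # b # ys) (Y 2) = b" "weights xs (a # b # c # ys) (Y 3) = c"
  by (simp_all add: weights_def numeral_2_eq_2 numeral_3_eq_3)

lemma trace2_numeral:
  "trace2 2 A B = (A ! 0 ! 0 * B ! 0 ! 0 + A ! 0 ! 1 * B ! 1 ! 0) + (A ! 1 ! 0 * B ! 0 ! 1 + A ! 1 ! 1 * B ! 1 ! 1)"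
  "trace2 4 A B = (A ! 0 ! 0 * B ! 0 ! 0 + A ! 0 ! 1 * B ! 1 ! 0 + A ! 0 ! 2 * B ! 2 ! 0 + A ! 0 ! 3 * B ! 3 ! 0) + (A ! 1 ! 0 * B ! 0 ! 1 + A ! 1 ! 1 * B ! 1 ! 1 + A ! 1 ! 2 * B ! 2 ! 1 + A ! 1 ! 3 * B ! 3 ! 1) + (A ! 2 ! 0 * B ! 0 ! 2 + A ! 2 ! 1 * B ! 1 ! 2 + A ! 2 ! 2 * B ! 2 ! 2 + A ! 2 ! 3 * B ! 3 ! 2) + (A ! 3 ! 0 * B ! 0 ! 3 + A ! 3 ! 1 * B ! 1 ! 3 + A ! 3 ! 2 * B ! 2 ! 3 + A ! 3 ! 3 * B ! 3 ! 3)"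
  "trace2 6 A B = (A ! 0 ! 0 * B ! 0 ! 0 + A ! 0 ! 1 * B ! 1 ! 0 + A ! 0 ! 2 * B ! 2 ! 0 + A ! 0 ! 3 * B ! 3 ! 0 + A ! 0 ! 4 * B ! 4 ! 0 + A ! 0 ! 5 * B ! 5 ! 0) + (A ! 1 ! 0 * B ! 0 ! 1 + A ! 1 ! 1 * B ! 1 ! 1 + A ! 1 ! 2 * B ! 2 ! 1 + A ! 1 ! 3 * B ! 3 ! 1 + A ! 1 ! 4 * B ! 4 ! 1 + A ! 1 ! 5 * B ! 5 ! 1) + (A ! 2 ! 0 * B ! 0 ! 2 + A ! 2 ! 1 * B ! 1 ! 2 + A ! 2 ! 2 * B ! 2 ! 2 + A ! 2 ! 3 * B ! 3 ! 2 + A ! 2 ! 4 * B ! 4 ! 2 + A ! 2 ! 5 * B ! 5 ! 2) + (A ! 3 ! 0 * B ! 0 ! 3 + A ! 3 ! 1 * B ! 1 ! 3 + A ! 3 ! 2 * B ! 2 ! 3 + A ! 3 ! 3 * B ! 3 ! 3 + A ! 3 ! 4 * B ! 4 ! 3 + A ! 3 ! 5 * B ! 5 ! 3) + (A ! 4 ! 0 * B ! 0 ! 4 + A ! 4 ! 1 * B ! 1 ! 4 + A ! 4 ! 2 * B ! 2 ! 4 + A ! 4 ! 3 * B ! 3 ! 4 + A ! 4 ! 4 * B ! 4 ! 4 + A ! 4 ! 5 * B ! 5 ! 4) + (A ! 5 ! 0 * B ! 0 ! 5 + A ! 5 ! 1 * B ! 1 ! 5 + A ! 5 ! 2 * B !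 2 ! 5 + A ! 5 ! 3 * B ! 3 ! 5 + A ! 5 ! 4 * B ! 4 ! 5 + A ! 5 ! 5 * B ! 5 ! 5)"
  by (simp_all add: trace2_def eval_nat_numeral add.assoc)

lemma eqvD: "eqv a b \<Longrightarrow> a = b" by (simp add: eqv_def)

lemmas qh_base = quasi_homogeneous_0 quasi_homogeneous_pconst quasi_homogeneous_1 quasi_homogeneous_numeral qh_vars
lemmas qh_step = qh_mult' qh_power' qh_const' qh_vars' quasi_homogeneous_add quasi_homogeneous_diff quasi_homogeneous_uminus

text \<open>The \<open>2 \<times> 2\<close> Koszul factorisation with entries \<open>a1 + a2 \<surd>N\<close> etc., each entry being replaced by the
  matrix of multiplication by it in the basis \<open>1, \<surd>N\<close>.\<close>

lemma lprod_block:
  fixes a1 a2 b1 b2 c1 c2 d1 d2 N :: "xy cpoly"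
  defines "e \<equiv> [[a1, N * a2, b1, N * b2], [a2, a1, b2, b1], [- c1, - (N * c2), d1, N * d2], [- c2, - c1, d2, d1]]"
    and "j \<equiv> [[d1, N * d2, - b1, - (N * b2)], [d2, d1, - b2, - b1], [c1, N * c2, a1, N * a2], [c2, c1, a2, a1]]"
  assumes W: "a1 * d1 + N * (a2 * d2) + b1 * c1 + N * (b2 * c2) = W" and O: "a1 * d2 + a2 * d1 + b1 * c2 + b2 * c1 = 0"
  shows "lprod 4 e j = diag_list 4 W" "lprod 4 j e = diag_list 4 W"
proof -
  \<comment> \<open>\<open>?P\<close> and \<open>?O\<close> are the rational part and the
    coefficient of \<surd>N in the sum of the two products. Before the hypotheses are used, both
    matrix products consist of two diagonal blocks, each representing multiplication by this
    sum.\<close>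
  let ?P = "a1 * d1 + N * (a2 * d2) + b1 * c1 + N * (b2 * c2)" and ?O = "a1 * d2 + a2 * d1 + b1 * c2 + b2 * c1"
  let ?R = "[[?P, N * ?O, 0, 0], [?O, ?P, 0, 0], [0, 0, ?P, N * ?O], [0, 0, ?O, ?P]]"
  have R: "?R = diag_list 4 W" unfolding W O by (simp add: diag_list_numeral)
  show "lprod 4 e j = diag_list 4 W" "lprod 4 j e = diag_list 4 W"
    unfolding R[symmetric] e_def j_def
    by - (rule list_eqvI, simp add: list_comp, ((intro conjI)?; unfold eqv_def; Groebner_Basis.algebra))+
qed

definition linear_list :: "nat \<Rightarrow> 'a::ring_1 \<Rightarrow> 'a \<Rightarrow> 'a list list \<Rightarrow> 'a list list" where
  "linear_list n x z c = map (\<lambda>i. map (\<lambda>j. (if i = j then x else 0) + z * c ! i ! j) [0..<n]) [0..<n]"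

lemma linear_list_6: "linear_list 6 x z [[a0, a1, a2, a3, a4, a5], [b0, b1, b2, b3, b4, b5], [c0, c1, c2, c3, c4, c5],
    [d0, d1, d2, d3, d4, d5], [e0, e1, e2, e3, e4, e5], [f0, f1, f2, f3, f4, f5]] =
  [[x + z * a0, z * a1, z * a2, z * a3, z * a4, z * a5], [z * b0, x + z * b1, z * b2, z * b3, z * b4, z * b5],
   [z * c0, z * c1, x + z * c2, z * c3, z * c4, z * c5], [z * d0, z * d1, z * d2, x + z * d3, z * d4, z * d5],
   [z * e0, z * e1, z * e2, z * e3, x + z * e4, z * e5], [z * f0, z * f1, z * f2, z * f3, z * f4, x + z * f5]]"
  by (simp add: linear_list_def upt_rec eval_nat_numeral)

text \<open>The scalars commute with the matrix, so (x + z c)(x - z c) = x^2 - z^2 c^2 = x^2 + d.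
  Replacing \<open>z\<close> by its negative gives the opposite order of the factors.\<close>

lemma lprod_linear_list:
  fixes c :: "'a::comm_ring_1 list list"
  assumes c: "sqlist n c" and cc: "lprod n c c = diag_list n d" and z: "z ^ 2 = - 1"
  shows "lprod n (linear_list n x z c) (linear_list n x (- z) c) = diag_list n (x ^ 2 + d)"
proof -
  have sq: "sqlist n (linear_list n x y c)" for y by (auto simp: linear_list_def)
  have entry: "lprod n A B ! i ! j = (\<Sum>k<n. A ! i ! k * B ! k ! j)"
    if "sqlist n A" "sqlist n B" "i < n" "j < n" for A B :: "'a list list" and i j
    using that rowmul_nth[of "A ! i" B n] nth_mem[of i A] by (auto simp: lprod_def)
  have row: "length (A ! i) = n" if "sqlist n A" "i < n" for A :: "'a list list" and i
    using that nth_mem[of i A] by blast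
  have ij: "lprod n (linear_list n x z c) (linear_list n x (- z) c) ! i ! j = diag_list n (x ^ 2 + d) ! i ! j"
    if i: "i < n" and j: "j < n" for i j
  proof -
    have "lprod n (linear_list n x z c) (linear_list n x (- z) c) ! i ! j =
      (\<Sum>k<n. ((if i = k then x else 0) + z * c ! i ! k) * ((if k = j then x else 0) + (- z) * c ! k ! j))"
      using entry[OF sq[of z] sq[of "- z"] i j] i j by (simp add: linear_list_def)
    also have "\<dots> = (\<Sum>k<n. (if k = i then x * ((if k = j then x else 0) + (- z) * c ! k ! j) else 0)
        + (if k = j then x * (z * c ! i ! k) else 0) - z ^ 2 * (c ! i ! k * c ! k ! j))"
      by (rule sum.cong) (auto simp: algebra_simps power2_eq_square)
    also have "\<dots> = (if i = j then x ^ 2 else 0) - z ^ 2 * (\<Sum>k<n. c ! i ! k * c ! k ! j)"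
      using i j by (simp add: sum.distrib sum_subtractf sum_distrib_left[symmetric] algebra_simps power2_eq_square)
    also have "(\<Sum>k<n. c ! i ! k * c ! k ! j) = diag_list n d ! i ! j"
      using entry[OF c c i j] cc by simp
    finally show ?thesis
      using i j z by (simp add: diag_list_def)
  qed
  show ?thesis
  proof (intro nth_equalityI)
    show len: "length (lprod n (linear_list n x z c) (linear_list n x (- z) c)) = length (diag_list n (x ^ 2 + d))"
      by (simp add: lprod_def linear_list_def diag_list_def)
    have n: "length (diag_list n (x ^ 2 + d)) = n" by (simp add: diag_list_def)
    fix i assume "i < length (lprod n (linear_list n x z c) (linear_list n x (- z) c))"
    then have i: "i < n" using len n by simp
    show l: "length (lprod n (linear_list n x z c) (linear_list n x (- z) c) ! i) = length (diag_list n (x ^ 2 + d) ! i)"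
      using row[OF sqlist_lprod[OF sq[of z] sq[of "- z"]] i] i by (simp add: diag_list_def)
    fix j assume "j < length (lprod n (linear_list n x z c) (linear_list n x (- z) c) ! i)"
    then show "lprod n (linear_list n x z c) (linear_list n x (- z) c) ! i ! j = diag_list n (x ^ 2 + d) ! i ! j"
      using ij i l by (simp add: diag_list_def)
  qed
qed

section \<open>The matrix factorisations\<close>

text \<open>Put P = \<open>y\<^sub>1 + y\<^sub>2\<close> and M =
  \<open>y\<^sub>1 - y\<^sub>2\<close>. Then \<open>y\<^sub>1 ^ 3 + y\<^sub>2 ^ 3\<close> is (P^3 +
  3 P M^2) / 4 = k^3 P^3 + l^2 k P M^2. The factor \<open>x\<^sub>1 ^ 2\<close> - k P divides
  \<open>x\<^sub>1 ^ 6\<close> - k^3 P^3, and modulo it the other term may be replaced by l^2 M^2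
  \<open>x\<^sub>1 ^ 2\<close>; what is left is a difference of two squares.\<close>

lemma orbifold_equivalent_A5_D4:
  fixes k l :: complex
  assumes k: "4 * k ^ 3 = 1" and l: "4 * l ^ 2 * k = 3"
  shows "orbifold_equivalent 2 2 (x\<^sub>1 ^ 6 + x\<^sub>2 ^ 2) (y\<^sub>1 ^ 3 + y\<^sub>2 ^ 3)"
proof -
  define w where "w = weights [1 / 3, 1] [2 / 3, 2 / 3]"
  note w_simps = w_def weights_simps
  define K L :: "xy cpoly" where "K = pconst k" and "L = pconst l"
  note const_defs = K_def L_def
  define a where "a = x\<^sub>1 ^ 2 - K * (y\<^sub>1 + y\<^sub>2)"
  define b where "b = x\<^sub>2 - L * (y\<^sub>1 - y\<^sub>2) * x\<^sub>1"
  define c where "c = x\<^sub>2 + L * (y\<^sub>1 - y\<^sub>2) * x\<^sub>1"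
  define d where "d = x\<^sub>1 ^ 4 + K * x\<^sub>1 ^ 2 * (y\<^sub>1 + y\<^sub>2) + K ^ 2 * (y\<^sub>1 + y\<^sub>2) ^ 2 + L ^ 2 * (y\<^sub>1 - y\<^sub>2) ^ 2"
  note entries = a_def b_def c_def d_def
  let ?e = "[[a, b], [- c, d]]" and ?j = "[[d, - b], [c, a]]"
  let ?C = "(1) * (1) - (0) * (0) :: xy cpoly" and ?B = "(1) * (1) - (0) * (0) :: xy cpoly"
  have W: "a * d + b * c = (x\<^sub>1 ^ 6 + x\<^sub>2 ^ 2) - (y\<^sub>1 ^ 3 + y\<^sub>2 ^ 3)"
  proof -
    have rel: "4 * K ^ 3 = 1" "4 * L ^ 2 * K = 3"
      by (simp_all add: k l const_defs pconst_hom[symmetric] flip: pconst_numeral pconst_1)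
    \<comment> \<open>An inverse of 4, kept as a symbol with the relation 4 q = 1 because the
      identity is verified without division.\<close>
    define q :: "xy cpoly" where "q = pconst (1 / 4)"
    have q: "4 * q = 1" by (simp add: q_def pconst_hom[symmetric] flip: pconst_numeral pconst_1)
    have "a * d + b * c = (x\<^sub>1 ^ 6 + x\<^sub>2 ^ 2) - (y\<^sub>1 ^ 3 + y\<^sub>2 ^ 3) - q * (4 * K ^ 3 - 1) * (y\<^sub>1 + y\<^sub>2) ^ 3
      - q * (4 * L ^ 2 * K - 3) * (y\<^sub>1 + y\<^sub>2) * (y\<^sub>1 - y\<^sub>2) ^ 2 + (4 * q - 1) * (K ^ 3 * (y\<^sub>1 + y\<^sub>2) ^ 3
      + L ^ 2 * K * (y\<^sub>1 + y\<^sub>2) * (y\<^sub>1 - y\<^sub>2) ^ 2 - (y\<^sub>1 ^ 3 + y\<^sub>2 ^ 3))"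
      unfolding entries by Groebner_Basis.algebra
    then show ?thesis by (simp add: rel q)
  qed
  note mf = lprod_koszul_2[where a = a and b = b and c = c and d = d, unfolded W]
  have nz: "k \<noteq> 0" "l \<noteq> 0" using k l by auto
  have L: "list_supertrace_4 2 {Y 1, Y 2} ?e ?j (X 1) (X 2) (Y 1) (Y 2) = 24 * K * L * x\<^sub>1 ^ 4" (is "?l = ?r")
  proof -
    have "eqv ?l ?r"
      by (simp add: list_supertrace_4_def entries const_defs list_comp trace2_numeral pderiv_simps zero_vars_simps,
          (unfold eqv_def, Groebner_Basis.algebra)?)
    then show ?thesis by (rule eqvD)
  qed
  have R: "list_supertrace_4 2 {X 1, X 2} ?e ?j (X 1) (X 2) (Y 1) (Y 2) = 16 * K * L ^ 3 * y\<^sub>1 * y\<^sub>2 - 8 * K * L ^ 3 * y\<^sub>1 ^ 2 - 8 * K * L ^ 3 * y\<^sub>2 ^ 2" (is "?l = ?r")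
  proof -
    have "eqv ?l ?r"
      by (simp add: list_supertrace_4_def entries const_defs list_comp trace2_numeral pderiv_simps zero_vars_simps,
          (unfold eqv_def, Groebner_Basis.algebra)?)
    then show ?thesis by (rule eqvD)
  qed
  have LC: "(?C) * (24 * K * L * x\<^sub>1 ^ 4) = pconst (24 * k * l) * (x\<^sub>1 ^ 4 * x\<^sub>2 ^ 0)"
    unfolding const_defs by (simp only: pconst_hom pconst_numeral pconst_1 pconst_0) Groebner_Basis.algebra
  have RB: "(?B) * (16 * K * L ^ 3 * y\<^sub>1 * y\<^sub>2 - 8 * K * L ^ 3 * y\<^sub>1 ^ 2 - 8 * K * L ^ 3 * y\<^sub>2 ^ 2) = pconst (- (8 * k * l ^ 3)) * (y\<^sub>1 ^ 2 * y\<^sub>2 ^ 0) + pconst (16 * k * l ^ 3) * (y\<^sub>1 ^ 1 * y\<^sub>2 ^ 1) + pconst (- (8 * k * l ^ 3)) * (y\<^sub>1 ^ 0 * y\<^sub>2 ^ 2)"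
    unfolding const_defs by (simp only: pconst_hom pconst_numeral pconst_1 pconst_0) Groebner_Basis.algebra
  show ?thesis
  \<comment> \<open>Both potentials are sums of powers, so the partial derivatives already are
    multiples of powers and identity matrices serve as certificates.\<close>
  proof (rule orbifold_equivalent_2I[where w = w and N = 2 and e = ?e and j = ?j
      and ga = "[0, - (1 / 3)]" and gb = "[- (1 / 3), 0]"
      and d = "0" and d' = "0"
      and ?c11.0 = "1" and ?c12.0 = "0" and ?c21.0 = "0" and ?c22.0 = "1"
      and ?b11.0 = "1" and ?b12.0 = "0" and ?b21.0 = "0" and ?b22.0 = "1"
      and ?m1.0 = 6 and ?n1.0 = 3 and ?k1.0 = 4 and ?l1.0 = 1 and ?m2.0 = 2 and ?n2.0 = 3 and ?k2.0 = 0 and ?l2.0 = 1])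
    show "x\<^sub>1 ^ 6 + x\<^sub>2 ^ 2 \<in> polys_in {X 1, X 2}" "y\<^sub>1 ^ 3 + y\<^sub>2 ^ 3 \<in> polys_in {Y 1, Y 2}" by (intro polys_in_intros; simp)+
    show "quasi_homogeneous w 2 (x\<^sub>1 ^ 6 + x\<^sub>2 ^ 2)" "quasi_homogeneous w 2 (y\<^sub>1 ^ 3 + y\<^sub>2 ^ 3)" by (rule qh_base | rule qh_step | rule refl | (simp add: w_simps; fail))+
    show "\<forall>v\<in>{X 1, X 2, Y 1, Y 2}. 0 < w v \<and> w v < 2" by (simp add: w_simps)
    show "\<forall>c\<in>{1, 0, 0, 1}. c \<in> polys_in {X 1, X 2}" by (auto intro!: polys_in_intros)
    show "\<forall>c\<in>{1, 0, 0, 1}. c \<in> polys_in {Y 1, Y 2}" by (auto intro!: polys_in_intros)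
    show "1 * pderiv_wrt (X 1) (x\<^sub>1 ^ 6 + x\<^sub>2 ^ 2) + 0 * pderiv_wrt (X 2) (x\<^sub>1 ^ 6 + x\<^sub>2 ^ 2) = pconst 6 * x\<^sub>1 ^ Suc 4"
      by (rule eqvD, simp add: pderiv_simps, ((unfold eqv_def)?, Groebner_Basis.algebra)?)
    show "0 * pderiv_wrt (X 1) (x\<^sub>1 ^ 6 + x\<^sub>2 ^ 2) + 1 * pderiv_wrt (X 2) (x\<^sub>1 ^ 6 + x\<^sub>2 ^ 2) = pconst 2 * x\<^sub>2 ^ Suc 0"
      by (rule eqvD, simp add: pderiv_simps, ((unfold eqv_def)?, Groebner_Basis.algebra)?)
    show "1 * pderiv_wrt (Y 1) (y\<^sub>1 ^ 3 + y\<^sub>2 ^ 3) + 0 * pderiv_wrt (Y 2) (y\<^sub>1 ^ 3 + y\<^sub>2 ^ 3) = pconst 3 * y\<^sub>1 ^ Suc 1"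
      by (rule eqvD, simp add: pderiv_simps, ((unfold eqv_def)?, Groebner_Basis.algebra)?)
    show "0 * pderiv_wrt (Y 1) (y\<^sub>1 ^ 3 + y\<^sub>2 ^ 3) + 1 * pderiv_wrt (Y 2) (y\<^sub>1 ^ 3 + y\<^sub>2 ^ 3) = pconst 3 * y\<^sub>2 ^ Suc 1"
      by (rule eqvD, simp add: pderiv_simps, ((unfold eqv_def)?, Groebner_Basis.algebra)?)
    have det: "?C = 1" by ((simp; fail) | Groebner_Basis.algebra)
    show "quasi_homogeneous w (0) (?C)" unfolding det by ((rule qh_base | rule qh_step | rule refl | (simp add: w_simps; fail))+)
    have det: "?B = 1" by ((simp; fail) | Groebner_Basis.algebra)
    show "quasi_homogeneous w (0) (?B)" unfolding det by ((rule qh_base | rule qh_step | rule refl | (simp add: w_simps; fail))+)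
    show "lk ((?C) * (list_supertrace_4 2 {Y 1, Y 2} ?e ?j (X 1) (X 2) (Y 1) (Y 2))) (single (X 1) 4 + single (X 2) 0) \<noteq> 0"
      unfolding L LC by (simp only: lookup_add lookup_monom_2) (simp add: nz)
    show "lk ((?B) * (list_supertrace_4 2 {X 1, X 2} ?e ?j (X 1) (X 2) (Y 1) (Y 2))) (single (Y 1) 1 + single (Y 2) 1) \<noteq> 0"
      unfolding R RB by (simp only: lookup_add lookup_monom_2) (simp add: nz)
    show "\<forall>r\<in>set ?e \<union> set ?j. \<forall>p\<in>set r. p \<in> polys_in {X 1, X 2, Y 1, Y 2} \<and> zero_vars UNIV p = 0"
      unfolding entries const_defs by (simp add: zero_vars_simps) (intro conjI polys_in_intros; simp)
    show "list_all2 (\<lambda>a. list_all2 (\<lambda>b. quasi_homogeneous w (b - a + 1)) [- (1 / 3), 0]) [0, - (1 / 3)] ?e"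
      "list_all2 (\<lambda>b. list_all2 (\<lambda>a. quasi_homogeneous w (a - b + 1)) [0, - (1 / 3)]) [- (1 / 3), 0] ?j"
      by (simp add: entries const_defs, ((rule conjI qh_base | rule qh_step | rule refl | (simp add: w_simps; fail))+)?)+
  qed ((rule mf | (simp add: w_simps; fail))+)
qed

text \<open>Let n be a square root of \<open>N\<close>, l = F \<open>x\<^sub>1\<close> + S n, and p
  = G1 \<open>x\<^sub>1 * y\<^sub>1\<close> + G3 \<open>x\<^sub>1 ^ 3\<close> + (G0
  \<open>y\<^sub>1\<close> + G2 \<open>x\<^sub>1 ^ 2\<close>) n. The entries are a =
  \<open>x\<^sub>2\<close> - \<open>y\<^sub>2\<close> l, b = \<open>y\<^sub>2 ^ 2\<close> - p, c =
  \<open>y\<^sub>2\<close> (l^3 - p - \<open>y\<^sub>2 ^ 2\<close>) and d =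
  \<open>x\<^sub>1 ^ 5\<close> + \<open>x\<^sub>2 ^ 2\<close> + \<open>x\<^sub>2 * y\<^sub>2\<close>
  l + \<open>y\<^sub>2 ^ 2\<close> l^2. Then a d + b c exceeds the difference of the potentials by
  \<open>y\<^sub>2\<close> (p^2 - l^3 p + \<open>y\<^sub>1 ^ 3\<close> -
  \<open>x\<^sub>1 ^ 5\<close> l). The hypotheses \<open>rels\<close> are the coefficients of this
  bracket, first of its rational part and then of n; \<open>nz\<close> consists of the coefficients
  read off for the two residues.\<close>

lemma orbifold_equivalent_E13_Z11:
  fixes s f g0 g1 g2 g3 q :: complex
  assumes rels: "- f + 3 * f * g3 * q * s ^ 2 + 3 * f ^ 2 * g2 * q * s - f ^ 3 * g3 - g2 * q ^ 2 * s ^ 3 - g2 ^ 2 * q + g3 ^ 2 = 0"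
    "- (3 * f * g1 * s ^ 2) - 3 * f ^ 2 * g0 * s + 2 * g0 * g2 + 2 * g0 * q * s ^ 3 - g0 ^ 2 * q + g1 ^ 2 - g2 * s ^ 3 = 0"
    "3 * f * g1 * q * s ^ 2 - 3 * f * g3 * s ^ 2 + 3 * f ^ 2 * g0 * q * s - 3 * f ^ 2 * g2 * s - f ^ 3 * g1 - 2 * g0 * g2 * q - g0 * q ^ 2 * s ^ 3 + 2 * g1 * g3 + 2 * g2 * q * s ^ 3 + g2 ^ 2 = 0"
    "1 - g0 * s ^ 3 + g0 ^ 2 = 0"
    "3 * f * g2 * q * s ^ 2 - 3 * f ^ 2 * g3 * s - f ^ 3 * g2 + 2 * g2 * g3 + g3 * q * s ^ 3 - s = 0"
    "- (3 * f * g0 * s ^ 2) + 2 * g0 * g1 - g1 * s ^ 3 = 0"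
    "3 * f * g0 * q * s ^ 2 - 3 * f * g2 * s ^ 2 - 3 * f ^ 2 * g1 * s - f ^ 3 * g0 + 2 * g0 * g3 + 2 * g1 * g2 + g1 * q * s ^ 3 - g3 * s ^ 3 = 0"
    and nz: "450 * f * g1 * q * s ^ 2 + 450 * f ^ 2 * g0 * q * s - 225 * f ^ 2 * g2 * s - 150 * f ^ 3 * g1 - 150 * g0 * g2 * q - 150 * g0 * q ^ 2 * s ^ 3 + 150 * g1 * g3 + 75 * g2 * q * s ^ 3 + 75 * g2 ^ 2 \<noteq> 0" "- (135 * f * g0 * s) + 45 * g1 * s ^ 2 \<noteq> 0"
  shows "orbifold_equivalent 2 2 (x\<^sub>1 ^ 5 * x\<^sub>2 + x\<^sub>2 ^ 3) (y\<^sub>1 ^ 3 * y\<^sub>2 + y\<^sub>2 ^ 5)"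
proof -
  define w where "w = weights [4 / 15, 2 / 3] [8 / 15, 2 / 5]"
  note w_simps = w_def weights_simps
  define S F G0 G1 G2 G3 Q :: "xy cpoly" where "S = pconst s" and "F = pconst f" and "G0 = pconst g0" and "G1 = pconst g1" and "G2 = pconst g2" and "G3 = pconst g3" and "Q = pconst q"
  note const_defs = S_def F_def G0_def G1_def G2_def G3_def Q_def
  define a1 where "a1 = - (F * x\<^sub>1 * y\<^sub>2) + x\<^sub>2"
  define a2 where "a2 = - (S * y\<^sub>2)"
  define b1 where "b1 = - (G1 * x\<^sub>1 * y\<^sub>1) - G3 * x\<^sub>1 ^ 3 + y\<^sub>2 ^ 2"
  define b2 where "b2 = - (G0 * y\<^sub>1) - G2 * x\<^sub>1 ^ 2"
  define c1 where "c1 = - (3 * F * Q * S ^ 2 * x\<^sub>1 ^ 3 * y\<^sub>2) + 3 * F * S ^ 2 * x\<^sub>1 * y\<^sub>1 * y\<^sub>2 + F ^ 3 * x\<^sub>1 ^ 3 * y\<^sub>2 - G1 * x\<^sub>1 * y\<^sub>1 * y\<^sub>2 - G3 * x\<^sub>1 ^ 3 * y\<^sub>2 - y\<^sub>2 ^ 3"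
  define c2 where "c2 = 3 * F ^ 2 * S * x\<^sub>1 ^ 2 * y\<^sub>2 - G0 * y\<^sub>1 * y\<^sub>2 - G2 * x\<^sub>1 ^ 2 * y\<^sub>2 - Q * S ^ 3 * x\<^sub>1 ^ 2 * y\<^sub>2 + S ^ 3 * y\<^sub>1 * y\<^sub>2"
  define d1 where "d1 = F * x\<^sub>1 * x\<^sub>2 * y\<^sub>2 + F ^ 2 * x\<^sub>1 ^ 2 * y\<^sub>2 ^ 2 - Q * S ^ 2 * x\<^sub>1 ^ 2 * y\<^sub>2 ^ 2 + S ^ 2 * y\<^sub>1 * y\<^sub>2 ^ 2 + x\<^sub>1 ^ 5 + x\<^sub>2 ^ 2"
  define d2 where "d2 = 2 * F * S * x\<^sub>1 * y\<^sub>2 ^ 2 + S * x\<^sub>2 * y\<^sub>2"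
  define N where "N = - (Q * x\<^sub>1 ^ 2) + y\<^sub>1"
  note entries = a1_def a2_def b1_def b2_def c1_def c2_def d1_def d2_def N_def
  let ?e = "[[a1, N * a2, b1, N * b2], [a2, a1, b2, b1], [- c1, - (N * c2), d1, N * d2], [- c2, - c1, d2, d1]]" and ?j = "[[d1, N * d2, - b1, - (N * b2)], [d2, d1, - b2, - b1], [c1, N * c2, a1, N * a2], [c2, c1, a2, a1]]"
  let ?C = "(- (3 * x\<^sub>2)) * (5 * x\<^sub>2) - (5 * x\<^sub>1 ^ 4) * (- x\<^sub>1) :: xy cpoly" and ?B = "(- (5 * y\<^sub>2 ^ 3)) * (3 * y\<^sub>2) - (3 * y\<^sub>1 ^ 2) * (- y\<^sub>1) :: xy cpoly"
  have rels': "- F + 3 * F * G3 * Q * S ^ 2 + 3 * F ^ 2 * G2 * Q * S - F ^ 3 * G3 - G2 * Q ^ 2 * S ^ 3 - G2 ^ 2 * Q + G3 ^ 2 = 0"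
    "- (3 * F * G1 * S ^ 2) - 3 * F ^ 2 * G0 * S + 2 * G0 * G2 + 2 * G0 * Q * S ^ 3 - G0 ^ 2 * Q + G1 ^ 2 - G2 * S ^ 3 = 0"
    "3 * F * G1 * Q * S ^ 2 - 3 * F * G3 * S ^ 2 + 3 * F ^ 2 * G0 * Q * S - 3 * F ^ 2 * G2 * S - F ^ 3 * G1 - 2 * G0 * G2 * Q - G0 * Q ^ 2 * S ^ 3 + 2 * G1 * G3 + 2 * G2 * Q * S ^ 3 + G2 ^ 2 = 0"
    "1 - G0 * S ^ 3 + G0 ^ 2 = 0"
    "3 * F * G2 * Q * S ^ 2 - 3 * F ^ 2 * G3 * S - F ^ 3 * G2 + 2 * G2 * G3 + G3 * Q * S ^ 3 - S = 0"
    "- (3 * F * G0 * S ^ 2) + 2 * G0 * G1 - G1 * S ^ 3 = 0"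
    "3 * F * G0 * Q * S ^ 2 - 3 * F * G2 * S ^ 2 - 3 * F ^ 2 * G1 * S - F ^ 3 * G0 + 2 * G0 * G3 + 2 * G1 * G2 + G1 * Q * S ^ 3 - G3 * S ^ 3 = 0"
    using rels[THEN arg_cong[where f = "pconst :: complex \<Rightarrow> xy cpoly"]]
    unfolding const_defs by (simp_all only: pconst_hom pconst_numeral pconst_1 pconst_0)
  have "a1 * d1 + N * (a2 * d2) + b1 * c1 + N * (b2 * c2) = (x\<^sub>1 ^ 5 * x\<^sub>2 + x\<^sub>2 ^ 3) - (y\<^sub>1 ^ 3 * y\<^sub>2 + y\<^sub>2 ^ 5) + ((- F + 3 * F * G3 * Q * S ^ 2 + 3 * F ^ 2 * G2 * Q * S - F ^ 3 * G3 - G2 * Q ^ 2 * S ^ 3 - G2 ^ 2 * Q + G3 ^ 2) * (x\<^sub>1 ^ 6 * y\<^sub>2) + (- (3 * F * G1 * S ^ 2) - 3 * F ^ 2 * G0 * S + 2 * G0 * G2 + 2 * G0 * Q * S ^ 3 - G0 ^ 2 * Q + G1 ^ 2 - G2 * S ^ 3) * (x\<^sub>1 ^ 2 * y\<^sub>1 ^ 2 * y\<^sub>2) + (3 * F * G1 * Q * S ^ 2 - 3 * F * G3 * S ^ 2 + 3 * F ^ 2 * G0 * Q * S - 3 * F ^ 2 * G2 * S - F ^ 3 * G1 - 2 * G0 * G2 * Q - G0 * Q ^ 2 * S ^ 3 + 2 * G1 * G3 + 2 * G2 * Q * S ^ 3 + G2 ^ 2) * (x\<^sub>1 ^ 4 *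 y\<^sub>1 * y\<^sub>2) + (1 - G0 * S ^ 3 + G0 ^ 2) * (y\<^sub>1 ^ 3 * y\<^sub>2))"
    and "a1 * d2 + a2 * d1 + b1 * c2 + b2 * c1 = (3 * F * G2 * Q * S ^ 2 - 3 * F ^ 2 * G3 * S - F ^ 3 * G2 + 2 * G2 * G3 + G3 * Q * S ^ 3 - S) * (x\<^sub>1 ^ 5 * y\<^sub>2) + (- (3 * F * G0 * S ^ 2) + 2 * G0 * G1 - G1 * S ^ 3) * (x\<^sub>1 * y\<^sub>1 ^ 2 * y\<^sub>2) + (3 * F * G0 * Q * S ^ 2 - 3 * F * G2 * S ^ 2 - 3 * F ^ 2 * G1 * S - F ^ 3 * G0 + 2 * G0 * G3 + 2 * G1 * G2 + G1 * Q * S ^ 3 - G3 * S ^ 3) * (x\<^sub>1 ^ 3 * y\<^sub>1 * y\<^sub>2)"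
    unfolding entries by Groebner_Basis.algebra+
  then have W: "a1 * d1 + N * (a2 * d2) + b1 * c1 + N * (b2 * c2) = (x\<^sub>1 ^ 5 * x\<^sub>2 + x\<^sub>2 ^ 3) - (y\<^sub>1 ^ 3 * y\<^sub>2 + y\<^sub>2 ^ 5)"
    and O: "a1 * d2 + a2 * d1 + b1 * c2 + b2 * c1 = 0"
    unfolding rels' by simp_all
  note mf = lprod_block[OF W O]
  have L: "list_supertrace_4 4 {Y 1, Y 2} ?e ?j (X 1) (X 2) (Y 1) (Y 2) = - (30 * F * G1 * Q * S ^ 2 * x\<^sub>1 ^ 8) - 30 * F ^ 2 * G0 * Q * S * x\<^sub>1 ^ 8 + 15 * F ^ 2 * G2 * S * x\<^sub>1 ^ 8 + 10 * F ^ 3 * G1 * x\<^sub>1 ^ 8 + 10 * G0 * G2 * Q * x\<^sub>1 ^ 8 + 10 * G0 * Q ^ 2 * S ^ 3 * x\<^sub>1 ^ 8 - 10 * G1 * G3 * x\<^sub>1 ^ 8 - 5 * G2 * Q * S ^ 3 * x\<^sub>1 ^ 8 - 5 * G2 ^ 2 * x\<^sub>1 ^ 8" (is "?l = ?r")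
  proof -
    have "eqv ?l ?r"
      by (simp add: list_supertrace_4_def entries const_defs list_comp trace2_numeral pderiv_simps zero_vars_simps,
          (unfold eqv_def, Groebner_Basis.algebra)?)
    then show ?thesis by (rule eqvD)
  qed
  have R: "list_supertrace_4 4 {X 1, X 2} ?e ?j (X 1) (X 2) (Y 1) (Y 2) = - (45 * F * G0 * S * y\<^sub>1 * y\<^sub>2 ^ 4) + 15 * G1 * S ^ 2 * y\<^sub>1 * y\<^sub>2 ^ 4" (is "?l = ?r")
  proof -
    have "eqv ?l ?r"
      by (simp add: list_supertrace_4_def entries const_defs list_comp trace2_numeral pderiv_simps zero_vars_simps,
          (unfold eqv_def, Groebner_Basis.algebra)?)
    then show ?thesis by (rule eqvD)
  qed
  have LC: "(?C) * (- (30 * F * G1 * Q * S ^ 2 * x\<^sub>1 ^ 8) - 30 * F ^ 2 * G0 * Q * S * x\<^sub>1 ^ 8 + 15 * F ^ 2 * G2 * S * x\<^sub>1 ^ 8 + 10 * F ^ 3 * G1 * x\<^sub>1 ^ 8 + 10 * G0 * G2 * Q * x\<^sub>1 ^ 8 + 10 * G0 * Q ^ 2 * S ^ 3 * x\<^sub>1 ^ 8 - 10 * G1 * G3 * x\<^sub>1 ^ 8 - 5 * G2 * Q * S ^ 3 * x\<^sub>1 ^ 8 - 5 * G2 ^ 2 * x\<^sub>1 ^ 8) = pconst (450 * f * g1 * q * s ^ 2 + 450 * f ^ 2 * g0 * q * s - 225 * f ^ 2 * g2 * s - 150 * f ^ 3 * g1 - 150 * g0 * g2 * q - 150 * g0 *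 q ^ 2 * s ^ 3 + 150 * g1 * g3 + 75 * g2 * q * s ^ 3 + 75 * g2 ^ 2) * (x\<^sub>1 ^ 8 * x\<^sub>2 ^ 2) + pconst (- (150 * f * g1 * q * s ^ 2) - 150 * f ^ 2 * g0 * q * s + 75 * f ^ 2 * g2 * s + 50 * f ^ 3 * g1 + 50 * g0 * g2 * q + 50 * g0 * q ^ 2 * s ^ 3 - 50 * g1 * g3 - 25 * g2 * q * s ^ 3 - 25 * g2 ^ 2) * (x\<^sub>1 ^ 13 * x\<^sub>2 ^ 0)"
    unfolding const_defs by (simp only: pconst_hom pconst_numeral pconst_1 pconst_0) Groebner_Basis.algebra
  have RB: "(?B) * (- (45 * F * G0 * S * y\<^sub>1 * y\<^sub>2 ^ 4) + 15 * G1 * S ^ 2 * y\<^sub>1 * y\<^sub>2 ^ 4) = pconst (675 * f * g0 * s - 225 * g1 * s ^ 2) * (y\<^sub>1 ^ 1 * y\<^sub>2 ^ 8) + pconst (- (135 * f * g0 * s) + 45 * g1 * s ^ 2) * (y\<^sub>1 ^ 4 * y\<^sub>2 ^ 4)"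
    unfolding const_defs by (simp only: pconst_hom pconst_numeral pconst_1 pconst_0) Groebner_Basis.algebra
  show ?thesis
  \<comment> \<open>The second row of each certificate is a diagonal vector field under which the
    mixed monomial has degree 0, so that only a power of one variable survives; in the first row the
    mixed terms cancel directly.\<close>
  proof (rule orbifold_equivalent_2I[where w = w and N = 4 and e = ?e and j = ?j
      and ga = "[0, 4 / 15, - (8 / 15), - (4 / 15)]" and gb = "[- (1 / 3), - (1 / 15), - (1 / 5), 1 / 15]"
      and d = "4 / 3" and d' = "8 / 5"
      and ?c11.0 = "- (3 * x\<^sub>2)" and ?c12.0 = "5 * x\<^sub>1 ^ 4" and ?c21.0 = "- x\<^sub>1" and ?c22.0 = "5 * x\<^sub>2"
      and ?b11.0 = "- (5 * y\<^sub>2 ^ 3)" and ?b12.0 = "3 * y\<^sub>1 ^ 2" and ?b21.0 = "- y\<^sub>1" and ?b22.0 = "3 * y\<^sub>2"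
      and ?m1.0 = 5 and ?n1.0 = 3 and ?k1.0 = 8 and ?l1.0 = 4 and ?m2.0 = 15 and ?n2.0 = 15 and ?k2.0 = 2 and ?l2.0 = 4])
    show "x\<^sub>1 ^ 5 * x\<^sub>2 + x\<^sub>2 ^ 3 \<in> polys_in {X 1, X 2}" "y\<^sub>1 ^ 3 * y\<^sub>2 + y\<^sub>2 ^ 5 \<in> polys_in {Y 1, Y 2}" by (intro polys_in_intros; simp)+
    show "quasi_homogeneous w 2 (x\<^sub>1 ^ 5 * x\<^sub>2 + x\<^sub>2 ^ 3)" "quasi_homogeneous w 2 (y\<^sub>1 ^ 3 * y\<^sub>2 + y\<^sub>2 ^ 5)" by (rule qh_base | rule qh_step | rule refl | (simp add: w_simps; fail))+
    show "\<forall>v\<in>{X 1, X 2, Y 1, Y 2}. 0 < w v \<and> w v < 2" by (simp add: w_simps)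
    show "\<forall>c\<in>{- (3 * x\<^sub>2), 5 * x\<^sub>1 ^ 4, - x\<^sub>1, 5 * x\<^sub>2}. c \<in> polys_in {X 1, X 2}" by (auto intro!: polys_in_intros)
    show "\<forall>c\<in>{- (5 * y\<^sub>2 ^ 3), 3 * y\<^sub>1 ^ 2, - y\<^sub>1, 3 * y\<^sub>2}. c \<in> polys_in {Y 1, Y 2}" by (auto intro!: polys_in_intros)
    show "(- (3 * x\<^sub>2)) * pderiv_wrt (X 1) (x\<^sub>1 ^ 5 * x\<^sub>2 + x\<^sub>2 ^ 3) + 5 * x\<^sub>1 ^ 4 * pderiv_wrt (X 2) (x\<^sub>1 ^ 5 * x\<^sub>2 + x\<^sub>2 ^ 3) = pconst 5 * x\<^sub>1 ^ Suc 8"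
      by (rule eqvD, simp add: pderiv_simps, ((unfold eqv_def)?, Groebner_Basis.algebra)?)
    show "(- x\<^sub>1) * pderiv_wrt (X 1) (x\<^sub>1 ^ 5 * x\<^sub>2 + x\<^sub>2 ^ 3) + 5 * x\<^sub>2 * pderiv_wrt (X 2) (x\<^sub>1 ^ 5 * x\<^sub>2 + x\<^sub>2 ^ 3) = pconst 15 * x\<^sub>2 ^ Suc 2"
      by (rule eqvD, simp add: pderiv_simps, ((unfold eqv_def)?, Groebner_Basis.algebra)?)
    show "(- (5 * y\<^sub>2 ^ 3)) * pderiv_wrt (Y 1) (y\<^sub>1 ^ 3 * y\<^sub>2 + y\<^sub>2 ^ 5) + 3 * y\<^sub>1 ^ 2 * pderiv_wrt (Y 2) (y\<^sub>1 ^ 3 * y\<^sub>2 + y\<^sub>2 ^ 5) = pconst 3 * y\<^sub>1 ^ Suc 4"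
      by (rule eqvD, simp add: pderiv_simps, ((unfold eqv_def)?, Groebner_Basis.algebra)?)
    show "(- y\<^sub>1) * pderiv_wrt (Y 1) (y\<^sub>1 ^ 3 * y\<^sub>2 + y\<^sub>2 ^ 5) + 3 * y\<^sub>2 * pderiv_wrt (Y 2) (y\<^sub>1 ^ 3 * y\<^sub>2 + y\<^sub>2 ^ 5) = pconst 15 * y\<^sub>2 ^ Suc 4"
      by (rule eqvD, simp add: pderiv_simps, ((unfold eqv_def)?, Groebner_Basis.algebra)?)
    have det: "?C = 5 * x\<^sub>1 ^ 5 - 15 * x\<^sub>2 ^ 2" by ((simp; fail) | Groebner_Basis.algebra)
    show "quasi_homogeneous w (4 / 3) (?C)" unfolding det by ((rule qh_base | rule qh_step | rule refl | (simp add: w_simps; fail))+)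
    have det: "?B = 3 * y\<^sub>1 ^ 3 - 15 * y\<^sub>2 ^ 4" by ((simp; fail) | Groebner_Basis.algebra)
    show "quasi_homogeneous w (8 / 5) (?B)" unfolding det by ((rule qh_base | rule qh_step | rule refl | (simp add: w_simps; fail))+)
    show "lk ((?C) * (list_supertrace_4 4 {Y 1, Y 2} ?e ?j (X 1) (X 2) (Y 1) (Y 2))) (single (X 1) 8 + single (X 2) 2) \<noteq> 0"
      unfolding L LC by (simp only: lookup_add lookup_monom_2) (use nz in simp)
    show "lk ((?B) * (list_supertrace_4 4 {X 1, X 2} ?e ?j (X 1) (X 2) (Y 1) (Y 2))) (single (Y 1) 4 + single (Y 2) 4) \<noteq> 0"
      unfolding R RB by (simp only: lookup_add lookup_monom_2) (use nz in simp)
    show "\<forall>r\<in>set ?e \<union> set ?j. \<forall>p\<in>set r. p \<in> polys_in {X 1, X 2, Y 1, Y 2} \<and> zero_vars UNIV p = 0"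
      unfolding entries const_defs by (simp add: zero_vars_simps) (intro conjI polys_in_intros; simp)
    show "list_all2 (\<lambda>a. list_all2 (\<lambda>b. quasi_homogeneous w (b - a + 1)) [- (1 / 3), - (1 / 15), - (1 / 5), 1 / 15]) [0, 4 / 15, - (8 / 15), - (4 / 15)] ?e"
      "list_all2 (\<lambda>b. list_all2 (\<lambda>a. quasi_homogeneous w (a - b + 1)) [0, 4 / 15, - (8 / 15), - (4 / 15)]) [- (1 / 3), - (1 / 15), - (1 / 5), 1 / 15] ?j"
      by (simp add: entries const_defs, ((rule conjI qh_base | rule qh_step | rule refl | (simp add: w_simps; fail))+)?)+
  qed ((rule mf | (simp add: w_simps; fail))+)
qed

text \<open>Put P = GA^2 \<open>x\<^sub>1 ^ 2\<close> + \<open>y\<^sub>2\<close> and R =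
  \<open>y\<^sub>2\<close> + (2 GA NU + 2 NU^2) \<open>x\<^sub>1 ^ 2\<close>, so U = B^2 P, Z = EE R
  and T = \<open>x\<^sub>1\<close> (2 NU P + GA R). As B EE = 1, T^2 - Z^2 U =
  \<open>x\<^sub>1 ^ 2\<close> (2 NU P + GA R)^2 - P R^2, and this is to be
  \<open>x\<^sub>1 ^ 6 - y\<^sub>2 ^ 3\<close>. The form of R makes the coefficient of
  \<open>x\<^sub>1 ^ 2 * y\<^sub>2 ^ 2\<close> vanish; the third and fourth relations settle those
  of \<open>x\<^sub>1 ^ 4 * y\<^sub>2\<close> and \<open>x\<^sub>1 ^ 6\<close>.\<close>

lemma orbifold_equivalent_Z13_Q11:
  fixes b e ga nu i :: complex
  assumes rels: "- 1 + b * e = 0"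
    "- (b ^ 2) + 4 * e * nu = 0"
    "3 * ga ^ 2 * nu + ga ^ 3 - nu ^ 3 = 0"
    "- 1 + 8 * ga ^ 3 * nu ^ 3 + 12 * ga ^ 4 * nu ^ 2 = 0"
    "1 + i ^ 2 = 0"
    and nz: "72 * b ^ 2 * e * ga * i ^ 5 * nu ^ 4 + 88 * b ^ 2 * e * ga ^ 2 * i ^ 5 * nu ^ 3 + 32 * b ^ 2 * e * ga ^ 4 * i ^ 5 * nu - 96 * b ^ 2 * e ^ 4 * ga * i ^ 5 * nu ^ 5 - 32 * b ^ 2 * e ^ 4 * ga ^ 2 * i ^ 5 * nu ^ 4 + 96 * b ^ 2 * e ^ 4 * ga ^ 3 * i ^ 5 * nu ^ 3 + 64 * b ^ 2 * e ^ 4 * ga ^ 4 * i ^ 5 * nu ^ 2 - 32 * b ^ 2 * e ^ 4 * i ^ 5 * nu ^ 6 + 64 * e ^ 2 * ga * i ^ 5 * nu ^ 5 + 64 * e ^ 2 * ga ^ 2 * i ^ 5 * nu ^ 4 - 160 * e ^ 2 * ga ^ 3 * i ^ 5 * nu ^ 3 - 160 * e ^ 2 * ga ^ 4 * i ^ 5 * nu ^ 2 + 24 * e ^ 2 * i ^ 5 \<noteq> 0"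
      "72 * b ^ 2 * e ^ 3 * ga * i ^ 5 - 16 * b ^ 2 * e ^ 3 * i ^ 5 * nu - 32 * b ^ 4 * e ^ 2 * i ^ 5 - 72 * e * ga * i ^ 5 - 144 * e * i ^ 5 * nu \<noteq> 0"
  shows "orbifold_equivalent 3 3 (x\<^sub>1 ^ 6 + x\<^sub>1 * x\<^sub>2 ^ 3 + x\<^sub>3 ^ 2) (y\<^sub>2 * y\<^sub>3 ^ 3 + y\<^sub>2 ^ 3 + y\<^sub>1 ^ 2 * y\<^sub>3)"
proof -
  define w where "w = weights [1 / 3, 5 / 9, 1] [7 / 9, 2 / 3, 4 / 9]"
  note w_simps = w_def weights_simps
  define B EE GA NU II :: "xy cpoly" where "B = pconst b" and "EE = pconst e" and "GA = pconst ga" and "NU = pconst nu" and "II = pconst i"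
  note const_defs = B_def EE_def GA_def NU_def II_def
  define U where "U = B ^ 2 * (GA ^ 2 * x\<^sub>1 ^ 2 + y\<^sub>2)"
  define Z where "Z = EE * (y\<^sub>2 + (2 * GA * NU + 2 * NU ^ 2) * x\<^sub>1 ^ 2)"
  define T where "T = x\<^sub>1 * (2 * NU * (GA ^ 2 * x\<^sub>1 ^ 2 + y\<^sub>2) + GA * (y\<^sub>2 + (2 * GA * NU + 2 * NU ^ 2) * x\<^sub>1 ^ 2))"
  define Yp where "Yp = y\<^sub>1 + GA * x\<^sub>1 * y\<^sub>3"
  define Ym where "Ym = y\<^sub>1 - GA * x\<^sub>1 * y\<^sub>3"
  note entries = U_def Z_def T_def Yp_def Ym_def
  let ?e = "[[x\<^sub>3 + II * (- (EE * x\<^sub>2 * y\<^sub>3) + T), II * Z, II * Ym, II * (- (EE ^ 2 * y\<^sub>3 ^ 2) + x\<^sub>1 * x\<^sub>2), II * (- (EE * Z * y\<^sub>3)), II * (- (EE * Ym * y\<^sub>3))],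
      [II * (Yp * x\<^sub>2 - Z * U), x\<^sub>3 + II * (- T), II * (EE * U * y\<^sub>3), II * (EE * Yp * y\<^sub>3), II * (Yp * Z + U * x\<^sub>1 * y\<^sub>3 - x\<^sub>1 * x\<^sub>2 ^ 2), II * (Ym * Yp - U * x\<^sub>1 * x\<^sub>2)],
      [II * (- (Yp * y\<^sub>3) - Z * x\<^sub>2), II * (- (EE * y\<^sub>3 ^ 2)), x\<^sub>3 + II * (- T), II * (- (EE * Z * y\<^sub>3)), II * (- (Z ^ 2) + x\<^sub>1 * x\<^sub>2 * y\<^sub>3), II * (- (Ym * Z) + U * x\<^sub>1 * y\<^sub>3 - x\<^sub>1 * x\<^sub>2 ^ 2)],
      [II * (U * y\<^sub>3 + x\<^sub>2 ^ 2), 0, 0, x\<^sub>3 + II * (EE * x\<^sub>2 * y\<^sub>3 - T), II * (- (Ym * y\<^sub>3) + Z * x\<^sub>2), II * (Ym * x\<^sub>2 + Z * U)],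
      [0, II * (- x\<^sub>2), II * U, II * Yp, x\<^sub>3 + II * T, II * (- (EE * U * y\<^sub>3))],
      [0, II * (- y\<^sub>3), II * (- x\<^sub>2), II * (- Z), II * (EE * y\<^sub>3 ^ 2), x\<^sub>3 + II * T]]" and ?j = "[[x\<^sub>3 + - II * (- (EE * x\<^sub>2 * y\<^sub>3) + T), - II * Z, - II * Ym, - II * (- (EE ^ 2 * y\<^sub>3 ^ 2) + x\<^sub>1 * x\<^sub>2), - II * (- (EE * Z * y\<^sub>3)), - II * (- (EE * Ym * y\<^sub>3))],
      [- II * (Yp * x\<^sub>2 - Z * U), x\<^sub>3 + - II * (- T), - II * (EE * U * y\<^sub>3), - II * (EE * Yp * y\<^sub>3), - II * (Yp * Z + U * x\<^sub>1 * y\<^sub>3 - x\<^sub>1 * x\<^sub>2 ^ 2), - II * (Ym * Yp - U * x\<^sub>1 * x\<^sub>2)],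
      [- II * (- (Yp * y\<^sub>3) - Z * x\<^sub>2), - II * (- (EE * y\<^sub>3 ^ 2)), x\<^sub>3 + - II * (- T), - II * (- (EE * Z * y\<^sub>3)), - II * (- (Z ^ 2) + x\<^sub>1 * x\<^sub>2 * y\<^sub>3), - II * (- (Ym * Z) + U * x\<^sub>1 * y\<^sub>3 - x\<^sub>1 * x\<^sub>2 ^ 2)],
      [- II * (U * y\<^sub>3 + x\<^sub>2 ^ 2), 0, 0, x\<^sub>3 + - II * (EE * x\<^sub>2 * y\<^sub>3 - T), - II * (- (Ym * y\<^sub>3) + Z * x\<^sub>2), - II * (Ym * x\<^sub>2 + Z * U)],
      [0, - II * (- x\<^sub>2), - II * U, - II * Yp, x\<^sub>3 + - II * T, - II * (- (EE * U * y\<^sub>3))],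
      [0, - II * (- y\<^sub>3), - II * (- x\<^sub>2), - II * (- Z), - II * (EE * y\<^sub>3 ^ 2), x\<^sub>3 + - II * T]]"
  let ?C = "(3 * x\<^sub>1) * ((- (2 * x\<^sub>1 ^ 4)) * (1) - (0) * (0)) - (- x\<^sub>2) * ((x\<^sub>2 ^ 2) * (1) - (0) * (0)) + (0) * ((x\<^sub>2 ^ 2) * (0) - (- (2 * x\<^sub>1 ^ 4)) * (0)) :: xy cpoly" and ?B = "(- (3 * y\<^sub>2 * y\<^sub>3)) * ((6 * y\<^sub>2) * (- (2 * y\<^sub>2 * y\<^sub>3)) - (- (2 * y\<^sub>3)) * (2 * y\<^sub>3 ^ 3)) - (0) * ((y\<^sub>1) * (- (2 * y\<^sub>2 * y\<^sub>3)) - (- (2 * y\<^sub>3)) * (y\<^sub>1 * y\<^sub>2)) + (2 * y\<^sub>1) * ((y\<^sub>1) * (2 * y\<^sub>3 ^ 3) - (6 * y\<^sub>2) * (y\<^sub>1 * y\<^sub>2)) :: xy cpoly"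
  have rels': "- 1 + B * EE = 0"
    "- (B ^ 2) + 4 * EE * NU = 0"
    "3 * GA ^ 2 * NU + GA ^ 3 - NU ^ 3 = 0"
    "- 1 + 8 * GA ^ 3 * NU ^ 3 + 12 * GA ^ 4 * NU ^ 2 = 0"
    "1 + II ^ 2 = 0"
    using rels[THEN arg_cong[where f = "pconst :: complex \<Rightarrow> xy cpoly"]]
    unfolding const_defs by (simp_all only: pconst_hom pconst_numeral pconst_1 pconst_0)
  \<comment> \<open>\<open>R2\<close> and \<open>R3\<close> are the defects by which the square of
    the matrix fails to be \<open>D\<close> times the identity; they are multiples of the second and
    of the first relation.\<close>
  define R2 R3 D where "R2 = 2 * EE * T - x\<^sub>1 * U - 2 * GA * x\<^sub>1 * Z" and "R3 = EE ^ 2 * U - GA ^ 2 * x\<^sub>1 ^ 2 - y\<^sub>2" and "D = T ^ 2 - Z ^ 2 * U + x\<^sub>1 * x\<^sub>2 ^ 3 - y\<^sub>1 ^ 2 * y\<^sub>3 - y\<^sub>2 * y\<^sub>3 ^ 3"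
  have "R2 = x\<^sub>1 * (GA ^ 2 * x\<^sub>1 ^ 2 + y\<^sub>2) * (- (B ^ 2) + 4 * EE * NU)"
    and "R3 = (GA ^ 2 * x\<^sub>1 ^ 2 + y\<^sub>2) * (B * EE + 1) * (- 1 + B * EE)"
    unfolding R2_def R3_def entries by Groebner_Basis.algebra+
  then have R: "R2 = 0" "R3 = 0" unfolding rels' by simp_all
  have "D = (x\<^sub>1 ^ 6 + x\<^sub>1 * x\<^sub>2 ^ 3) - (y\<^sub>2 * y\<^sub>3 ^ 3 + y\<^sub>2 ^ 3 + y\<^sub>1 ^ 2 * y\<^sub>3) + x\<^sub>1 ^ 6 * (- 1 + 8 * GA ^ 3 * NU ^ 3 + 12 * GA ^ 4 * NU ^ 2)
      + 4 * NU * x\<^sub>1 ^ 4 * y\<^sub>2 * (3 * GA ^ 2 * NU + GA ^ 3 - NU ^ 3)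
      - (B * EE + 1) * (GA ^ 2 * x\<^sub>1 ^ 2 + y\<^sub>2) * (y\<^sub>2 + (2 * GA * NU + 2 * NU ^ 2) * x\<^sub>1 ^ 2) ^ 2 * (- 1 + B * EE)"
    unfolding D_def entries by Groebner_Basis.algebra
  then have D: "D = (x\<^sub>1 ^ 6 + x\<^sub>1 * x\<^sub>2 ^ 3) - (y\<^sub>2 * y\<^sub>3 ^ 3 + y\<^sub>2 ^ 3 + y\<^sub>1 ^ 2 * y\<^sub>3)" unfolding rels' by simp
  let ?c = "[[- (EE * x\<^sub>2 * y\<^sub>3) + T, Z, Ym, - (EE ^ 2 * y\<^sub>3 ^ 2) + x\<^sub>1 * x\<^sub>2, - (EE * Z * y\<^sub>3), - (EE * Ym * y\<^sub>3)],
      [Yp * x\<^sub>2 - Z * U, - T, EE * U * y\<^sub>3, EE * Yp * y\<^sub>3, Yp * Z + U * x\<^sub>1 * y\<^sub>3 - x\<^sub>1 * x\<^sub>2 ^ 2, Ym * Yp - U * x\<^sub>1 * x\<^sub>2],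
      [- (Yp * y\<^sub>3) - Z * x\<^sub>2, - (EE * y\<^sub>3 ^ 2), - T, - (EE * Z * y\<^sub>3), - (Z ^ 2) + x\<^sub>1 * x\<^sub>2 * y\<^sub>3, - (Ym * Z) + U * x\<^sub>1 * y\<^sub>3 - x\<^sub>1 * x\<^sub>2 ^ 2],
      [U * y\<^sub>3 + x\<^sub>2 ^ 2, 0, 0, EE * x\<^sub>2 * y\<^sub>3 - T, - (Ym * y\<^sub>3) + Z * x\<^sub>2, Ym * x\<^sub>2 + Z * U],
      [0, - x\<^sub>2, U, Yp, T, - (EE * U * y\<^sub>3)],
      [0, - y\<^sub>3, - x\<^sub>2, - Z, EE * y\<^sub>3 ^ 2, T]]"
  have "lprod 6 ?c ?c = [[D + (- (x\<^sub>2 * y\<^sub>3)) * R2 + (- (y\<^sub>3 ^ 3)) * R3, 0, 0, 0, (- (Z * y\<^sub>3)) * R2, (GA * x\<^sub>1 * y\<^sub>3 ^ 2 - y\<^sub>1 * y\<^sub>3) * R2],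
      [0, D + (- (y\<^sub>3 ^ 3)) * R3, (- (U * y\<^sub>3)) * R2, (- (GA * x\<^sub>1 * y\<^sub>3 ^ 2) - y\<^sub>1 * y\<^sub>3) * R2, 0, 0],
      [0, (y\<^sub>3 ^ 2) * R2, D + (- (y\<^sub>3 ^ 3)) * R3, (Z * y\<^sub>3) * R2, 0, 0],
      [0, 0, 0, D + (- (x\<^sub>2 * y\<^sub>3)) * R2 + (- (y\<^sub>3 ^ 3)) * R3, 0, 0],
      [0, 0, 0, 0, D + (- (y\<^sub>3 ^ 3)) * R3, (- (U * y\<^sub>3)) * R2],
      [0, 0, 0, 0, (y\<^sub>3 ^ 2) * R2, D + (- (y\<^sub>3 ^ 3)) * R3]]"
    by (rule list_eqvI, simp add: list_comp, ((intro conjI)?; unfold eqv_def R2_def R3_def D_def Yp_def Ym_def; Groebner_Basis.algebra))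
  then have cc: "lprod 6 ?c ?c = diag_list 6 D" unfolding R by (simp add: diag_list_numeral)
  have i2: "II ^ 2 = - 1" "(- II) ^ 2 = - 1" using rels'(5) by (simp_all add: add_eq_0_iff)
  have sq: "sqlist 6 ?c" by simp
  have W: "x\<^sub>3 ^ 2 + D = (x\<^sub>1 ^ 6 + x\<^sub>1 * x\<^sub>2 ^ 3 + x\<^sub>3 ^ 2) - (y\<^sub>2 * y\<^sub>3 ^ 3 + y\<^sub>2 ^ 3 + y\<^sub>1 ^ 2 * y\<^sub>3)" unfolding D by Groebner_Basis.algebra
  note mf = lprod_linear_list[OF sq cc i2(1), of x\<^sub>3, unfolded linear_list_6 W mult_zero_right]
     lprod_linear_list[OF sq cc i2(2), of x\<^sub>3, unfolded linear_list_6 W mult_zero_right minus_minus]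
  have L: "list_supertrace_6 6 {Y 1, Y 2, Y 3} ?e ?j (X 1) (X 2) (X 3) (Y 1) (Y 2) (Y 3) = 72 * B ^ 2 * EE * GA * II ^ 5 * NU ^ 4 * x\<^sub>1 ^ 5 * x\<^sub>2 + 88 * B ^ 2 * EE * GA ^ 2 * II ^ 5 * NU ^ 3 * x\<^sub>1 ^ 5 * x\<^sub>2 + 32 * B ^ 2 * EE * GA ^ 4 * II ^ 5 * NU * x\<^sub>1 ^ 5 * x\<^sub>2 - 96 * B ^ 2 * EE ^ 4 * GA * II ^ 5 * NU ^ 5 * x\<^sub>1 ^ 5 * x\<^sub>2 - 32 * B ^ 2 * EE ^ 4 * GA ^ 2 * II ^ 5 * NU ^ 4 * x\<^sub>1 ^ 5 * x\<^sub>2 + 96 * B ^ 2 * EE ^ 4 * GA ^ 3 * II ^ 5 * NU ^ 3 * x\<^sub>1 ^ 5 * x\<^sub>2 + 64 * B ^ 2 * EE ^ 4 * GA ^ 4 * II ^ 5 * NU ^ 2 * x\<^sub>1 ^ 5 * x\<^sub>2 - 32 * B ^ 2 * EE ^ 4 * II ^ 5 * NU ^ 6 * x\<^sub>1 ^ 5 * x\<^sub>2 + 64 * EE ^ 2 * GA * II ^ 5 * NU ^ 5 * x\<^sub>1 ^ 5 * x\<^sub>2 + 64 * EE ^ 2 * GA ^ 2 * II ^ 5 * NU ^ 4 * x\<^sub>1 ^ 5 * x\<^sub>2 - 160 * EE ^ 2 * GA ^ 3 * II ^ 5 * NU ^ 3 * x\<^sub>1 ^ 5 * x\<^sub>2 -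 160 * EE ^ 2 * GA ^ 4 * II ^ 5 * NU ^ 2 * x\<^sub>1 ^ 5 * x\<^sub>2 - 4 * EE ^ 2 * II ^ 5 * x\<^sub>2 ^ 4" (is "?l = ?r")
  proof -
    have "eqv ?l ?r"
      by (simp add: list_supertrace_6_def entries const_defs list_comp trace2_numeral pderiv_simps zero_vars_simps,
          (unfold eqv_def, Groebner_Basis.algebra)?)
    then show ?thesis by (rule eqvD)
  qed
  have R: "list_supertrace_6 6 {X 1, X 2, X 3} ?e ?j (X 1) (X 2) (X 3) (Y 1) (Y 2) (Y 3) = - (12 * B ^ 2 * EE ^ 3 * GA * II ^ 5 * y\<^sub>2 ^ 2 * y\<^sub>3 ^ 2) - 10 * B ^ 2 * EE ^ 3 * GA * II ^ 5 * y\<^sub>3 ^ 5 - 4 * B ^ 2 * EE ^ 3 * II ^ 5 * NU * y\<^sub>2 ^ 2 * y\<^sub>3 ^ 2 - 8 * B ^ 4 * EE ^ 2 * II ^ 5 * y\<^sub>2 ^ 2 * y\<^sub>3 ^ 2 + 6 * EE * GA * II ^ 5 * y\<^sub>1 ^ 2 * y\<^sub>2 + 12 * EE * II ^ 5 * NU * y\<^sub>1 ^ 2 * y\<^sub>2" (is "?l = ?r")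
  proof -
    have "eqv ?l ?r"
      by (simp add: list_supertrace_6_def entries const_defs list_comp trace2_numeral pderiv_simps zero_vars_simps,
          (unfold eqv_def, Groebner_Basis.algebra)?)
    then show ?thesis by (rule eqvD)
  qed
  have LC: "(?C) * (72 * B ^ 2 * EE * GA * II ^ 5 * NU ^ 4 * x\<^sub>1 ^ 5 * x\<^sub>2 + 88 * B ^ 2 * EE * GA ^ 2 * II ^ 5 * NU ^ 3 * x\<^sub>1 ^ 5 * x\<^sub>2 + 32 * B ^ 2 * EE * GA ^ 4 * II ^ 5 * NU * x\<^sub>1 ^ 5 * x\<^sub>2 - 96 * B ^ 2 * EE ^ 4 * GA * II ^ 5 * NU ^ 5 * x\<^sub>1 ^ 5 * x\<^sub>2 - 32 * B ^ 2 * EE ^ 4 * GA ^ 2 * II ^ 5 * NU ^ 4 * x\<^sub>1 ^ 5 * x\<^sub>2 + 96 * B ^ 2 * EE ^ 4 * GA ^ 3 * II ^ 5 * NU ^ 3 * x\<^sub>1 ^ 5 * x\<^sub>2 + 64 * B ^ 2 * EE ^ 4 * GA ^ 4 * II ^ 5 * NU ^ 2 * x\<^sub>1 ^ 5 * x\<^sub>2 - 32 * B ^ 2 * EE ^ 4 * II ^ 5 * NU ^ 6 * x\<^sub>1 ^ 5 * x\<^sub>2 + 64 * EE ^ 2 * GA * II ^ 5 * NU ^ 5 * x\<^sub>1 ^ 5 * x\<^sub>2 + 64 * EE ^ 2 * GA ^ 2 * II ^ 5 * NU ^ 4 * x\<^sub>1 ^ 5 * x\<^sub>2 - 160 * EE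 ^ 2 * GA ^ 3 * II ^ 5 * NU ^ 3 * x\<^sub>1 ^ 5 * x\<^sub>2 - 160 * EE ^ 2 * GA ^ 4 * II ^ 5 * NU ^ 2 * x\<^sub>1 ^ 5 * x\<^sub>2 - 4 * EE ^ 2 * II ^ 5 * x\<^sub>2 ^ 4) = pconst (72 * b ^ 2 * e * ga * i ^ 5 * nu ^ 4 + 88 * b ^ 2 * e * ga ^ 2 * i ^ 5 * nu ^ 3 + 32 * b ^ 2 * e * ga ^ 4 * i ^ 5 * nu - 96 * b ^ 2 * e ^ 4 * ga * i ^ 5 * nu ^ 5 - 32 * b ^ 2 * e ^ 4 * ga ^ 2 * i ^ 5 * nu ^ 4 + 96 * b ^ 2 * e ^ 4 * ga ^ 3 * i ^ 5 * nu ^ 3 + 64 * b ^ 2 * e ^ 4 * ga ^ 4 * i ^ 5 * nu ^ 2 - 32 * b ^ 2 * e ^ 4 * i ^ 5 * nu ^ 6 + 64 * e ^ 2 * ga * i ^ 5 * nu ^ 5 + 64 * e ^ 2 * ga ^ 2 * i ^ 5 * nu ^ 4 - 160 * e ^ 2 * ga ^ 3 * i ^ 5 * nu ^ 3 - 160 * e ^ 2 * ga ^ 4 * i ^ 5 * nu ^ 2 + 24 * e ^ 2 * i ^ 5) * (x\<^sub>1 ^ 5 * (x\<^sub>2 ^ 4 * x\<^sub>3 ^ 0)) + pconst (- (432 * b ^ 2 * e * ga * i ^ 5 * nu ^ 4) - 528 * b ^ 2 * e * ga ^ 2 * i ^ 5 * nu ^ 3 - 192 * b ^ 2 * e * ga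 ^ 4 * i ^ 5 * nu + 576 * b ^ 2 * e ^ 4 * ga * i ^ 5 * nu ^ 5 + 192 * b ^ 2 * e ^ 4 * ga ^ 2 * i ^ 5 * nu ^ 4 - 576 * b ^ 2 * e ^ 4 * ga ^ 3 * i ^ 5 * nu ^ 3 - 384 * b ^ 2 * e ^ 4 * ga ^ 4 * i ^ 5 * nu ^ 2 + 192 * b ^ 2 * e ^ 4 * i ^ 5 * nu ^ 6 - 384 * e ^ 2 * ga * i ^ 5 * nu ^ 5 - 384 * e ^ 2 * ga ^ 2 * i ^ 5 * nu ^ 4 + 960 * e ^ 2 * ga ^ 3 * i ^ 5 * nu ^ 3 + 960 * e ^ 2 * ga ^ 4 * i ^ 5 * nu ^ 2) * (x\<^sub>1 ^ 10 * (x\<^sub>2 ^ 1 * x\<^sub>3 ^ 0)) + pconst (- (4 * e ^ 2 * i ^ 5)) * (x\<^sub>1 ^ 0 * (x\<^sub>2 ^ 7 * x\<^sub>3 ^ 0))"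
    unfolding const_defs by (simp only: pconst_hom pconst_numeral pconst_1 pconst_0) Groebner_Basis.algebra
  have RB: "(?B) * (- (12 * B ^ 2 * EE ^ 3 * GA * II ^ 5 * y\<^sub>2 ^ 2 * y\<^sub>3 ^ 2) - 10 * B ^ 2 * EE ^ 3 * GA * II ^ 5 * y\<^sub>3 ^ 5 - 4 * B ^ 2 * EE ^ 3 * II ^ 5 * NU * y\<^sub>2 ^ 2 * y\<^sub>3 ^ 2 - 8 * B ^ 4 * EE ^ 2 * II ^ 5 * y\<^sub>2 ^ 2 * y\<^sub>3 ^ 2 + 6 * EE * GA * II ^ 5 * y\<^sub>1 ^ 2 * y\<^sub>2 + 12 * EE * II ^ 5 * NU * y\<^sub>1 ^ 2 * y\<^sub>2) = pconst (- (432 * b ^ 2 * e ^ 3 * ga * i ^ 5) - 144 * b ^ 2 * e ^ 3 * i ^ 5 * nu - 288 * b ^ 4 * e ^ 2 * i ^ 5) * (y\<^sub>1 ^ 0 * (y\<^sub>2 ^ 5 * y\<^sub>3 ^ 4)) + pconst (- (216 * b ^ 2 * e ^ 3 * ga * i ^ 5) + 48 * b ^ 2 * e ^ 3 * i ^ 5 * nu + 96 * b ^ 4 * e ^ 2 * i ^ 5) * (y\<^sub>1 ^ 0 * (y\<^sub>2 ^ 3 * y\<^sub>3 ^ 7)) + pconst (144 * b ^ 2 * e ^ 3 * ga * i ^ 5 + 48 * b ^ 2 * e ^ 3 * i ^ 5 * nu + 96 * b ^ 4 * e ^ 2 * i ^ 5 + 216 * e * ga * i ^ 5 + 432 * e *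 i ^ 5 * nu) * (y\<^sub>1 ^ 2 * (y\<^sub>2 ^ 4 * y\<^sub>3 ^ 2)) + pconst (120 * b ^ 2 * e ^ 3 * ga * i ^ 5) * (y\<^sub>1 ^ 0 * (y\<^sub>2 ^ 1 * y\<^sub>3 ^ 10)) + pconst (72 * b ^ 2 * e ^ 3 * ga * i ^ 5 - 16 * b ^ 2 * e ^ 3 * i ^ 5 * nu - 32 * b ^ 4 * e ^ 2 * i ^ 5 - 72 * e * ga * i ^ 5 - 144 * e * i ^ 5 * nu) * (y\<^sub>1 ^ 2 * (y\<^sub>2 ^ 2 * y\<^sub>3 ^ 5)) + pconst (- (40 * b ^ 2 * e ^ 3 * ga * i ^ 5)) * (y\<^sub>1 ^ 2 * (y\<^sub>2 ^ 0 * y\<^sub>3 ^ 8)) + pconst (24 * e * ga * i ^ 5 + 48 * e * i ^ 5 * nu) * (y\<^sub>1 ^ 4 * (y\<^sub>2 ^ 1 * y\<^sub>3 ^ 3)) + pconst (- (72 * e * ga * i ^ 5) - 144 * e * i ^ 5 * nu) * (y\<^sub>1 ^ 4 * (y\<^sub>2 ^ 3 * y\<^sub>3 ^ 0))"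
    unfolding const_defs by (simp only: pconst_hom pconst_numeral pconst_1 pconst_0) Groebner_Basis.algebra
  show ?thesis
  proof (rule orbifold_equivalent_3I[where w = w and N = 6 and e = ?e and j = ?j
      and ga = "[0, - (1 / 3), - (2 / 9), - (1 / 9), 1 / 9, 2 / 9]" and gb = "[0, - (1 / 3), - (2 / 9), - (1 / 9), 1 / 9, 2 / 9]"
      and d = "5 / 3" and d' = "26 / 9"
      and ?c11.0 = "3 * x\<^sub>1" and ?c12.0 = "- x\<^sub>2" and ?c13.0 = "0" and ?c21.0 = "x\<^sub>2 ^ 2" and ?c22.0 = "- (2 * x\<^sub>1 ^ 4)" and ?c23.0 = "0" and ?c31.0 = "0" and ?c32.0 = "0" and ?c33.0 = "1"
      and ?b11.0 = "- (3 * y\<^sub>2 * y\<^sub>3)" and ?b12.0 = "0" and ?b13.0 = "2 * y\<^sub>1" and ?b21.0 = "y\<^sub>1" and ?b22.0 = "6 * y\<^sub>2" and ?b23.0 = "- (2 * y\<^sub>3)" and ?b31.0 = "y\<^sub>1 * y\<^sub>2" and ?b32.0 = "2 * y\<^sub>3 ^ 3" and ?b33.0 = "- (2 * y\<^sub>2 * y\<^sub>3)"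
      and ?m1.0 = 18 and ?n1.0 = 2 and ?k1.0 = 5 and ?l1.0 = 2 and ?m2.0 = 1 and ?n2.0 = 18 and ?k2.0 = 4 and ?l2.0 = 2 and ?m3.0 = 2 and ?n3.0 = 2 and ?k3.0 = 0 and ?l3.0 = 5, OF refl refl])
    show "x\<^sub>1 ^ 6 + x\<^sub>1 * x\<^sub>2 ^ 3 + x\<^sub>3 ^ 2 \<in> polys_in {X 1, X 2, X 3}" "y\<^sub>2 * y\<^sub>3 ^ 3 + y\<^sub>2 ^ 3 + y\<^sub>1 ^ 2 * y\<^sub>3 \<in> polys_in {Y 1, Y 2, Y 3}" by (intro polys_in_intros; simp)+
    show "quasi_homogeneous w 2 (x\<^sub>1 ^ 6 + x\<^sub>1 * x\<^sub>2 ^ 3 + x\<^sub>3 ^ 2)" "quasi_homogeneous w 2 (y\<^sub>2 * y\<^sub>3 ^ 3 + y\<^sub>2 ^ 3 + y\<^sub>1 ^ 2 * y\<^sub>3)" by (rule qh_base | rule qh_step | rule refl | (simp add: w_simps; fail))+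
    show "\<forall>v\<in>{X 1, X 2, X 3, Y 1, Y 2, Y 3}. 0 < w v \<and> w v < 2" by (simp add: w_simps)
    show "\<forall>c\<in>{3 * x\<^sub>1, - x\<^sub>2, 0, x\<^sub>2 ^ 2, - (2 * x\<^sub>1 ^ 4), 0, 0, 0, 1}. c \<in> polys_in {X 1, X 2, X 3}" by (auto intro!: polys_in_intros)
    show "\<forall>c\<in>{- (3 * y\<^sub>2 * y\<^sub>3), 0, 2 * y\<^sub>1, y\<^sub>1, 6 * y\<^sub>2, - (2 * y\<^sub>3), y\<^sub>1 * y\<^sub>2, 2 * y\<^sub>3 ^ 3, - (2 * y\<^sub>2 * y\<^sub>3)}. c \<in> polys_in {Y 1, Y 2, Y 3}" by (auto intro!: polys_in_intros)
    show "3 * x\<^sub>1 * pderiv_wrt (X 1) (x\<^sub>1 ^ 6 + x\<^sub>1 * x\<^sub>2 ^ 3 + x\<^sub>3 ^ 2) + (- x\<^sub>2) * pderiv_wrt (X 2) (x\<^sub>1 ^ 6 + x\<^sub>1 * x\<^sub>2 ^ 3 + x\<^sub>3 ^ 2) + 0 * pderiv_wrt (X 3) (x\<^sub>1 ^ 6 + x\<^sub>1 * x\<^sub>2 ^ 3 + x\<^sub>3 ^ 2) = pconst 18 * x\<^sub>1 ^ Suc 5"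
      by (rule eqvD, simp add: pderiv_simps, ((unfold eqv_def)?, Groebner_Basis.algebra)?)
    show "x\<^sub>2 ^ 2 * pderiv_wrt (X 1) (x\<^sub>1 ^ 6 + x\<^sub>1 * x\<^sub>2 ^ 3 + x\<^sub>3 ^ 2) + (- (2 * x\<^sub>1 ^ 4)) * pderiv_wrt (X 2) (x\<^sub>1 ^ 6 + x\<^sub>1 * x\<^sub>2 ^ 3 + x\<^sub>3 ^ 2) + 0 * pderiv_wrt (X 3) (x\<^sub>1 ^ 6 + x\<^sub>1 * x\<^sub>2 ^ 3 + x\<^sub>3 ^ 2) = pconst 1 * x\<^sub>2 ^ Suc 4"
      by (rule eqvD, simp add: pderiv_simps, ((unfold eqv_def)?, Groebner_Basis.algebra)?)
    show "0 * pderiv_wrt (X 1) (x\<^sub>1 ^ 6 + x\<^sub>1 * x\<^sub>2 ^ 3 + x\<^sub>3 ^ 2) + 0 * pderiv_wrt (X 2) (x\<^sub>1 ^ 6 + x\<^sub>1 * x\<^sub>2 ^ 3 + x\<^sub>3 ^ 2) + 1 * pderiv_wrt (X 3) (x\<^sub>1 ^ 6 + x\<^sub>1 * x\<^sub>2 ^ 3 + x\<^sub>3 ^ 2) = pconst 2 * x\<^sub>3 ^ Suc 0"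
      by (rule eqvD, simp add: pderiv_simps, ((unfold eqv_def)?, Groebner_Basis.algebra)?)
    show "(- (3 * y\<^sub>2 * y\<^sub>3)) * pderiv_wrt (Y 1) (y\<^sub>2 * y\<^sub>3 ^ 3 + y\<^sub>2 ^ 3 + y\<^sub>1 ^ 2 * y\<^sub>3) + 0 * pderiv_wrt (Y 2) (y\<^sub>2 * y\<^sub>3 ^ 3 + y\<^sub>2 ^ 3 + y\<^sub>1 ^ 2 * y\<^sub>3) + 2 * y\<^sub>1 * pderiv_wrt (Y 3) (y\<^sub>2 * y\<^sub>3 ^ 3 + y\<^sub>2 ^ 3 + y\<^sub>1 ^ 2 * y\<^sub>3) = pconst 2 * y\<^sub>1 ^ Suc 2"
      by (rule eqvD, simp add: pderiv_simps, ((unfold eqv_def)?, Groebner_Basis.algebra)?)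
    show "y\<^sub>1 * pderiv_wrt (Y 1) (y\<^sub>2 * y\<^sub>3 ^ 3 + y\<^sub>2 ^ 3 + y\<^sub>1 ^ 2 * y\<^sub>3) + 6 * y\<^sub>2 * pderiv_wrt (Y 2) (y\<^sub>2 * y\<^sub>3 ^ 3 + y\<^sub>2 ^ 3 + y\<^sub>1 ^ 2 * y\<^sub>3) + (- (2 * y\<^sub>3)) * pderiv_wrt (Y 3) (y\<^sub>2 * y\<^sub>3 ^ 3 + y\<^sub>2 ^ 3 + y\<^sub>1 ^ 2 * y\<^sub>3) = pconst 18 * y\<^sub>2 ^ Suc 2"
      by (rule eqvD, simp add: pderiv_simps, ((unfold eqv_def)?, Groebner_Basis.algebra)?)
    show "y\<^sub>1 * y\<^sub>2 * pderiv_wrt (Y 1) (y\<^sub>2 * y\<^sub>3 ^ 3 + y\<^sub>2 ^ 3 + y\<^sub>1 ^ 2 * y\<^sub>3) + 2 * y\<^sub>3 ^ 3 * pderiv_wrt (Y 2) (y\<^sub>2 * y\<^sub>3 ^ 3 + y\<^sub>2 ^ 3 + y\<^sub>1 ^ 2 * y\<^sub>3) + (- (2 * y\<^sub>2 * y\<^sub>3)) * pderiv_wrt (Y 3) (y\<^sub>2 * y\<^sub>3 ^ 3 + y\<^sub>2 ^ 3 + y\<^sub>1 ^ 2 * y\<^sub>3) = pconst 2 * y\<^sub>3 ^ Suc 5"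
      by (rule eqvD, simp add: pderiv_simps, ((unfold eqv_def)?, Groebner_Basis.algebra)?)
    have det: "?C = - (6 * x\<^sub>1 ^ 5) + x\<^sub>2 ^ 3" by ((simp; fail) | Groebner_Basis.algebra)
    show "quasi_homogeneous w (5 / 3) (?C)" unfolding det by ((rule qh_base | rule qh_step | rule refl | (simp add: w_simps; fail))+)
    have det: "?B = - (12 * y\<^sub>1 ^ 2 * y\<^sub>2 ^ 2) + 4 * y\<^sub>1 ^ 2 * y\<^sub>3 ^ 3 - 12 * y\<^sub>2 * y\<^sub>3 ^ 5 + 36 * y\<^sub>2 ^ 3 * y\<^sub>3 ^ 2" by ((simp; fail) | Groebner_Basis.algebra)
    show "quasi_homogeneous w (26 / 9) (?B)" unfolding det by ((rule qh_base | rule qh_step | rule refl | (simp add: w_simps; fail))+)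
    show "lk ((?C) * (list_supertrace_6 6 {Y 1, Y 2, Y 3} ?e ?j (X 1) (X 2) (X 3) (Y 1) (Y 2) (Y 3))) (single (X 1) 5 + (single (X 2) 4 + single (X 3) 0)) \<noteq> 0"
      unfolding L LC by (simp only: lookup_add lookup_monom_3) (use nz in simp)
    show "lk ((?B) * (list_supertrace_6 6 {X 1, X 2, X 3} ?e ?j (X 1) (X 2) (X 3) (Y 1) (Y 2) (Y 3))) (single (Y 1) 2 + (single (Y 2) 2 + single (Y 3) 5)) \<noteq> 0"
      unfolding R RB by (simp only: lookup_add lookup_monom_3) (use nz in simp)
    show "\<forall>r\<in>set ?e \<union> set ?j. \<forall>p\<in>set r. p \<in> polys_in {X 1, X 2, X 3, Y 1, Y 2, Y 3} \<and> zero_vars UNIV p = 0"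
      unfolding entries const_defs by (simp add: zero_vars_simps) (intro conjI polys_in_intros; simp)
    show "list_all2 (\<lambda>a. list_all2 (\<lambda>b. quasi_homogeneous w (b - a + 1)) [0, - (1 / 3), - (2 / 9), - (1 / 9), 1 / 9, 2 / 9]) [0, - (1 / 3), - (2 / 9), - (1 / 9), 1 / 9, 2 / 9] ?e"
      "list_all2 (\<lambda>b. list_all2 (\<lambda>a. quasi_homogeneous w (a - b + 1)) [0, - (1 / 3), - (2 / 9), - (1 / 9), 1 / 9, 2 / 9]) [0, - (1 / 3), - (2 / 9), - (1 / 9), 1 / 9, 2 / 9] ?j"
      by (simp add: entries const_defs, ((rule conjI qh_base | rule qh_step | rule refl | (simp add: w_simps; fail))+)?)+
  qed ((rule mf | (simp add: w_simps; fail))+)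
qed

text \<open>The difference of the potentials vanishes for \<open>x\<^sub>2\<close> =
  \<open>y\<^sub>2\<close>, \<open>x\<^sub>3\<close> = - \<open>y\<^sub>3 ^ 2\<close> and
  \<open>y\<^sub>1\<close> = \<open>x\<^sub>1 * y\<^sub>3\<close>, so it is a combination of
  \<open>a1\<close>, \<open>a2\<close> and \<open>a3\<close>, and there are no coefficients to solve
  for.\<close>

lemma orbifold_equivalent_S11_W13:
    shows "orbifold_equivalent 3 3 (x\<^sub>1 ^ 2 * x\<^sub>3 + x\<^sub>2 * x\<^sub>3 ^ 2 + x\<^sub>2 ^ 4) (- (y\<^sub>1 ^ 2) + y\<^sub>2 ^ 4 + y\<^sub>2 * y\<^sub>3 ^ 4)"
proof -
  define w where "w = weights [5 / 8, 1 / 2, 3 / 4] [1, 1 / 2, 3 / 8]"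
  note w_simps = w_def weights_simps
  \<comment> \<open>There are no symbolic constants in this case; a trivial fact stands in for their
    definitions so that the steps can be phrased as in the other cases.\<close>
  note const_defs = refl
  define a1 where "a1 = x\<^sub>2 - y\<^sub>2"
  define a2 where "a2 = x\<^sub>3 + y\<^sub>3 ^ 2"
  define a3 where "a3 = - (x\<^sub>1 * y\<^sub>3) + y\<^sub>1"
  define b1 where "b1 = x\<^sub>2 * y\<^sub>2 ^ 2 + x\<^sub>2 ^ 2 * y\<^sub>2 + x\<^sub>2 ^ 3 + y\<^sub>2 ^ 3 + y\<^sub>3 ^ 4"
  define b2 where "b2 = x\<^sub>1 ^ 2 + x\<^sub>2 * x\<^sub>3 - x\<^sub>2 * y\<^sub>3 ^ 2"
  define b3 where "b3 = x\<^sub>1 * y\<^sub>3 + y\<^sub>1"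
  note entries = a1_def a2_def a3_def b1_def b2_def b3_def
  let ?e = "[[a1, a2, a3, 0], [b2, - b1, 0, a3], [b3, 0, - b1, - a2], [0, b3, - b2, a1]]" and ?j = "[[b1, a2, a3, 0], [b2, - a1, 0, a3], [b3, 0, - a1, - a2], [0, b3, - b2, b1]]"
  let ?C = "(- (16 * x\<^sub>2)) * ((4 * x\<^sub>2) * (- (2 * x\<^sub>2 ^ 2 * x\<^sub>3)) - (- (2 * x\<^sub>3)) * (x\<^sub>3 ^ 2)) - (0) * ((x\<^sub>1) * (- (2 * x\<^sub>2 ^ 2 * x\<^sub>3)) - (- (2 * x\<^sub>3)) * (x\<^sub>1 * x\<^sub>2 ^ 2)) + (16 * x\<^sub>1) * ((x\<^sub>1) * (x\<^sub>3 ^ 2) - (4 * x\<^sub>2) * (x\<^sub>1 * x\<^sub>2 ^ 2)) :: xy cpoly" and ?B = "(- 1) * ((4 * y\<^sub>2) * (- (y\<^sub>2 ^ 2)) - (- y\<^sub>3) * (y\<^sub>3 ^ 3)) - (0) * ((0) * (- (y\<^sub>2 ^ 2)) - (- y\<^sub>3) * (0)) + (0) * ((0) * (y\<^sub>3 ^ 3) - (4 * y\<^sub>2) * (0)) :: xy cpoly"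
  have W: "a1 * b1 + a2 * b2 + a3 * b3 = (x\<^sub>1 ^ 2 * x\<^sub>3 + x\<^sub>2 * x\<^sub>3 ^ 2 + x\<^sub>2 ^ 4) - (- (y\<^sub>1 ^ 2) + y\<^sub>2 ^ 4 + y\<^sub>2 * y\<^sub>3 ^ 4)"
    unfolding entries by Groebner_Basis.algebra
  note mf = lprod_koszul_3[where ?a1.0 = a1 and ?a2.0 = a2 and ?a3.0 = a3 and ?b1.0 = b1 and ?b2.0 = b2 and ?b3.0 = b3, unfolded W]
  have L: "list_supertrace_6 4 {Y 1, Y 2, Y 3} ?e ?j (X 1) (X 2) (X 3) (Y 1) (Y 2) (Y 3) = - (16 * x\<^sub>1 ^ 2 * x\<^sub>2 ^ 2)" (is "?l = ?r")
  proof -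
    have "eqv ?l ?r"
      by (simp add: list_supertrace_6_def entries const_defs list_comp trace2_numeral pderiv_simps zero_vars_simps,
          (unfold eqv_def, Groebner_Basis.algebra)?)
    then show ?thesis by (rule eqvD)
  qed
  have R: "list_supertrace_6 4 {X 1, X 2, X 3} ?e ?j (X 1) (X 2) (X 3) (Y 1) (Y 2) (Y 3) = 8 * y\<^sub>3 ^ 6" (is "?l = ?r")
  proof -
    have "eqv ?l ?r"
      by (simp add: list_supertrace_6_def entries const_defs list_comp trace2_numeral pderiv_simps zero_vars_simps,
          (unfold eqv_def, Groebner_Basis.algebra)?)
    then show ?thesis by (rule eqvD)
  qed
  have LC: "(?C) * (- (16 * x\<^sub>1 ^ 2 * x\<^sub>2 ^ 2)) = pconst (- 2048) * (x\<^sub>1 ^ 2 * (x\<^sub>2 ^ 6 * x\<^sub>3 ^ 1)) + pconst (512) * (x\<^sub>1 ^ 2 * (x\<^sub>2 ^ 3 * x\<^sub>3 ^ 3)) + pconst (- 256) * (x\<^sub>1 ^ 4 * (x\<^sub>2 ^ 2 * x\<^sub>3 ^ 2)) + pconst (1024) * (x\<^sub>1 ^ 4 * (x\<^sub>2 ^ 5 * x\<^sub>3 ^ 0))"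
    unfolding const_defs by (simp only: pconst_hom pconst_numeral pconst_1 pconst_0) Groebner_Basis.algebra
  have RB: "(?B) * (8 * y\<^sub>3 ^ 6) = pconst (32) * (y\<^sub>1 ^ 0 * (y\<^sub>2 ^ 3 * y\<^sub>3 ^ 6)) + pconst (- 8) * (y\<^sub>1 ^ 0 * (y\<^sub>2 ^ 0 * y\<^sub>3 ^ 10))"
    unfolding const_defs by (simp only: pconst_hom pconst_numeral pconst_1 pconst_0) Groebner_Basis.algebra
  show ?thesis
  \<comment> \<open>The second row for V1 is the vector field with degrees 1, 4, -2, which
    annihilates the two mixed monomials and leaves 16 \<open>x\<^sub>2 ^ 4\<close>.\<close>
  proof (rule orbifold_equivalent_3I[where w = w and N = 4 and e = ?e and j = ?j
      and ga = "[0, - (3 / 4), - (1 / 2), - (1 / 4)]" and gb = "[- (1 / 2), - (1 / 4), 0, - (3 / 4)]"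
      and d = "11 / 4" and d' = "3 / 2"
      and ?c11.0 = "- (16 * x\<^sub>2)" and ?c12.0 = "0" and ?c13.0 = "16 * x\<^sub>1" and ?c21.0 = "x\<^sub>1" and ?c22.0 = "4 * x\<^sub>2" and ?c23.0 = "- (2 * x\<^sub>3)" and ?c31.0 = "x\<^sub>1 * x\<^sub>2 ^ 2" and ?c32.0 = "x\<^sub>3 ^ 2" and ?c33.0 = "- (2 * x\<^sub>2 ^ 2 * x\<^sub>3)"
      and ?b11.0 = "- 1" and ?b12.0 = "0" and ?b13.0 = "0" and ?b21.0 = "0" and ?b22.0 = "4 * y\<^sub>2" and ?b23.0 = "- y\<^sub>3" and ?b31.0 = "0" and ?b32.0 = "y\<^sub>3 ^ 3" and ?b33.0 = "- (y\<^sub>2 ^ 2)"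
      and ?m1.0 = 16 and ?n1.0 = 2 and ?k1.0 = 2 and ?l1.0 = 0 and ?m2.0 = 16 and ?n2.0 = 16 and ?k2.0 = 3 and ?l2.0 = 3 and ?m3.0 = 1 and ?n3.0 = 1 and ?k3.0 = 3 and ?l3.0 = 6, OF refl refl])
    show "x\<^sub>1 ^ 2 * x\<^sub>3 + x\<^sub>2 * x\<^sub>3 ^ 2 + x\<^sub>2 ^ 4 \<in> polys_in {X 1, X 2, X 3}" "- (y\<^sub>1 ^ 2) + y\<^sub>2 ^ 4 + y\<^sub>2 * y\<^sub>3 ^ 4 \<in> polys_in {Y 1, Y 2, Y 3}" by (intro polys_in_intros; simp)+
    show "quasi_homogeneous w 2 (x\<^sub>1 ^ 2 * x\<^sub>3 + x\<^sub>2 * x\<^sub>3 ^ 2 + x\<^sub>2 ^ 4)" "quasi_homogeneous w 2 (- (y\<^sub>1 ^ 2) + y\<^sub>2 ^ 4 + y\<^sub>2 * y\<^sub>3 ^ 4)" by (rule qh_base | rule qh_step | rule refl | (simp add: w_simps; fail))+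
    show "\<forall>v\<in>{X 1, X 2, X 3, Y 1, Y 2, Y 3}. 0 < w v \<and> w v < 2" by (simp add: w_simps)
    show "\<forall>c\<in>{- (16 * x\<^sub>2), 0, 16 * x\<^sub>1, x\<^sub>1, 4 * x\<^sub>2, - (2 * x\<^sub>3), x\<^sub>1 * x\<^sub>2 ^ 2, x\<^sub>3 ^ 2, - (2 * x\<^sub>2 ^ 2 * x\<^sub>3)}. c \<in> polys_in {X 1, X 2, X 3}" by (auto intro!: polys_in_intros)
    show "\<forall>c\<in>{- 1, 0, 0, 0, 4 * y\<^sub>2, - y\<^sub>3, 0, y\<^sub>3 ^ 3, - (y\<^sub>2 ^ 2)}. c \<in> polys_in {Y 1, Y 2, Y 3}" by (auto intro!: polys_in_intros)
    show "(- (16 * x\<^sub>2)) * pderiv_wrt (X 1) (x\<^sub>1 ^ 2 * x\<^sub>3 + x\<^sub>2 * x\<^sub>3 ^ 2 + x\<^sub>2 ^ 4) + 0 * pderiv_wrt (X 2) (x\<^sub>1 ^ 2 * x\<^sub>3 + x\<^sub>2 * x\<^sub>3 ^ 2 + x\<^sub>2 ^ 4) + 16 * x\<^sub>1 * pderiv_wrt (X 3) (x\<^sub>1 ^ 2 * x\<^sub>3 + x\<^sub>2 * x\<^sub>3 ^ 2 + x\<^sub>2 ^ 4) = pconst 16 * x\<^sub>1 ^ Suc 2"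
      by (rule eqvD, simp add: pderiv_simps, ((unfold eqv_def)?, Groebner_Basis.algebra)?)
    show "x\<^sub>1 * pderiv_wrt (X 1) (x\<^sub>1 ^ 2 * x\<^sub>3 + x\<^sub>2 * x\<^sub>3 ^ 2 + x\<^sub>2 ^ 4) + 4 * x\<^sub>2 * pderiv_wrt (X 2) (x\<^sub>1 ^ 2 * x\<^sub>3 + x\<^sub>2 * x\<^sub>3 ^ 2 + x\<^sub>2 ^ 4) + (- (2 * x\<^sub>3)) * pderiv_wrt (X 3) (x\<^sub>1 ^ 2 * x\<^sub>3 + x\<^sub>2 * x\<^sub>3 ^ 2 + x\<^sub>2 ^ 4) = pconst 16 * x\<^sub>2 ^ Suc 3"
      by (rule eqvD, simp add: pderiv_simps, ((unfold eqv_def)?, Groebner_Basis.algebra)?)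
    show "x\<^sub>1 * x\<^sub>2 ^ 2 * pderiv_wrt (X 1) (x\<^sub>1 ^ 2 * x\<^sub>3 + x\<^sub>2 * x\<^sub>3 ^ 2 + x\<^sub>2 ^ 4) + x\<^sub>3 ^ 2 * pderiv_wrt (X 2) (x\<^sub>1 ^ 2 * x\<^sub>3 + x\<^sub>2 * x\<^sub>3 ^ 2 + x\<^sub>2 ^ 4) + (- (2 * x\<^sub>2 ^ 2 * x\<^sub>3)) * pderiv_wrt (X 3) (x\<^sub>1 ^ 2 * x\<^sub>3 + x\<^sub>2 * x\<^sub>3 ^ 2 + x\<^sub>2 ^ 4) = pconst 1 * x\<^sub>3 ^ Suc 3"
      by (rule eqvD, simp add: pderiv_simps, ((unfold eqv_def)?, Groebner_Basis.algebra)?)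
    show "(- 1) * pderiv_wrt (Y 1) (- (y\<^sub>1 ^ 2) + y\<^sub>2 ^ 4 + y\<^sub>2 * y\<^sub>3 ^ 4) + 0 * pderiv_wrt (Y 2) (- (y\<^sub>1 ^ 2) + y\<^sub>2 ^ 4 + y\<^sub>2 * y\<^sub>3 ^ 4) + 0 * pderiv_wrt (Y 3) (- (y\<^sub>1 ^ 2) + y\<^sub>2 ^ 4 + y\<^sub>2 * y\<^sub>3 ^ 4) = pconst 2 * y\<^sub>1 ^ Suc 0"
      by (rule eqvD, simp add: pderiv_simps, ((unfold eqv_def)?, Groebner_Basis.algebra)?)
    show "0 * pderiv_wrt (Y 1) (- (y\<^sub>1 ^ 2) + y\<^sub>2 ^ 4 + y\<^sub>2 * y\<^sub>3 ^ 4) + 4 * y\<^sub>2 * pderiv_wrt (Y 2) (- (y\<^sub>1 ^ 2) + y\<^sub>2 ^ 4 + y\<^sub>2 * y\<^sub>3 ^ 4) + (- y\<^sub>3) * pderiv_wrt (Y 3) (- (y\<^sub>1 ^ 2) + y\<^sub>2 ^ 4 + y\<^sub>2 * y\<^sub>3 ^ 4) = pconst 16 * y\<^sub>2 ^ Suc 3"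
      by (rule eqvD, simp add: pderiv_simps, ((unfold eqv_def)?, Groebner_Basis.algebra)?)
    show "0 * pderiv_wrt (Y 1) (- (y\<^sub>1 ^ 2) + y\<^sub>2 ^ 4 + y\<^sub>2 * y\<^sub>3 ^ 4) + y\<^sub>3 ^ 3 * pderiv_wrt (Y 2) (- (y\<^sub>1 ^ 2) + y\<^sub>2 ^ 4 + y\<^sub>2 * y\<^sub>3 ^ 4) + (- (y\<^sub>2 ^ 2)) * pderiv_wrt (Y 3) (- (y\<^sub>1 ^ 2) + y\<^sub>2 ^ 4 + y\<^sub>2 * y\<^sub>3 ^ 4) = pconst 1 * y\<^sub>3 ^ Suc 6"
      by (rule eqvD, simp add: pderiv_simps, ((unfold eqv_def)?, Groebner_Basis.algebra)?)
    have det: "?C = - (64 * x\<^sub>1 ^ 2 * x\<^sub>2 ^ 3) + 16 * x\<^sub>1 ^ 2 * x\<^sub>3 ^ 2 - 32 * x\<^sub>2 * x\<^sub>3 ^ 3 + 128 * x\<^sub>2 ^ 4 * x\<^sub>3" by ((simp; fail) | Groebner_Basis.algebra)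
    show "quasi_homogeneous w (11 / 4) (?C)" unfolding det by ((rule qh_base | rule qh_step | rule refl | (simp add: w_simps; fail))+)
    have det: "?B = 4 * y\<^sub>2 ^ 3 - y\<^sub>3 ^ 4" by ((simp; fail) | Groebner_Basis.algebra)
    show "quasi_homogeneous w (3 / 2) (?B)" unfolding det by ((rule qh_base | rule qh_step | rule refl | (simp add: w_simps; fail))+)
    show "lk ((?C) * (list_supertrace_6 4 {Y 1, Y 2, Y 3} ?e ?j (X 1) (X 2) (X 3) (Y 1) (Y 2) (Y 3))) (single (X 1) 2 + (single (X 2) 3 + single (X 3) 3)) \<noteq> 0"
      unfolding L LC by (simp only: lookup_add lookup_monom_3) (simp)
    show "lk ((?B) * (list_supertrace_6 4 {X 1, X 2, X 3} ?e ?j (X 1) (X 2) (X 3) (Y 1) (Y 2) (Y 3))) (single (Y 1) 0 + (single (Y 2) 3 + single (Y 3) 6)) \<noteq> 0"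
      unfolding R RB by (simp only: lookup_add lookup_monom_3) (simp)
    show "\<forall>r\<in>set ?e \<union> set ?j. \<forall>p\<in>set r. p \<in> polys_in {X 1, X 2, X 3, Y 1, Y 2, Y 3} \<and> zero_vars UNIV p = 0"
      unfolding entries const_defs by (simp add: zero_vars_simps) (intro conjI polys_in_intros; simp)
    show "list_all2 (\<lambda>a. list_all2 (\<lambda>b. quasi_homogeneous w (b - a + 1)) [- (1 / 2), - (1 / 4), 0, - (3 / 4)]) [0, - (3 / 4), - (1 / 2), - (1 / 4)] ?e"
      "list_all2 (\<lambda>b. list_all2 (\<lambda>a. quasi_homogeneous w (a - b + 1)) [0, - (3 / 4), - (1 / 2), - (1 / 4)]) [- (1 / 2), - (1 / 4), 0, - (3 / 4)] ?j"
      by (simp add: entries const_defs, ((rule conjI qh_base | rule qh_step | rule refl | (simp add: w_simps; fail))+)?)+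
  qed ((rule mf | (simp add: w_simps; fail))+)
qed

text \<open>Let r be a square root of \<open>x\<^sub>1\<close>. On \<open>y\<^sub>2\<close> = r^3,
  \<open>x\<^sub>2\<close> = r \<open>y\<^sub>1\<close> the potentials agree, both being r^21
  \<open>y\<^sub>1\<close> + r^3 \<open>y\<^sub>1 ^ 3\<close>. Accordingly a =
  \<open>y\<^sub>2\<close> - r^3, b = \<open>x\<^sub>2\<close> - r \<open>y\<^sub>1\<close>, c =
  r^20 + \<open>x\<^sub>2 ^ 2\<close> + r \<open>x\<^sub>2 * y\<^sub>1\<close> + r^2
  \<open>y\<^sub>1 ^ 2\<close>, and d is - \<open>y\<^sub>1 ^ 3\<close> minus
  \<open>y\<^sub>1\<close> times the quotient of \<open>y\<^sub>2 ^ 7\<close> - r^21 by a. Odd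
  powers of r go into the second components, for instance r^3 = \<open>x\<^sub>1\<close> r into
  \<open>a2\<close>.\<close>

lemma orbifold_equivalent_chain_loop:
    shows "orbifold_equivalent 2 2 (x\<^sub>1 ^ 10 * x\<^sub>2 + x\<^sub>2 ^ 3) (y\<^sub>1 * y\<^sub>2 ^ 7 + y\<^sub>1 ^ 3 * y\<^sub>2)"
proof -
  define w where "w = weights [2 / 15, 2 / 3] [3 / 5, 1 / 5]"
  note w_simps = w_def weights_simps
  note const_defs = refl
  define a1 where "a1 = y\<^sub>2"
  define a2 where "a2 = - x\<^sub>1"
  define b1 where "b1 = x\<^sub>2"
  define b2 where "b2 = - y\<^sub>1"
  define c1 where "c1 = x\<^sub>1 * y\<^sub>1 ^ 2 + x\<^sub>1 ^ 10 + x\<^sub>2 ^ 2"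
  define c2 where "c2 = x\<^sub>2 * y\<^sub>1"
  define d1 where "d1 = - (x\<^sub>1 ^ 3 * y\<^sub>1 * y\<^sub>2 ^ 4) - x\<^sub>1 ^ 6 * y\<^sub>1 * y\<^sub>2 ^ 2 - x\<^sub>1 ^ 9 * y\<^sub>1 - y\<^sub>1 * y\<^sub>2 ^ 6 - y\<^sub>1 ^ 3"
  define d2 where "d2 = - (x\<^sub>1 * y\<^sub>1 * y\<^sub>2 ^ 5) - x\<^sub>1 ^ 4 * y\<^sub>1 * y\<^sub>2 ^ 3 - x\<^sub>1 ^ 7 * y\<^sub>1 * y\<^sub>2"
  define N where "N = x\<^sub>1"
  note entries = a1_def a2_def b1_def b2_def c1_def c2_def d1_def d2_def N_def
  let ?e = "[[a1, N * a2, b1, N * b2], [a2, a1, b2, b1], [- c1, - (N * c2), d1, N * d2], [- c2, - c1, d2, d1]]" and ?j = "[[d1, N * d2, - b1, - (N * b2)], [d2, d1, - b2, - b1], [c1, N * c2, a1, N * a2], [c2, c1, a2, a1]]"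
  let ?C = "(- (3 * x\<^sub>2)) * (10 * x\<^sub>2) - (10 * x\<^sub>1 ^ 9) * (- x\<^sub>1) :: xy cpoly" and ?B = "(- (49 * y\<^sub>1 * y\<^sub>2 ^ 5)) * (- (9 * y\<^sub>1 * y\<^sub>2)) - (20 * y\<^sub>1 ^ 2 + 7 * y\<^sub>2 ^ 6) * (3 * y\<^sub>1 ^ 2 + 20 * y\<^sub>2 ^ 6) :: xy cpoly"
  have W: "a1 * d1 + N * (a2 * d2) + b1 * c1 + N * (b2 * c2) = (x\<^sub>1 ^ 10 * x\<^sub>2 + x\<^sub>2 ^ 3) - (y\<^sub>1 * y\<^sub>2 ^ 7 + y\<^sub>1 ^ 3 * y\<^sub>2)"
    and O: "a1 * d2 + a2 * d1 + b1 * c2 + b2 * c1 = 0"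
    unfolding entries by Groebner_Basis.algebra+
  note mf = lprod_block[OF W O]
  have L: "list_supertrace_4 4 {Y 1, Y 2} ?e ?j (X 1) (X 2) (Y 1) (Y 2) = - (20 * x\<^sub>1 ^ 18)" (is "?l = ?r")
  proof -
    have "eqv ?l ?r"
      by (simp add: list_supertrace_4_def entries const_defs list_comp trace2_numeral pderiv_simps zero_vars_simps,
          (unfold eqv_def, Groebner_Basis.algebra)?)
    then show ?thesis by (rule eqvD)
  qed
  have R: "list_supertrace_4 4 {X 1, X 2} ?e ?j (X 1) (X 2) (Y 1) (Y 2) = - (3 * y\<^sub>1 ^ 2 * y\<^sub>2 ^ 6) - 9 * y\<^sub>1 ^ 4" (is "?l = ?r")
  proof -
    have "eqv ?l ?r"
      by (simp add: list_supertrace_4_def entries const_defs list_comp trace2_numeral pderiv_simps zero_vars_simps,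
          (unfold eqv_def, Groebner_Basis.algebra)?)
    then show ?thesis by (rule eqvD)
  qed
  have LC: "(?C) * (- (20 * x\<^sub>1 ^ 18)) = pconst (600) * (x\<^sub>1 ^ 18 * x\<^sub>2 ^ 2) + pconst (- 200) * (x\<^sub>1 ^ 28 * x\<^sub>2 ^ 0)"
    unfolding const_defs by (simp only: pconst_hom pconst_numeral pconst_1 pconst_0) Groebner_Basis.algebra
  have RB: "(?B) * (- (3 * y\<^sub>1 ^ 2 * y\<^sub>2 ^ 6) - 9 * y\<^sub>1 ^ 4) = pconst (1200) * (y\<^sub>1 ^ 4 * y\<^sub>2 ^ 12) + pconst (540) * (y\<^sub>1 ^ 8 * y\<^sub>2 ^ 0) + pconst (420) * (y\<^sub>1 ^ 2 * y\<^sub>2 ^ 18)"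
    unfolding const_defs by (simp only: pconst_hom pconst_numeral pconst_1 pconst_0) Groebner_Basis.algebra
  show ?thesis
  \<comment> \<open>The rows for V2 combine the two derivatives so that all mixed monomials cancel
    and only 20 \<open>y\<^sub>1 ^ 5\<close>, respectively 20 \<open>y\<^sub>2 ^ 13\<close>,
    remains.\<close>
  proof (rule orbifold_equivalent_2I[where w = w and N = 4 and e = ?e and j = ?j
      and ga = "[0, 1 / 15, - (17 / 15), - (16 / 15)]" and gb = "[- (4 / 5), - (11 / 15), - (1 / 3), - (4 / 15)]"
      and d = "4 / 3" and d' = "12 / 5"
      and ?c11.0 = "- (3 * x\<^sub>2)" and ?c12.0 = "10 * x\<^sub>1 ^ 9" and ?c21.0 = "- x\<^sub>1" and ?c22.0 = "10 * x\<^sub>2"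
      and ?b11.0 = "- (49 * y\<^sub>1 * y\<^sub>2 ^ 5)" and ?b12.0 = "20 * y\<^sub>1 ^ 2 + 7 * y\<^sub>2 ^ 6" and ?b21.0 = "3 * y\<^sub>1 ^ 2 + 20 * y\<^sub>2 ^ 6" and ?b22.0 = "- (9 * y\<^sub>1 * y\<^sub>2)"
      and ?m1.0 = 10 and ?n1.0 = 20 and ?k1.0 = 18 and ?l1.0 = 4 and ?m2.0 = 30 and ?n2.0 = 20 and ?k2.0 = 2 and ?l2.0 = 12])
    show "x\<^sub>1 ^ 10 * x\<^sub>2 + x\<^sub>2 ^ 3 \<in> polys_in {X 1, X 2}" "y\<^sub>1 * y\<^sub>2 ^ 7 + y\<^sub>1 ^ 3 * y\<^sub>2 \<in> polys_in {Y 1, Y 2}" by (intro polys_in_intros; simp)+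
    show "quasi_homogeneous w 2 (x\<^sub>1 ^ 10 * x\<^sub>2 + x\<^sub>2 ^ 3)" "quasi_homogeneous w 2 (y\<^sub>1 * y\<^sub>2 ^ 7 + y\<^sub>1 ^ 3 * y\<^sub>2)" by (rule qh_base | rule qh_step | rule refl | (simp add: w_simps; fail))+
    show "\<forall>v\<in>{X 1, X 2, Y 1, Y 2}. 0 < w v \<and> w v < 2" by (simp add: w_simps)
    show "\<forall>c\<in>{- (3 * x\<^sub>2), 10 * x\<^sub>1 ^ 9, - x\<^sub>1, 10 * x\<^sub>2}. c \<in> polys_in {X 1, X 2}" by (auto intro!: polys_in_intros)
    show "\<forall>c\<in>{- (49 * y\<^sub>1 * y\<^sub>2 ^ 5), 20 * y\<^sub>1 ^ 2 + 7 * y\<^sub>2 ^ 6, 3 * y\<^sub>1 ^ 2 + 20 * y\<^sub>2 ^ 6, - (9 * y\<^sub>1 * y\<^sub>2)}. c \<in> polys_in {Y 1, Y 2}" by (auto intro!: polys_in_intros)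
    show "(- (3 * x\<^sub>2)) * pderiv_wrt (X 1) (x\<^sub>1 ^ 10 * x\<^sub>2 + x\<^sub>2 ^ 3) + 10 * x\<^sub>1 ^ 9 * pderiv_wrt (X 2) (x\<^sub>1 ^ 10 * x\<^sub>2 + x\<^sub>2 ^ 3) = pconst 10 * x\<^sub>1 ^ Suc 18"
      by (rule eqvD, simp add: pderiv_simps, ((unfold eqv_def)?, Groebner_Basis.algebra)?)
    show "(- x\<^sub>1) * pderiv_wrt (X 1) (x\<^sub>1 ^ 10 * x\<^sub>2 + x\<^sub>2 ^ 3) + 10 * x\<^sub>2 * pderiv_wrt (X 2) (x\<^sub>1 ^ 10 * x\<^sub>2 + x\<^sub>2 ^ 3) = pconst 30 * x\<^sub>2 ^ Suc 2"
      by (rule eqvD, simp add: pderiv_simps, ((unfold eqv_def)?, Groebner_Basis.algebra)?)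
    show "(- (49 * y\<^sub>1 * y\<^sub>2 ^ 5)) * pderiv_wrt (Y 1) (y\<^sub>1 * y\<^sub>2 ^ 7 + y\<^sub>1 ^ 3 * y\<^sub>2) + (20 * y\<^sub>1 ^ 2 + 7 * y\<^sub>2 ^ 6) * pderiv_wrt (Y 2) (y\<^sub>1 * y\<^sub>2 ^ 7 + y\<^sub>1 ^ 3 * y\<^sub>2) = pconst 20 * y\<^sub>1 ^ Suc 4"
      by (rule eqvD, simp add: pderiv_simps, ((unfold eqv_def)?, Groebner_Basis.algebra)?)
    show "(3 * y\<^sub>1 ^ 2 + 20 * y\<^sub>2 ^ 6) * pderiv_wrt (Y 1) (y\<^sub>1 * y\<^sub>2 ^ 7 + y\<^sub>1 ^ 3 * y\<^sub>2) + (- (9 * y\<^sub>1 * y\<^sub>2)) * pderiv_wrt (Y 2) (y\<^sub>1 * y\<^sub>2 ^ 7 + y\<^sub>1 ^ 3 * y\<^sub>2) = pconst 20 * y\<^sub>2 ^ Suc 12"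
      by (rule eqvD, simp add: pderiv_simps, ((unfold eqv_def)?, Groebner_Basis.algebra)?)
    have det: "?C = 10 * x\<^sub>1 ^ 10 - 30 * x\<^sub>2 ^ 2" by ((simp; fail) | Groebner_Basis.algebra)
    show "quasi_homogeneous w (4 / 3) (?C)" unfolding det by ((rule qh_base | rule qh_step | rule refl | (simp add: w_simps; fail))+)
    have det: "?B = 20 * y\<^sub>1 ^ 2 * y\<^sub>2 ^ 6 - 60 * y\<^sub>1 ^ 4 - 140 * y\<^sub>2 ^ 12" by ((simp; fail) | Groebner_Basis.algebra)
    show "quasi_homogeneous w (12 / 5) (?B)" unfolding det by ((rule qh_base | rule qh_step | rule refl | (simp add: w_simps; fail))+)
    show "lk ((?C) * (list_supertrace_4 4 {Y 1, Y 2} ?e ?j (X 1) (X 2) (Y 1) (Y 2))) (single (X 1) 18 + single (X 2) 2) \<noteq> 0"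
      unfolding L LC by (simp only: lookup_add lookup_monom_2) (simp)
    show "lk ((?B) * (list_supertrace_4 4 {X 1, X 2} ?e ?j (X 1) (X 2) (Y 1) (Y 2))) (single (Y 1) 4 + single (Y 2) 12) \<noteq> 0"
      unfolding R RB by (simp only: lookup_add lookup_monom_2) (simp)
    show "\<forall>r\<in>set ?e \<union> set ?j. \<forall>p\<in>set r. p \<in> polys_in {X 1, X 2, Y 1, Y 2} \<and> zero_vars UNIV p = 0"
      unfolding entries const_defs by (simp add: zero_vars_simps) (intro conjI polys_in_intros; simp)
    show "list_all2 (\<lambda>a. list_all2 (\<lambda>b. quasi_homogeneous w (b - a + 1)) [- (4 / 5), - (11 / 15), - (1 / 3), - (4 / 15)]) [0, 1 / 15, - (17 / 15), - (16 / 15)] ?e"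
      "list_all2 (\<lambda>b. list_all2 (\<lambda>a. quasi_homogeneous w (a - b + 1)) [0, 1 / 15, - (17 / 15), - (16 / 15)]) [- (4 / 5), - (11 / 15), - (1 / 3), - (4 / 15)] ?j"
      by (simp add: entries const_defs, ((rule conjI qh_base | rule qh_step | rule refl | (simp add: w_simps; fail))+)?)+
  qed ((rule mf | (simp add: w_simps; fail))+)
qed

section \<open>Solving for the coefficients\<close>

lemma numeral_mult_eq_0D: "numeral n * x = 0 \<Longrightarrow> x = (0 :: complex)" by simp

lemma exists_complex_root:
  assumes "0 < n" shows "\<exists>z :: complex. z ^ n = c"
proof
  show "rcis (root n (cmod c)) (Arg c / of_nat n) ^ n = c"
    using assms by (simp add: DeMoivre2 real_root_pow_pos2 rcis_cmod_Arg)
qed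

text \<open>For given \<open>y\<close> both square roots of \<open>y - q\<close> may be inserted for
  \<open>m\<close>, which separates the part even in \<open>m\<close> from the odd one. Each part is
  then a polynomial in \<open>y\<close> with infinitely many zeros.\<close>

lemma even_odd_poly_zero:
  fixes r0 r1 r2 r3 o0 o1 o2 q :: complex
  assumes z: "\<And>m y. y = m ^ 2 + q \<Longrightarrow> (r0 + r1 * y + r2 * y ^ 2 + r3 * y ^ 3) + m * (o0 + o1 * y + o2 * y ^ 2) = 0"
  shows "r0 = 0" "r1 = 0" "r2 = 0" "r3 = 0" "o0 = 0" "o1 = 0" "o2 = 0"
proof -
  have zero: "p = 0" if "\<And>y. y \<noteq> c \<Longrightarrow> poly p y = 0" for p :: "complex poly" and c
  proof (rule ccontr)
    assume "p \<noteq> 0"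
    then have "finite ({y. poly p y = 0} \<union> {c})" by (simp add: poly_roots_finite)
    moreover have "{y. poly p y = 0} \<union> {c} = UNIV" using that by auto
    ultimately have "finite (UNIV :: complex set)" by metis
    then show False by (simp add: infinite_UNIV_char_0)
  qed
  have both: "r0 + r1 * y + r2 * y ^ 2 + r3 * y ^ 3 = 0 \<and> csqrt (y - q) * (o0 + o1 * y + o2 * y ^ 2) = 0" for y
  proof -
    have "a = 0 \<and> b = 0" if "a + b = 0" "a - b = 0" for a b :: complex
    proof -
      have "2 * a = (a + b) + (a - b)" "2 * b = (a + b) - (a - b)" by simp_all
      then show ?thesis using that by simp
    qed
    then show ?thesis using z[of y "csqrt (y - q)"] z[of y "- csqrt (y - q)"] by simp
  qed
  have "[:r0, r1, r2, r3:] = 0"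
    by (rule zero) (use both in \<open>simp add: algebra_simps power2_eq_square power3_eq_cube\<close>)
  \<comment> \<open>At \<open>y = q\<close> the factor \<open>m\<close> is 0 and nothing follows
    about the odd part, hence the exceptional point allowed in \<open>zero\<close>.\<close>
  moreover have o: "o0 + o1 * y + o2 * y ^ 2 = 0" if "y \<noteq> q" for y using both[of y] that by simp
  have "[:o0, o1, o2:] = 0"
    by (rule zero[of q]) (use o in \<open>simp add: algebra_simps power2_eq_square\<close>)
  ultimately show "r0 = 0" "r1 = 0" "r2 = 0" "r3 = 0" "o0 = 0" "o1 = 0" "o2 = 0" by simp_all
qed

text \<open>A section of the rational elliptic surface \<open>c\<^sup>2 = p\<^sup>3 + 2 h m (t - m)\<^sup>5 + \<beta> m\<^sup>6\<close> with \<open>c\<close> of degree 3 and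
  \<open>p\<close> of degree 2; the constants come from comparing coefficients.\<close>

lemma E8_section_identity:
  fixes w h t m k \<beta> :: complex
  assumes w: "w ^ 2 = 5" and h: "h ^ 2 + (5 + w) * h + w = 0"
    and k: "3 * k = 10 + 3 * w + (5 - w) * h" and \<beta>: "9 * \<beta> = 400 - 1632 * h + 640 * h * w - 800 * w"
  shows "(t ^ 3 + h * t ^ 2 * m + (5 + 2 * w) * t * m ^ 2 + h * (5 - 2 * w) * m ^ 3) ^ 2 =
    (t ^ 2 + k * m ^ 2) ^ 3 + 2 * h * (t - m) ^ 5 * m + \<beta> * m ^ 6"
proof -
  let ?C = "t ^ 3 + h * t ^ 2 * m + (5 + 2 * w) * t * m ^ 2 + h * (5 - 2 * w) * m ^ 3"
  \<comment> \<open>The difference of the two sides lies in the ideal of the equations for w and h,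
    here with explicit cofactors. The factor 27 clears the denominators of k and \<beta>.\<close>
  have "27 * ?C ^ 2 - ((3 * t ^ 2 + (3 * k) * m ^ 2) ^ 3 + 54 * h * (t - m) ^ 5 * m + 3 * (9 * \<beta>) * m ^ 6) =
    (72 * h * m ^ 4 * t ^ 2 - 216 * h * m ^ 5 * t + 675 * h * m ^ 6 + 27 * h * m ^ 6 * w - 9 * h ^ 2 * m ^ 4 * t ^ 2 + 88 * h ^ 2 * m ^ 6 - 9 * h ^ 2 * m ^ 6 * w - 15 * h ^ 3 * m ^ 6 + h ^ 3 * m ^ 6 * w + 45 * m ^ 4 * t ^ 2 + 440 * m ^ 6 - 27 * m ^ 6 * w) * (w ^ 2 - 5) + (-200 * h * m ^ 6 + 80 * h * m ^ 6 * w + 27 * m ^ 2 * t ^ 4 - 18 * m ^ 4 * t ^ 2 * w + 1365 * m ^ 6 - 710 * m ^ 6 * w) * (h ^ 2 + (5 + w) * h + w)"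
    unfolding k \<beta> by Groebner_Basis.algebra
  then have "27 * ?C ^ 2 = (3 * t ^ 2 + (3 * k) * m ^ 2) ^ 3 + 54 * h * (t - m) ^ 5 * m + 3 * (9 * \<beta>) * m ^ 6"
    unfolding h w by simp
  also have "\<dots> = 27 * ((t ^ 2 + k * m ^ 2) ^ 3 + 2 * h * (t - m) ^ 5 * m + \<beta> * m ^ 6)"
    by Groebner_Basis.algebra
  finally show ?thesis unfolding mult_cancel_left by (elim disjE) (simp, assumption)
qed

text \<open>The equations say that, with \<open>y = m\<^sup>2 + q\<close> and \<open>l = f + s m\<close>, the polynomial
  \<open>c = g1 y + g3 + (g0 y + g2) m\<close> in \<open>m\<close> satisfies \<open>c\<^sup>2 - l\<^sup>3 c + y\<^sup>3 = l\<close>.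
  Completing the square reduces this to the section above.\<close>

lemma E13_Z11_numbers:
  "\<exists>s f g0 g1 g2 g3 q :: complex. - f + 3 * f * g3 * q * s ^ 2 + 3 * f ^ 2 * g2 * q * s - f ^ 3 * g3 - g2 * q ^ 2 * s ^ 3 - g2 ^ 2 * q + g3 ^ 2 = 0 \<and>
    - (3 * f * g1 * s ^ 2) - 3 * f ^ 2 * g0 * s + 2 * g0 * g2 + 2 * g0 * q * s ^ 3 - g0 ^ 2 * q + g1 ^ 2 - g2 * s ^ 3 = 0 \<and>
    3 * f * g1 * q * s ^ 2 - 3 * f * g3 * s ^ 2 + 3 * f ^ 2 * g0 * q * s - 3 * f ^ 2 * g2 * s - f ^ 3 * g1 - 2 * g0 * g2 * q - g0 * q ^ 2 * s ^ 3 + 2 * g1 * g3 + 2 * g2 * q * s ^ 3 + g2 ^ 2 = 0 \<and>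
    1 - g0 * s ^ 3 + g0 ^ 2 = 0 \<and>
    3 * f * g2 * q * s ^ 2 - 3 * f ^ 2 * g3 * s - f ^ 3 * g2 + 2 * g2 * g3 + g3 * q * s ^ 3 - s = 0 \<and>
    - (3 * f * g0 * s ^ 2) + 2 * g0 * g1 - g1 * s ^ 3 = 0 \<and>
    3 * f * g0 * q * s ^ 2 - 3 * f * g2 * s ^ 2 - 3 * f ^ 2 * g1 * s - f ^ 3 * g0 + 2 * g0 * g3 + 2 * g1 * g2 + g1 * q * s ^ 3 - g3 * s ^ 3 = 0 \<and>
    450 * f * g1 * q * s ^ 2 + 450 * f ^ 2 * g0 * q * s - 225 * f ^ 2 * g2 * s - 150 * f ^ 3 * g1 - 150 * g0 * g2 * q - 150 * g0 * q ^ 2 * s ^ 3 + 150 * g1 * g3 + 75 * g2 * q * s ^ 3 + 75 * g2 ^ 2 \<noteq> 0 \<and>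
    - (135 * f * g0 * s) + 45 * g1 * s ^ 2 \<noteq> 0"
proof -
  define w where "w = csqrt 5"
  have w: "w ^ 2 = 5" unfolding w_def by (rule power2_csqrt)
  \<comment> \<open>The quadratic formula: modulo w^2 = 5 the discriminant (5 + w)^2 - 4 w is 30 + 6
    w.\<close>
  define h where "h = (csqrt (30 + 6 * w) - (5 + w)) / 2"
  have h: "h ^ 2 + (5 + w) * h + w = 0"
  proof -
    define r where "r = csqrt (30 + 6 * w)"
    have r: "r ^ 2 = 30 + 6 * w" unfolding r_def by (rule power2_csqrt)
    have "2 * h = r - (5 + w)" by (simp add: h_def r_def)
    moreover have "4 * (h ^ 2 + (5 + w) * h + w) = (2 * h) ^ 2 + 2 * (5 + w) * (2 * h) + 4 * w" by Groebner_Basis.algebra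
    ultimately have "4 * (h ^ 2 + (5 + w) * h + w) = (r - (5 + w)) ^ 2 + 2 * (5 + w) * (r - (5 + w)) + 4 * w" by simp
    also have "\<dots> = (r ^ 2 - (30 + 6 * w)) - (w ^ 2 - 5)" by Groebner_Basis.algebra
    also have "\<dots> = 0" by (simp only: r w) simp
    finally show ?thesis by (rule numeral_mult_eq_0D)
  qed
  \<comment> \<open>k and \<beta> are the constants of the section; \<sigma> is the inverse of 1 +
    k, expressed as a polynomial in h and w.\<close>
  define k \<beta> \<sigma> where "k = (10 + 3 * w + (5 - w) * h) / 3" and "\<beta> = (400 - 1632 * h + 640 * h * w - 800 * w) / 9"
    and "\<sigma> = (1 - 5 * h - 3 * h * w - w) / 16"
  have k: "3 * k = 10 + 3 * w + (5 - w) * h" and \<beta>: "9 * \<beta> = 400 - 1632 * h + 640 * h * w - 800 * w"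
    and \<sigma>16: "16 * \<sigma> = (1 - 5 * h - 3 * h * w - w)"
    by (simp_all add: k_def \<beta>_def \<sigma>_def)
  have \<sigma>: "(1 + k) * \<sigma> = 1"
  proof -
    have "(3 + 3 * k) * (16 * \<sigma>) - 48 = (7 + 2 * h + 3 * h ^ 2) * (w ^ 2 - 5) + (-10 - 10 * w) * (h ^ 2 + (5 + w) * h + w)"
      unfolding k \<sigma>16 by Groebner_Basis.algebra
    then have "(3 + 3 * k) * (16 * \<sigma>) - 48 = 0" unfolding h w by simp
    moreover have "(3 + 3 * k) * (16 * \<sigma>) - 48 = 48 * ((1 + k) * \<sigma> - 1)" by Groebner_Basis.algebra
    ultimately have "48 * ((1 + k) * \<sigma> - 1) = 0" by simp
    then show ?thesis using numeral_mult_eq_0D by fastforce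
  qed
  \<comment> \<open>An explicit multiple of 9 \<beta> is congruent to 720 modulo the equations for w
    and h, so \<beta> is a unit. The factor \<Lambda> below is treated in the same way.\<close>
  have \<beta>0: "\<beta> \<noteq> 0"
  proof -
    have "(9 * \<beta>) * (18585 + 57450 * h + 25692 * h * w + 8310 * w) - 720 = (-1486656 - 10073856 * h + 16442880 * h ^ 2) * (w ^ 2 - 5) + (-11544000 - 5161344 * w) * (h ^ 2 + (5 + w) * h + w)"
      unfolding \<beta> by Groebner_Basis.algebra
    then show ?thesis unfolding h w by auto
  qed
  have h0: "h \<noteq> 0" using h w by auto
  \<comment> \<open>The factor of the left quantum dimension whose nonvanishing is not evident; it
    appears there after \<sigma> and powers of the other nonzero constants are split off.\<close>
  define \<Lambda> where "\<Lambda> = 3 + (3 + h) * (1 - 4 * \<sigma>) + 2 * (3 + 2 * h + (5 + 2 * w)) * (2 * \<sigma> ^ 2 - \<sigma>)"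
  have \<Lambda>0: "\<Lambda> \<noteq> 0"
  proof -
    have "128 * \<Lambda> = 384 + (3 + h) * (128 - 32 * (16 * \<sigma>)) + 2 * (8 + 2 * h + 2 * w) * ((16 * \<sigma>) ^ 2 - 8 * (16 * \<sigma>))"
      unfolding \<Lambda>_def by Groebner_Basis.algebra
    moreover have "(384 + (3 + h) * (128 - 32 * (16 * \<sigma>)) + 2 * (8 + 2 * h + 2 * w) * ((16 * \<sigma>) ^ 2 - 8 * (16 * \<sigma>))) * (15 + h * w) - 2560
      = (-1168 - 324 * h + 400 * h * w + 4 * h * w ^ 2 + 3152 * h ^ 2 + 752 * h ^ 2 * w + 24 * h ^ 2 * w ^ 2 + 1228 * h ^ 3 + 288 * h ^ 3 * w + 36 * h ^ 3 * w ^ 2 + 120 * h ^ 4 + 36 * h ^ 4 * w + 60 * w) * (w ^ 2 - 5) + (2760 + 4640 * h + 1920 * h * w + 600 * h ^ 2 + 280 * h ^ 2 * w + 1768 * w) * (h ^ 2 + (5 + w) * h + w)"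
      unfolding \<sigma>16 by Groebner_Basis.algebra
    ultimately have "128 * \<Lambda> * (15 + h * w) = 2560" unfolding h w by simp
    then show ?thesis by auto
  qed
  \<comment> \<open>With c = g^3 P + l^3 / 2, y = - g^2 (t^2 + k u^2), l = S u and t - u = 1, the
    section turns c^2 - l^3 c + y^3 = l into g^6 (2 h u + \<beta> u^6) = S u + S^6 u^6 / 4.
    Comparing coefficients gives S = 2 h g^6 and 4 g^6 \<beta> = S^6, that is, the equation for
    g.\<close>
  obtain g where g: "g ^ 30 = \<beta> / (16 * h ^ 6)"
    using exists_complex_root[of 30 "\<beta> / (16 * h ^ 6)"] by auto
  have g0: "g \<noteq> 0" using g \<beta>0 h0 by (auto simp: power_0_left)
  \<comment> \<open>As (1 + k) \<sigma> = 1, t^2 + k u^2 = (1 + k) (u + \<sigma>)^2 + 1 - \<sigma>.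
    So u = \<rho> m - \<sigma> removes the linear term of y in m, \<rho>^2 g^2 = - \<sigma> makes
    the leading coefficient 1, and the constant term is q.\<close>
  define \<rho> where "\<rho> = csqrt (- \<sigma> / g ^ 2)"
  have \<rho>: "\<rho> ^ 2 * g ^ 2 = - \<sigma>" using g0 by (simp add: \<rho>_def)
  have \<sigma>0: "\<sigma> \<noteq> 0" using \<sigma> by auto
  have \<rho>0: "\<rho> \<noteq> 0" using \<rho> \<sigma>0 by auto
  define S where "S = 2 * h * g ^ 6"
  have S0: "S \<noteq> 0" using h0 g0 by (simp add: S_def)
  define s f q where "s = S * \<rho>" and "f = - (S * \<sigma>)" and "q = - (g ^ 2 * (1 - \<sigma>))"
  \<comment> \<open>A, B, C are the coefficients of u^3, u^2 and u in the cubic of the section at t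
    = u + 1. The constants e0 to e3 and l0 to l3 expand g^3 times this cubic and l^3 in the basis m
    y, y, m, 1, using m^2 = y - q.\<close>
  define A B C where "A = 1 + h + (5 + 2 * w) + h * (5 - 2 * w)" and "B = 3 + 2 * h + (5 + 2 * w)" and "C = 3 + h"
  define e0 e1 e2 e3 where "e0 = g ^ 3 * A * \<rho> ^ 3" and "e1 = g ^ 3 * \<rho> ^ 2 * (B - 3 * A * \<sigma>)"
    and "e2 = g ^ 3 * (\<rho> * (C - 2 * B * \<sigma> + 3 * A * \<sigma> ^ 2) - q * \<rho> ^ 3 * A)"
    and "e3 = g ^ 3 * (1 - C * \<sigma> + B * \<sigma> ^ 2 - A * \<sigma> ^ 3 - q * \<rho> ^ 2 * (B - 3 * A * \<sigma>))"
  define l0 l1 l2 l3 where "l0 = s ^ 3" and "l1 = 3 * f * s ^ 2" and "l2 = 3 * f ^ 2 * s - q * s ^ 3"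
    and "l3 = f ^ 3 - 3 * q * f * s ^ 2"
  define z :: complex where "z = 1 / 2"
  have z: "2 * z - 1 = 0" by (simp add: z_def)
  define g0 g1 g2 g3 where "g0 = e0 + z * l0" and "g1 = e1 + z * l1" and "g2 = e2 + z * l2" and "g3 = e3 + z * l3"
  \<comment> \<open>The left-hand side is c^2 - l^3 c + y^3 - l, sorted by powers of y and by parity
    in m; its coefficients are the relations to be proved.\<close>
  have id: "(- f + 3 * f * g3 * q * s ^ 2 + 3 * f ^ 2 * g2 * q * s - f ^ 3 * g3 - g2 * q ^ 2 * s ^ 3 - g2 ^ 2 * q + g3 ^ 2) + (3 * f * g1 * q * s ^ 2 - 3 * f * g3 * s ^ 2 + 3 * f ^ 2 * g0 * q * s - 3 * f ^ 2 * g2 * s - f ^ 3 * g1 - 2 * g0 * g2 * q - g0 * q ^ 2 * s ^ 3 + 2 * g1 * g3 + 2 * g2 * q * s ^ 3 + g2 ^ 2) * y + (- (3 * f * g1 * s ^ 2) - 3 * f ^ 2 * g0 * s + 2 * g0 * g2 + 2 * g0 * q * s ^ 3 - g0 ^ 2 * q + g1 ^ 2 - g2 * s ^ 3) * y ^ 2 + (1 - g0 * s ^ 3 + g0 ^ 2) * y ^ 3 +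
      m * ((3 * f * g2 * q * s ^ 2 - 3 * f ^ 2 * g3 * s - f ^ 3 * g2 + 2 * g2 * g3 + g3 * q * s ^ 3 - s) + (3 * f * g0 * q * s ^ 2 - 3 * f * g2 * s ^ 2 - 3 * f ^ 2 * g1 * s - f ^ 3 * g0 + 2 * g0 * g3 + 2 * g1 * g2 + g1 * q * s ^ 3 - g3 * s ^ 3) * y + (- (3 * f * g0 * s ^ 2) + 2 * g0 * g1 - g1 * s ^ 3) * y ^ 2) = 0" (is "?F = 0")
    if y: "y = m ^ 2 + q" for m y
  proof -
    define u where "u = \<rho> * m - \<sigma>"
    define t where "t = u + 1"
    define lm where "lm = S * u"
    define P where "P = t ^ 3 + h * t ^ 2 * u + (5 + 2 * w) * t * u ^ 2 + h * (5 - 2 * w) * u ^ 3"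
    define c where "c = g1 * y + g3 + (g0 * y + g2) * m"
    have c: "c = g ^ 3 * P + z * lm ^ 3"
      unfolding c_def g0_def g1_def g2_def g3_def e0_def e1_def e2_def e3_def l0_def l1_def l2_def l3_def y P_def t_def u_def
        A_def B_def C_def lm_def s_def f_def
      by Groebner_Basis.algebra
    have y': "y = - (g ^ 2 * (t ^ 2 + k * u ^ 2))"
    proof -
      have "y + g ^ 2 * (t ^ 2 + k * u ^ 2) =
        m ^ 2 * ((1 + k) * (\<rho> ^ 2 * g ^ 2 + \<sigma>) - ((1 + k) * \<sigma> - 1)) - 2 * g ^ 2 * \<rho> * m * ((1 + k) * \<sigma> - 1) + g ^ 2 * \<sigma> * ((1 + k) * \<sigma> - 1)"
        unfolding y t_def u_def q_def by Groebner_Basis.algebra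
      then show ?thesis using \<rho> \<sigma> by (simp add: add_eq_0_iff)
    qed
    have P: "P ^ 2 = (t ^ 2 + k * u ^ 2) ^ 3 + 2 * h * u + \<beta> * u ^ 6"
      using E8_section_identity[OF w h k \<beta>, of t u] by (simp add: P_def t_def)
    have \<beta>': "4 * g ^ 6 * \<beta> = S ^ 6"
    proof -
      have "16 * h ^ 6 * g ^ 30 = \<beta>" using g h0 by simp
      moreover have "S ^ 6 - 4 * g ^ 6 * \<beta> = 4 * g ^ 6 * (16 * h ^ 6 * g ^ 30 - \<beta>)"
        unfolding S_def by Groebner_Basis.algebra
      ultimately show ?thesis by simp
    qed
    have "4 * (c ^ 2 - lm ^ 3 * c + y ^ 3 - lm) = 4 * g ^ 6 * (P ^ 2 - ((t ^ 2 + k * u ^ 2) ^ 3 + 2 * h * u + \<beta> * u ^ 6))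
      + u ^ 6 * (4 * g ^ 6 * \<beta> - S ^ 6) + (2 * z - 1) * (4 * g ^ 3 * P * lm ^ 3 + (2 * z - 1) * lm ^ 6)"
      unfolding c y' lm_def S_def by Groebner_Basis.algebra
    also have "\<dots> = 0" unfolding P \<beta>' z by simp
    finally have "c ^ 2 - lm ^ 3 * c + y ^ 3 - lm = 0" by (rule numeral_mult_eq_0D)
    moreover have "lm = f + s * m" by (simp add: lm_def u_def f_def s_def algebra_simps)
    then have "?F = c ^ 2 - lm ^ 3 * c + y ^ 3 - lm"
      unfolding c_def y by Groebner_Basis.algebra
    ultimately show ?thesis by simp
  qed
  note rels = even_odd_poly_zero[where q = q, OF id]
  have L: "450 * f * g1 * q * s ^ 2 + 450 * f ^ 2 * g0 * q * s - 225 * f ^ 2 * g2 * s - 150 * f ^ 3 * g1 - 150 * g0 * g2 * q - 150 * g0 * q ^ 2 * s ^ 3 + 150 * g1 * g3 + 75 * g2 * q * s ^ 3 + 75 * g2 ^ 2 \<noteq> 0" (is "?T \<noteq> 0")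
  proof -
    have sq: "q * \<rho> ^ 2 = \<sigma> * (1 - \<sigma>)"
    proof -
      have "q * \<rho> ^ 2 - \<sigma> * (1 - \<sigma>) = - (1 - \<sigma>) * (\<rho> ^ 2 * g ^ 2 + \<sigma>)" unfolding q_def by Groebner_Basis.algebra
      then show ?thesis using \<rho> by simp
    qed
    \<comment> \<open>After a multiple of a relation is taken out, what remains is alternating and
      bilinear in the coefficients of c and of l^3, so the summand \<open>z\<close> l^3 of c drops
      out and the e's can replace the g's.\<close>
    have "?T = 75 * (3 * f * g1 * q * s ^ 2 - 3 * f * g3 * s ^ 2 + 3 * f ^ 2 * g0 * q * s - 3 * f ^ 2 * g2 * s - f ^ 3 * g1 - 2 * g0 * g2 * q - g0 * q ^ 2 * s ^ 3 + 2 * g1 * g3 + 2 * g2 * q * s ^ 3 + g2 ^ 2) - 75 * ((e1 * l3 - e3 * l1) - q * (e0 * l2 - e2 * l0))"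
      unfolding g0_def g1_def g2_def g3_def l0_def l1_def l2_def l3_def by Groebner_Basis.algebra
    also have "(e1 * l3 - e3 * l1) - q * (e0 * l2 - e2 * l0) =
       g ^ 3 * S ^ 3 * \<rho> ^ 2 * (3 * \<sigma> + C * (q * \<rho> ^ 2 - 3 * \<sigma> ^ 2) + B * 2 * \<sigma> * (\<sigma> ^ 2 - q * \<rho> ^ 2))"
      unfolding e0_def e1_def e2_def e3_def l0_def l1_def l2_def l3_def s_def f_def by Groebner_Basis.algebra
    also have "3 * \<sigma> + C * (q * \<rho> ^ 2 - 3 * \<sigma> ^ 2) + B * 2 * \<sigma> * (\<sigma> ^ 2 - q * \<rho> ^ 2) = \<sigma> * \<Lambda>"
      unfolding sq \<Lambda>_def B_def C_def by Groebner_Basis.algebra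
    finally show ?thesis using rels(2) \<Lambda>0 \<sigma>0 \<rho>0 S0 \<open>g \<noteq> 0\<close> by simp
  qed
  have R: "- (135 * f * g0 * s) + 45 * g1 * s ^ 2 \<noteq> 0"
  proof
    \<comment> \<open>Together with the relation \<open>rels(7)\<close>, vanishing would force g1
      (g0 - s^3) = 0. But g0 = s^3 contradicts 1 - g0 s^3 + g0^2 = 0, and g1 = 0 leads to f g0 =
      0.\<close>
    assume "- (135 * f * g0 * s) + 45 * g1 * s ^ 2 = 0"
    then have "45 * (s * (g1 * s - 3 * f * g0)) = 0" by (simp add: algebra_simps power2_eq_square)
    moreover have s0: "s \<noteq> 0" using S0 \<rho>0 by (simp add: s_def)
    ultimately have 1: "g1 * s - 3 * f * g0 = 0" by simp
    have "2 * g1 * (g0 - s ^ 3) = (- (3 * f * g0 * s ^ 2) + 2 * g0 * g1 - g1 * s ^ 3) - s ^ 2 * (g1 * s - 3 * f * g0)" by Groebner_Basis.algebra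
    also have "\<dots> = 0" by (simp only: rels 1) simp
    finally have "g1 * (g0 - s ^ 3) = 0" by simp
    moreover have "g0 - s ^ 3 \<noteq> 0"
    proof
      assume "g0 - s ^ 3 = 0"
      moreover have "1 = (1 - g0 * s ^ 3 + g0 ^ 2) - g0 * (g0 - s ^ 3)" by Groebner_Basis.algebra
      ultimately show False by (simp only: rels) simp
    qed
    ultimately have "g1 = 0" by simp
    with 1 have "f * g0 = 0" by simp
    moreover have "f \<noteq> 0" using S0 \<sigma>0 by (simp add: f_def)
    moreover have "g0 \<noteq> 0" using rels(4) by auto
    ultimately show False by simp
  qed
  from rels L R show ?thesis by blast
qed

text \<open>With ga = K nu the third and fourth equations become K^3 + 3 K^2 = 1 and 4 K^3 (3 K + 2)
  nu^6 = 1, while the first two amount to e = 1 / b and b^3 = 4 nu. So K, nu and b can be chosen one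
  after the other.\<close>

lemma Z13_Q11_numbers:
  "\<exists>b e ga nu i :: complex. - 1 + b * e = 0 \<and>
    - (b ^ 2) + 4 * e * nu = 0 \<and>
    3 * ga ^ 2 * nu + ga ^ 3 - nu ^ 3 = 0 \<and>
    - 1 + 8 * ga ^ 3 * nu ^ 3 + 12 * ga ^ 4 * nu ^ 2 = 0 \<and>
    1 + i ^ 2 = 0 \<and>
    72 * b ^ 2 * e * ga * i ^ 5 * nu ^ 4 + 88 * b ^ 2 * e * ga ^ 2 * i ^ 5 * nu ^ 3 + 32 * b ^ 2 * e * ga ^ 4 * i ^ 5 * nu - 96 * b ^ 2 * e ^ 4 * ga * i ^ 5 * nu ^ 5 - 32 * b ^ 2 * e ^ 4 * ga ^ 2 * i ^ 5 * nu ^ 4 + 96 * b ^ 2 * e ^ 4 * ga ^ 3 * i ^ 5 * nu ^ 3 + 64 * b ^ 2 * e ^ 4 * ga ^ 4 * i ^ 5 * nu ^ 2 - 32 * b ^ 2 * e ^ 4 * i ^ 5 * nu ^ 6 + 64 * e ^ 2 * ga * i ^ 5 * nu ^ 5 + 64 * e ^ 2 * ga ^ 2 * i ^ 5 * nu ^ 4 - 160 * e ^ 2 * ga ^ 3 * i ^ 5 * nu ^ 3 - 160 * e ^ 2 * ga ^ 4 * i ^ 5 * nu ^ 2 + 24 * e ^ 2 * i ^ 5 \<noteq> 0 \<and>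
    72 * b ^ 2 * e ^ 3 * ga * i ^ 5 - 16 * b ^ 2 * e ^ 3 * i ^ 5 * nu - 32 * b ^ 4 * e ^ 2 * i ^ 5 - 72 * e * ga * i ^ 5 - 144 * e * i ^ 5 * nu \<noteq> 0"
proof -
  \<comment> \<open>A nonnegative real root is chosen so that 3 K + 2, by which nu^6 is divided, is
    visibly nonzero.\<close>
  have "continuous_on {0..1} (\<lambda>x :: real. x ^ 3 + 3 * x ^ 2)" by (intro continuous_intros)
  then obtain K' :: real where K': "0 \<le> K'" "K' ^ 3 + 3 * K' ^ 2 = 1"
    using IVT'[of "\<lambda>x :: real. x ^ 3 + 3 * x ^ 2" 0 1 1] by auto
  define K where "K = complex_of_real K'"
  have K: "K ^ 3 + 3 * K ^ 2 = 1"
    using arg_cong[OF K'(2), of complex_of_real] by (simp add: K_def)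
  have K0: "K \<noteq> 0" using K by auto
  have "3 * K' + 2 \<noteq> 0" using K'(1) by simp
  then have "complex_of_real (3 * K' + 2) \<noteq> 0" by (simp only: of_real_eq_0_iff) simp
  then have K1: "3 * K + 2 \<noteq> 0" by (simp add: K_def)
  obtain nu where "nu ^ 6 = 1 / (4 * K ^ 3 * (3 * K + 2))" using exists_complex_root[of 6] by auto
  then have nu: "4 * K ^ 3 * (3 * K + 2) * nu ^ 6 = 1" using K0 K1 by simp
  have nu0: "nu \<noteq> 0" using nu by (auto simp: power_0_left)
  obtain b where b: "b ^ 3 = 4 * nu" using exists_complex_root[of 3 "4 * nu"] by auto
  have b0: "b \<noteq> 0" using b nu0 by (auto simp: power_0_left)
  define e ga where "e = 1 / b" and "ga = K * nu"
  have be: "b * e = 1" using b0 by (simp add: e_def)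
  have m: "b ^ 4 * e = 4 * nu" "b ^ 5 * e ^ 2 = 4 * nu" "b ^ 2 * e ^ 2 = 1" "b ^ 3 * e ^ 3 = 1" "b ^ 4 * e ^ 4 = 1"
  proof -
    have "b ^ 4 * e = b ^ 3 * (b * e)" "b ^ 5 * e ^ 2 = b ^ 3 * (b * e) ^ 2" "b ^ 2 * e ^ 2 = (b * e) ^ 2"
      "b ^ 3 * e ^ 3 = (b * e) ^ 3" "b ^ 4 * e ^ 4 = (b * e) ^ 4"
      by Groebner_Basis.algebra+
    then show "b ^ 4 * e = 4 * nu" "b ^ 5 * e ^ 2 = 4 * nu" "b ^ 2 * e ^ 2 = 1" "b ^ 3 * e ^ 3 = 1" "b ^ 4 * e ^ 4 = 1"
      unfolding be b by simp_all
  qed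
  have rels: "- 1 + b * e = 0" "- (b ^ 2) + 4 * e * nu = 0" "3 * ga ^ 2 * nu + ga ^ 3 - nu ^ 3 = 0" "- 1 + 8 * ga ^ 3 * nu ^ 3 + 12 * ga ^ 4 * nu ^ 2 = 0"
  proof -
    show "- 1 + b * e = 0" using be by simp
    have "4 * e * nu = e * (4 * nu)" by simp
    also have "\<dots> = b ^ 2 * (b * e)" unfolding b[symmetric] by Groebner_Basis.algebra
    finally show "- (b ^ 2) + 4 * e * nu = 0" unfolding be by simp
    have "3 * ga ^ 2 * nu + ga ^ 3 - nu ^ 3 = nu ^ 3 * (K ^ 3 + 3 * K ^ 2 - 1)" unfolding ga_def by Groebner_Basis.algebra
    then show "3 * ga ^ 2 * nu + ga ^ 3 - nu ^ 3 = 0" unfolding K by simp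
    have "- 1 + 8 * ga ^ 3 * nu ^ 3 + 12 * ga ^ 4 * nu ^ 2 = 4 * K ^ 3 * (3 * K + 2) * nu ^ 6 - 1" unfolding ga_def by Groebner_Basis.algebra
    then show "- 1 + 8 * ga ^ 3 * nu ^ 3 + 12 * ga ^ 4 * nu ^ 2 = 0" unfolding nu by simp
  qed
  let ?L = "72 * b ^ 2 * e * ga * \<i> ^ 5 * nu ^ 4 + 88 * b ^ 2 * e * ga ^ 2 * \<i> ^ 5 * nu ^ 3 + 32 * b ^ 2 * e * ga ^ 4 * \<i> ^ 5 * nu - 96 * b ^ 2 * e ^ 4 * ga * \<i> ^ 5 * nu ^ 5 - 32 * b ^ 2 * e ^ 4 * ga ^ 2 * \<i> ^ 5 * nu ^ 4 + 96 * b ^ 2 * e ^ 4 * ga ^ 3 * \<i> ^ 5 * nu ^ 3 + 64 * b ^ 2 * e ^ 4 * ga ^ 4 * \<i> ^ 5 * nu ^ 2 - 32 * b ^ 2 * e ^ 4 * \<i> ^ 5 * nu ^ 6 + 64 * e ^ 2 * ga * \<i> ^ 5 * nu ^ 5 + 64 * e ^ 2 * ga ^ 2 * \<i> ^ 5 * nu ^ 4 - 160 * e ^ 2 * ga ^ 3 * \<i> ^ 5 * nu ^ 3 - 160 * e ^ 2 * ga ^ 4 * \<i> ^ 5 * nu ^ 2 + 24 * e ^ 2 * \<i> ^ 5"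
    and ?R = "72 * b ^ 2 * e ^ 3 * ga * \<i> ^ 5 - 16 * b ^ 2 * e ^ 3 * \<i> ^ 5 * nu - 32 * b ^ 4 * e ^ 2 * \<i> ^ 5 - 72 * e * ga * \<i> ^ 5 - 144 * e * \<i> ^ 5 * nu"
  \<comment> \<open>The factor b^2 balances the powers of b and e, so that they occur only in the
    combinations evaluated in \<open>m\<close>; a polynomial in K and nu remains.\<close>
  have "b ^ 2 * ?L = \<i> ^ 5 *
      ((b ^ 4 * e) * (72 * ga * nu ^ 4 + 88 * ga ^ 2 * nu ^ 3 + 32 * ga ^ 4 * nu)
        + (b ^ 4 * e ^ 4) * (- (96 * ga * nu ^ 5) - 32 * ga ^ 2 * nu ^ 4 + 96 * ga ^ 3 * nu ^ 3 + 64 * ga ^ 4 * nu ^ 2 - 32 * nu ^ 6)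
        + (b ^ 2 * e ^ 2) * (64 * ga * nu ^ 5 + 64 * ga ^ 2 * nu ^ 4 - 160 * ga ^ 3 * nu ^ 3 - 160 * ga ^ 4 * nu ^ 2 + 24))"
    by Groebner_Basis.algebra
  also have "\<dots> = \<i> ^ 5 * (32 * nu ^ 6 * ((10 * K - 26) * (K ^ 3 + 3 * K ^ 2 - 1) + 9 * (10 * K ^ 2 + 2 * K - 3))
      - 24 * (4 * K ^ 3 * (3 * K + 2) * nu ^ 6 - 1))"
    unfolding m ga_def by Groebner_Basis.algebra
  also have "\<dots> = 288 * \<i> ^ 5 * nu ^ 6 * (10 * K ^ 2 + 2 * K - 3)" unfolding K nu by simp
  finally have L: "b ^ 2 * ?L = 288 * \<i> ^ 5 * nu ^ 6 * (10 * K ^ 2 + 2 * K - 3)" .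
  \<comment> \<open>This quadratic is coprime to the cubic equation of K: the cofactors in the
    following identity combine the two to the constant 3.\<close>
  have "10 * K ^ 2 + 2 * K - 3 \<noteq> 0"
  proof
    assume 0: "10 * K ^ 2 + 2 * K - 3 = 0"
    have "3 = (26 * K ^ 2 + 62 * K - 37) * (10 * K ^ 2 + 2 * K - 3) - (260 * K - 108) * (K ^ 3 + 3 * K ^ 2 - 1)"
      by Groebner_Basis.algebra
    also have "\<dots> = 0" unfolding 0 K by simp
    finally show False by simp
  qed
  with L nu0 have L0: "?L \<noteq> 0" by (metis complex_i_not_zero mult_eq_0_iff power_not_zero zero_neq_numeral)
  have "b * ?R = \<i> ^ 5 *
      (72 * ga * (b ^ 3 * e ^ 3) - 16 * nu * (b ^ 3 * e ^ 3) - 32 * (b ^ 5 * e ^ 2) - (72 * ga + 144 * nu) * (b * e))"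
    by Groebner_Basis.algebra
  also have "\<dots> = - (288 * \<i> ^ 5 * nu)" unfolding m be by Groebner_Basis.algebra
  finally have R0: "?R \<noteq> 0" using nu0 by auto
  have "1 + \<i> ^ 2 = 0" by simp
  with rels L0 R0 show ?thesis by blast
qed

theorem theorem4p1:
  shows "orbifold_equivalent 2 2
           (x_var 1 ^ 6 + x_var 2 ^ 2)
           (y_var 1 ^ 3 + y_var 2 ^ 3)
         \<and> orbifold_equivalent 2 2
           (x_var 1 ^ 5 * x_var 2 + x_var 2 ^ 3)
           (y_var 1 ^ 3 * y_var 2 + y_var 2 ^ 5)
         \<and> orbifold_equivalent 3 3
           (x_var 1 ^ 6 + x_var 1 * x_var 2 ^ 3 + x_var 3 ^ 2)
           (y_var 2 * y_var 3 ^ 3 + y_var 2 ^ 3 + y_var 1 ^ 2 * y_var 3)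
         \<and> orbifold_equivalent 3 3
           (x_var 1 ^ 2 * x_var 3 + x_var 2 * x_var 3 ^ 2 + x_var 2 ^ 4)
           (- (y_var 1 ^ 2) + y_var 2 ^ 4 + y_var 2 * y_var 3 ^ 4)
         \<and> orbifold_equivalent 2 2
           (x_var 1 ^ 10 * x_var 2 + x_var 2 ^ 3)
           (y_var 1 * y_var 2 ^ 7 + y_var 1 ^ 3 * y_var 2)"
proof (intro conjI)
  obtain k :: complex where k: "k ^ 3 = 1 / 4" using exists_complex_root[of 3 "1 / 4"] by auto
  then have "k \<noteq> 0" by auto
  obtain l :: complex where l: "l ^ 2 = 3 / (4 * k)" using exists_complex_root[of 2 "3 / (4 * k)"] by auto
  have "4 * k ^ 3 = 1" unfolding k by simp
  moreover have "4 * l ^ 2 * k = 3" unfolding l using \<open>k \<noteq> 0\<close> by simp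
  ultimately show "orbifold_equivalent 2 2 (x_var 1 ^ 6 + x_var 2 ^ 2) (y_var 1 ^ 3 + y_var 2 ^ 3)"
    by (rule orbifold_equivalent_A5_D4[unfolded var_defs])
  show "orbifold_equivalent 2 2 (x_var 1 ^ 5 * x_var 2 + x_var 2 ^ 3) (y_var 1 ^ 3 * y_var 2 + y_var 2 ^ 5)"
    using E13_Z11_numbers orbifold_equivalent_E13_Z11[unfolded var_defs] by blast
  show "orbifold_equivalent 3 3 (x_var 1 ^ 6 + x_var 1 * x_var 2 ^ 3 + x_var 3 ^ 2)
      (y_var 2 * y_var 3 ^ 3 + y_var 2 ^ 3 + y_var 1 ^ 2 * y_var 3)"
    using Z13_Q11_numbers orbifold_equivalent_Z13_Q11[unfolded var_defs] by blast
  show "orbifold_equivalent 3 3 (x_var 1 ^ 2 * x_var 3 + x_var 2 * x_var 3 ^ 2 + x_var 2 ^ 4)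
      (- (y_var 1 ^ 2) + y_var 2 ^ 4 + y_var 2 * y_var 3 ^ 4)"
    by (rule orbifold_equivalent_S11_W13[unfolded var_defs])
  show "orbifold_equivalent 2 2 (x_var 1 ^ 10 * x_var 2 + x_var 2 ^ 3) (y_var 1 * y_var 2 ^ 7 + y_var 1 ^ 3 * y_var 2)"
    by (rule orbifold_equivalent_chain_loop[unfolded var_defs])
qed

end
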